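(* Let $\alpha\in(0,2)$ and let $X,X_1,X_2,\ldots$ be i.i.d. integer valued random variables with span $1$ and distribution function $F$, and let $S_n=X_1+\dots+X_n$. Let $c,(k_n),\ell_1,A_n,C_n,\ell,\delta,M_R,M_L,\gamma_n,g_\lambda$ be as in the context, and assume that for all sufficiently large $x$ $$\mathbb P(X>x)=\frac{\ell(x)}{x^{\alpha}}[M_R(\delta(x))+h_R(x)],\qquad \mathbb P(X<-x)=\frac{\ell(x)}{x^{\alpha}}[M_L(\delta(x))+h_L(x)],$$ where $h_R,h_L$ are right-continuous functions such that $\lim_{n\to\infty}h_R(A_{k_n}x)=0$ for every continuity point $x>0$ of $M_R$ and $\lim_{n\to\infty}h_L(A_{k_n}x)=0$ for every continuity point $x>0$ of $M_L$. Then $$\lim_{n\to\infty}\ \sup_{k\in\mathbb Z}\left|A_n\,\mathbb P(S_n=k)-g_{\gamma_n}\!\left(\frac{k-C_n}{A_n}\right)\right|=0 .$$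
   Context: Span: a random variable is lattice if it is concentrated on $a+h\mathbb Z$ for some $a\in\mathbb R$, $h>0$; the largest possible such $h$ is its span. Setting: $c>1$; $(k_n)_{n\ge1}$ is a strictly increasing sequence of positive integers with $k_{n+1}/k_n\to c$. $\ell_1:[1,\infty)\to(0,\infty)$ is slowly varying at infinity, $A(x)=A_x=x^{1/\alpha}\ell_1(x)$, and $C_n=n\int_{1/n}^{1-1/n}Q(s)\,\mathrm ds$, where $Q(s)=\inf\{x:F(x)\ge s\}$, $s\in(0,1)$. For large $x$ the slowly varying function $\ell$ is defined by $x^{-\alpha}\ell(x)=\sup\{t\in(0,1]: t^{-1/\alpha}\ell_1(1/t)>x\}$. For all large $x$ there is a unique $k_n$ with $A_{k_n}\le x<A_{k_{n+1}}$, and $\delta(x)=x/A_{k_n}$. Each of $M_R,M_L:(0,\infty)\to[0,\infty)$ is either identically $0$ or is positive, bounded, bounded away from $0$, right-continuous and satisfies $M(c^{1/\alpha}x)=M(x)$ for all $x>0$; $x\mapsto M_R(x)x^{-\alpha}$ and $x\mapsto M_L(x)x^{-\alpha}$ are nonincreasing; $M_R,M_L$ are not both identically zero, and at least one of them is not constant. Position parameter: $\gamma_n=n/k_m$ where $k_{m-1}<n\le k_m$ (with the convention $k_0=0$). For $\lambda>0$ let $\Lambda_\lambda$ be the Lévy measure with $\Lambda_\lambda((x,\infty))=x^{-\alpha}M_R(\lambda^{1/\alpha}x)$ and $\Lambda_\lambda((-\infty,-x))=x^{-\alpha}M_L(\lambda^{1/\alpha}x)$, $x>0$. $V_\lambda$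 is the semistable random variable with characteristic function $$\psi_\lambda(t)=\exp\Big\{\mathrm i t a_\lambda+\int_{\mathbb R\setminus\{0\}}\big(e^{\mathrm itx}-1-\mathrm itx\,\mathbb I\{|x|\le1\}\big)\Lambda_\lambda(\mathrm dx)\Big\},$$ where the real constant $a_\lambda$ is the one for which $(S_{n_r}-C_{n_r})/A_{n_r}\to V_\lambda$ in distribution whenever $n_r\to\infty$ and $\gamma_{n_r}\to\lambda$, for $\lambda\in(c^{-1},1)$. Explicitly, for all $\lambda>0$, with $R_\lambda(s)=\inf\{x>0:\Lambda_\lambda((x,\infty))\le s\}$ and $L_\lambda(s)=\inf\{x>0:\Lambda_\lambda((-\infty,-x))\le s\}$, $s>0$, $$\log\psi_\lambda(t)=\int_0^\infty\big(e^{\mathrm itR_\lambda(s)}-1-\mathrm itR_\lambda(s)\mathbb I\{s>1\}\big)\mathrm ds+\int_0^\infty\big(e^{-\mathrm itL_\lambda(s)}-1+\mathrm itL_\lambda(s)\mathbb I\{s>1\}\big)\mathrm ds .$$ $G_\lambda$ is the distribution function of $V_\lambda$ and $g_\lambda$ its (smooth) density; $G_{c\lambda}=G_\lambda$. *)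

theory Defs
  imports "HOL-Probability.Probability"
begin

text \<open>
  Functions whose natural domain is a half-line, \<open>l\<^sub>1\<close> on \<open>[1, \<infinity>)\<close> and \<open>M\<^sub>R, M\<^sub>L, h\<^sub>R, h\<^sub>L\<close> on
  \<open>(0, \<infinity>)\<close>, are total functions \<open>real \<Rightarrow> real\<close>; all conditions below constrain them only on
  that half-line.
\<close>

subsection \<open>Lattice laws\<close>

definition concentrated_on_lattice :: "real measure \<Rightarrow> real \<Rightarrow> real \<Rightarrow> bool" where
  "concentrated_on_lattice \<mu> a h \<longleftrightarrow> h > 0 \<and> (AE x in \<mu>. \<exists>j::int. x = a + h * of_int j)"

definition has_span :: "real measure \<Rightarrow> real \<Rightarrow> bool" where
  "has_span \<mu> h \<longleftrightarrow>
     (\<exists>a. concentrated_on_lattice \<mu> a h) \<and>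
     (\<forall>a h'. concentrated_on_lattice \<mu> a h' \<longrightarrow> h' \<le> h)"

subsection \<open>Normalization and centering\<close>

text \<open>Slow variation at infinity of a positive function on \<open>[x\<^sub>0, \<infinity>)\<close>; as usual, measurability
  is part of the notion.\<close>

definition slowly_varying_on :: "real \<Rightarrow> (real \<Rightarrow> real) \<Rightarrow> bool" where
  "slowly_varying_on x0 f \<longleftrightarrow>
     f \<in> borel_measurable (restrict_space borel {x0..}) \<and>
     (\<forall>x\<ge>x0. f x > 0) \<and>
     (\<forall>y>0. ((\<lambda>x. f (y * x) / f x) \<longlongrightarrow> 1) at_top)"

definition norming :: "real \<Rightarrow> (real \<Rightarrow> real) \<Rightarrow> real \<Rightarrow> real" where
  "norming \<alpha> l\<^sub>1 x = x powr (1 / \<alpha>) * l\<^sub>1 x"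

definition quantile :: "real measure \<Rightarrow> real \<Rightarrow> real" where
  "quantile \<mu> s = Inf {x. s \<le> cdf \<mu> x}"

definition centering :: "real measure \<Rightarrow> nat \<Rightarrow> real" where
  "centering \<mu> n = real n * (LBINT s:{1 / real n..1 - 1 / real n}. quantile \<mu> s)"

definition tail_slow :: "real \<Rightarrow> (real \<Rightarrow> real) \<Rightarrow> real \<Rightarrow> real" where
  "tail_slow \<alpha> l\<^sub>1 x =
     x powr \<alpha> * Sup {t. 0 < t \<and> t \<le> 1 \<and> t powr (- (1 / \<alpha>)) * l\<^sub>1 (1 / t) > x}"

text \<open>The sequence is indexed by \<open>n \<ge> 1\<close>, with \<open>k 0 = 0\<close> by convention.  The descriptions below
  are unique for all large \<open>x\<close> and for all \<open>n \<ge> 1\<close>, respectively, which is all that matters.\<close>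

definition relative_position :: "(nat \<Rightarrow> nat) \<Rightarrow> (real \<Rightarrow> real) \<Rightarrow> real \<Rightarrow> real" where
  "relative_position k A x =
     x / A (real (k (THE n. 1 \<le> n \<and> A (real (k n)) \<le> x \<and> x < A (real (k (Suc n))))))"

definition position_parameter :: "(nat \<Rightarrow> nat) \<Rightarrow> nat \<Rightarrow> real" where
  "position_parameter k n =
     real n / real (k (THE m. 1 \<le> m \<and> k (m - 1) < n \<and> n \<le> k m))"

subsection \<open>Semistable laws\<close>

definition tail_profile :: "real \<Rightarrow> real \<Rightarrow> (real \<Rightarrow> real) \<Rightarrow> bool" where
  "tail_profile \<alpha> c M \<longleftrightarrow>
     ((\<forall>x>0. M x = 0) \<or>
      ((\<exists>a>0. \<exists>b. \<forall>x>0. a \<le> M x \<and> M x \<le> b) \<and>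
       (\<forall>x>0. continuous (at_right x) M) \<and>
       (\<forall>x>0. M (c powr (1 / \<alpha>) * x) = M x))) \<and>
     antimono_on {0<..} (\<lambda>x. M x * x powr (- \<alpha>))"

text \<open>The Levy measure \<open>\<Lambda>\<^sub>\<theta>\<close> is determined by its two tails: \<open>levy_tail \<alpha> M\<^sub>R \<theta> x\<close> is the mass
  of \<open>(x, \<infinity>)\<close> and \<open>levy_tail \<alpha> M\<^sub>L \<theta> x\<close> the mass of \<open>(-\<infinity>, -x)\<close>, for \<open>x > 0\<close>.  Accordingly
  \<open>levy_inverse\<close> yields both \<open>R\<^sub>\<theta>\<close> (from \<open>M\<^sub>R\<close>) and \<open>L\<^sub>\<theta>\<close> (from \<open>M\<^sub>L\<close>).\<close>

definition levy_tail :: "real \<Rightarrow> (real \<Rightarrow> real) \<Rightarrow> real \<Rightarrow> real \<Rightarrow> real" where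
  "levy_tail \<alpha> M \<theta> x = x powr (- \<alpha>) * M (\<theta> powr (1 / \<alpha>) * x)"

definition levy_inverse :: "real \<Rightarrow> (real \<Rightarrow> real) \<Rightarrow> real \<Rightarrow> real \<Rightarrow> real" where
  "levy_inverse \<alpha> M \<theta> s = Inf {x. 0 < x \<and> levy_tail \<alpha> M \<theta> x \<le> s}"

text \<open>The truncation \<open>s > 1\<close> in the compensator fixes the location constant of the law so that
  it matches the centering by \<open>centering\<close>.\<close>

definition semistable_exponent ::
    "real \<Rightarrow> (real \<Rightarrow> real) \<Rightarrow> (real \<Rightarrow> real) \<Rightarrow> real \<Rightarrow> real \<Rightarrow> complex" where
  "semistable_exponent \<alpha> M\<^sub>R M\<^sub>L \<theta> t =
     (let R = levy_inverse \<alpha> M\<^sub>R \<theta>; L = levy_inverse \<alpha> M\<^sub>L \<theta> in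
       (LINT s:{0<..}|lborel.
          iexp (t * R s) - 1 - \<i> * of_real (t * R s) * of_bool (s > 1)) +
       (LINT s:{0<..}|lborel.
          iexp (- (t * L s)) - 1 + \<i> * of_real (t * L s) * of_bool (s > 1)))"

definition semistable_law ::
    "real \<Rightarrow> (real \<Rightarrow> real) \<Rightarrow> (real \<Rightarrow> real) \<Rightarrow> real \<Rightarrow> real measure \<Rightarrow> bool" where
  "semistable_law \<alpha> M\<^sub>R M\<^sub>L \<theta> \<mu> \<longleftrightarrow>
     real_distribution \<mu> \<and> (\<forall>t. char \<mu> t = exp (semistable_exponent \<alpha> M\<^sub>R M\<^sub>L \<theta> t))"

text \<open>Continuity singles out one version of the density of \<open>\<mu>\<close>.\<close>

definition continuous_density :: "real measure \<Rightarrow> (real \<Rightarrow> real) \<Rightarrow> bool" where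
  "continuous_density \<mu> g \<longleftrightarrow>
     continuous_on UNIV g \<and> (\<forall>x. 0 \<le> g x) \<and> distributed \<mu> lborel (\<lambda>x. x) (\<lambda>x. ennreal (g x))"

end

theory Submission
  imports Defs
begin

text \<open>
  The proof compares Fourier transforms.  Write \<open>\<phi>\<close> for the characteristic function of a summand,
  \<open>\<gamma>\<close> for the position parameter of \<open>n\<close>, and \<open>\<psi> \<theta>\<close> for the characteristic function of
  \<open>V \<theta>\<close>.  Lattice inversion on \<open>[-\<pi>, \<pi>]\<close>, rescaled by \<open>A n\<close>, writes \<open>2 \<pi> A n P (S n = j)\<close>
  as the integral of \<open>exp (- i t x)\<close> times \<open>\<phi> (t / A n) ^ n * exp (- i t C n / A n)\<close> over
  \<open>|t| \<le> \<pi> A n\<close>, where \<open>x = (j - C n) / A n\<close>.  Inversion of an integrable characteristic function writes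
  \<open>2 \<pi> g \<gamma> x\<close> as the integral of \<open>exp (- i t x)\<close> times \<open>\<psi> \<gamma> t\<close> over the line.  The point \<open>x\<close> enters both
  only through a factor of modulus one, so the supremum over \<open>j\<close> is at most the L1 distance of the two
  transforms, and it suffices to show that this distance tends to zero.  By dominated convergence this needs
  pointwise convergence and an integrable majorant.

  \<^emph>\<open>Pointwise convergence.\<close>  Since \<open>\<gamma>\<close> stays in a compact subset of the positive half-line, one may pass to
  subsequences along which it converges to some \<open>\<theta>\<close>; then both transforms tend to \<open>\<psi> \<theta> t\<close>.
  For \<open>\<psi> \<gamma>\<close> this is continuity of the exponent in \<open>\<theta>\<close>.  For the sums it is the
  semistable limit theorem \<open>char_tendsto\<close>.  The law of a summand is the image of the uniform distribution
  under its quantile function, and near each end of the unit interval the quantiles at \<open>u / n\<close>, divided by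
  \<open>A n\<close>, converge to the inverse \<open>levy_inverse\<close> of the tail of the Levy measure at almost every \<open>u\<close>
  (\<open>quantile_tendsto\<close>).  The centering truncates the quantile function at \<open>1 / n\<close> and \<open>1 - 1 / n\<close>, which
  corresponds to the truncation at \<open>u = 1\<close> in the exponent of the limit.  Hence \<open>n\<close> times the compensated
  characteristic function of a summand converges to this exponent (\<open>char_half_exponents\<close>,
  \<open>half_exponent_tendsto\<close>).

  The convergence of the quantiles is extracted from the tails along the sequence \<open>k\<close>: the uniform convergence
  theorem for slowly varying functions (\<open>slow_variation_uniform\<close>) makes \<open>tail_slow\<close> an asymptotic
  inverse of the norming function (\<open>level_asymptotic\<close>), and the logarithmic periodicity of the profile absorbs
  the jumps of the relative position (\<open>profile_relative_position_tendsto\<close>).  The passage from the indices \<open>k m\<close> to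
  all \<open>n\<close> rescales by \<open>\<gamma>\<close>.  Potter's bound (\<open>A_potter_nat\<close>) supplies the majorant
  \<open>quantile_bound\<close>.

  \<^emph>\<open>Majorant.\<close>  The transforms \<open>\<psi> \<theta>\<close> decay like \<open>exp (- \<kappa> |t| powr \<alpha>)\<close> uniformly in \<open>\<theta>\<close>, because
  the Levy measure has mass of order \<open>|t| powr \<alpha>\<close> at distance of order \<open>1 / |t|\<close>.  For the sums the limit theorem itself
  bounds \<open>|\<phi> (s / A (k m))| ^ k m\<close> by a constant below one for all large \<open>m\<close> and \<open>s\<close> of order one.  Writing
  \<open>t / A n = s / A (k m)\<close> turns this into a bound that decays geometrically in \<open>n / k m\<close>, which is at
  least a power of \<open>|t|\<close>.  Where \<open>t / A n\<close> is bounded away from zero, the span-one hypothesis keeps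
  \<open>|\<phi>|\<close> below a constant less than one (\<open>norm_char_power_bound\<close>).
\<close>

section \<open>Slow variation\<close>

text \<open>Pointwise slow variation is turned into smallness of measure; this is where measurability
  of the slowly varying function matters.\<close>

lemma slow_variation_bad_set_measure_tendsto_0:
  fixes g :: "real \<Rightarrow> real"
  assumes [measurable]: "g \<in> borel_measurable borel"
    and g: "\<And>u. ((\<lambda>s. g (s + u) - g s) \<longlongrightarrow> 0) at_top"
    and s: "filterlim s at_top sequentially" and "\<epsilon> > 0"
  shows "(\<lambda>n. measure lborel {v \<in> {0..L}. \<epsilon> \<le> \<bar>g (s n + v) - g (s n)\<bar>}) \<longlonglongrightarrow> 0"
proof -
  define B where "B n = {v \<in> {0..L}. \<epsilon> \<le> \<bar>g (s n + v) - g (s n)\<bar>}" for n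
  have [measurable]: "B n \<in> sets borel" for n
    unfolding B_def by measurable
  have "(\<lambda>n. integral\<^sup>L lborel (indicator (B n) :: real \<Rightarrow> real)) \<longlonglongrightarrow> integral\<^sup>L lborel (\<lambda>_::real. 0 :: real)"
  proof (rule integral_dominated_convergence[where w = "indicator {0..L}"])
    show "integrable lborel (indicator {0..L} :: real \<Rightarrow> real)"
      by (simp add: integrable_indicator_iff emeasure_lborel_Icc_eq)
    show "AE v in lborel. (\<lambda>n. indicator (B n) v :: real) \<longlonglongrightarrow> 0"
    proof (rule AE_I2)
      fix v :: real
      have "(\<lambda>n. g (s n + v) - g (s n)) \<longlonglongrightarrow> 0"
        using filterlim_compose[OF g s] .
      then have "\<forall>\<^sub>F n in sequentially. \<bar>g (s n + v) - g (s n)\<bar> < \<epsilon>"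
        using \<open>\<epsilon> > 0\<close> by (auto simp: tendsto_iff dist_real_def)
      then have "\<forall>\<^sub>F n in sequentially. indicator (B n) v = (0::real)"
        by eventually_elim (auto simp: B_def)
      then show "(\<lambda>n. indicator (B n) v :: real) \<longlonglongrightarrow> 0"
        by (rule tendsto_eventually)
    qed
    show "AE v in lborel. norm (indicator (B n) v :: real) \<le> indicator {0..L} v" for n
      by (auto simp: B_def indicator_def)
  qed simp_all
  then show ?thesis by (simp add: B_def)
qed

text \<open>The uniform convergence theorem.  If an increment over the window starting at \<open>s\<close> and one over
  the window starting at \<open>s + u\<close> are both small at a common point \<open>z\<close>, then
  \<open>g (s + u) - g s\<close> is small.  The two sets of good points have almost full measure
  in windows that overlap in an interval of length at least one, so that they meet.\<close>

lemma slow_variation_uniform: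
  fixes g :: "real \<Rightarrow> real"
  assumes [measurable]: "g \<in> borel_measurable borel"
    and g: "\<And>u. ((\<lambda>s. g (s + u) - g s) \<longlongrightarrow> 0) at_top"
    and "\<epsilon> > 0" and "B \<ge> 0"
  shows "\<exists>S. \<forall>s\<ge>S. \<forall>u. \<bar>u\<bar> \<le> B \<longrightarrow> \<bar>g (s + u) - g s\<bar> < \<epsilon>"
proof (rule ccontr)
  assume "\<not> ?thesis"
  then have "\<forall>n::nat. \<exists>s u. s \<ge> real n \<and> \<bar>u\<bar> \<le> B \<and> \<epsilon> \<le> \<bar>g (s + u) - g s\<bar>"
    by (meson not_less)
  then obtain s u where su: "\<And>n::nat. s n \<ge> real n" "\<And>n. \<bar>u n\<bar> \<le> B" "\<And>n. \<epsilon> \<le> \<bar>g (s n + u n) - g (s n)\<bar>"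
    by metis
  have s: "filterlim s at_top sequentially"
    by (rule filterlim_at_top_mono[OF filterlim_real_sequentially]) (simp add: su)
  have su_top: "filterlim (\<lambda>n. s n + u n) at_top sequentially"
  proof (rule filterlim_at_top_mono)
    show "filterlim (\<lambda>n. real n + (- B)) at_top sequentially"
      using filterlim_tendsto_add_at_top[OF tendsto_const[of "- B"] filterlim_real_sequentially]
      by (simp add: add.commute)
    show "\<forall>\<^sub>F n in sequentially. real n + (- B) \<le> s n + u n"
    proof (intro always_eventually allI)
      show "real n + (- B) \<le> s n + u n" for n
        using su(1)[of n] su(2)[of n] by linarith
    qed
  qed
  (* Long enough that {B..2*B+1} and its translates by every u with |u| <= B lie in {0..L}. *)
  define L where "L = 3 * B + 1"
  define V where "V n = {v \<in> {0..L}. \<epsilon>/2 \<le> \<bar>g (s n + v) - g (s n)\<bar>}" for n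
  define W where "W n = {v \<in> {0..L}. \<epsilon>/2 \<le> \<bar>g (s n + u n + v) - g (s n + u n)\<bar>}" for n
  have VW: "V n \<in> sets lborel" "W n \<in> sets lborel" for n
    unfolding V_def W_def by measurable
  have "(\<lambda>n. measure lborel (V n)) \<longlonglongrightarrow> 0" "(\<lambda>n. measure lborel (W n)) \<longlonglongrightarrow> 0"
    unfolding V_def W_def using \<open>\<epsilon> > 0\<close>
    by (intro slow_variation_bad_set_measure_tendsto_0 assms(1) g s su_top; simp)+
  then have "\<forall>\<^sub>F n in sequentially. measure lborel (V n) < 1/2 \<and> measure lborel (W n) < 1/2"
    by (intro eventually_conj order_tendstoD(2)) auto
  then obtain n where n: "measure lborel (V n) < 1/2" "measure lborel (W n) < 1/2"
    by (auto dest: eventually_happens)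
  let ?V = "(+) (u n) -` V n"
  have V': "?V \<in> sets lborel" "measure lborel ?V = measure lborel (V n)"
  proof -
    show "?V \<in> sets lborel" using measurable_sets[of "(+) (u n)" borel borel "V n"] VW(1)[of n] by simp
    have "emeasure lborel (V n) = emeasure (distr lborel borel ((+) (u n))) (V n)"
      by (simp add: lborel_distr_plus)
    also have "\<dots> = emeasure lborel ?V"
      using VW(1)[of n] by (subst emeasure_distr) (auto simp: vimage_def)
    finally show "measure lborel ?V = measure lborel (V n)"
      by (simp add: measure_def)
  qed
  have fin: "W n \<in> fmeasurable lborel" "?V \<in> fmeasurable lborel"
  proof -
    have *: "A \<in> fmeasurable lborel" if "A \<in> sets lborel" "A \<subseteq> {p..q}" for A and p q :: real
    proof (rule fmeasurableI2)
      show "{p..q} \<in> fmeasurable lborel"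
        by (simp add: fmeasurable_def emeasure_lborel_Icc_eq)
    qed (use that in simp_all)
    have "W n \<subseteq> {0..L}" "?V \<subseteq> {- u n..L - u n}"
      by (auto simp: W_def V_def)
    then show "W n \<in> fmeasurable lborel" "?V \<in> fmeasurable lborel"
      using *[OF VW(2)] *[OF V'(1)] by blast+
  qed
  have "\<not> {B..2*B+1} \<subseteq> W n \<union> ?V"
  proof
    assume "{B..2*B+1} \<subseteq> W n \<union> ?V"
    then have "measure lborel {B..2*B+1} \<le> measure lborel (W n \<union> ?V)"
      using fin by (intro measure_mono_fmeasurable) auto
    also have "\<dots> \<le> measure lborel (W n) + measure lborel ?V"
      using VW V' by (intro measure_Un_le) auto
    finally show False
      using n V'(2) \<open>B \<ge> 0\<close> by simp
  qed
  then obtain v where v: "v \<in> {B..2*B+1}" "v \<notin> W n" "v \<notin> ?V"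
    by blast
  have "\<bar>g (s n + u n + v) - g (s n + u n)\<bar> < \<epsilon>/2" "\<bar>g (s n + u n + v) - g (s n)\<bar> < \<epsilon>/2"
    using v su(2)[of n] by (auto simp: W_def V_def L_def add.assoc)
  then show False using su(3)[of n] by (simp add: abs_if split: if_splits)
qed

text \<open>Chaining unit steps turns local uniformity into a linear bound on all increments; in the
  multiplicative scale this is Potter's bound.\<close>

lemma slow_variation_potter:
  fixes g :: "real \<Rightarrow> real"
  assumes [measurable]: "g \<in> borel_measurable borel"
    and g: "\<And>u. ((\<lambda>s. g (s + u) - g s) \<longlongrightarrow> 0) at_top"
    and "\<epsilon> > 0"
  shows "\<exists>S. \<forall>s\<ge>S. \<forall>u\<ge>0. \<bar>g (s + u) - g s\<bar> \<le> \<epsilon> * (1 + u)"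
proof -
  obtain S where S: "\<And>s u. s \<ge> S \<Longrightarrow> \<bar>u\<bar> \<le> 1 \<Longrightarrow> \<bar>g (s + u) - g s\<bar> < \<epsilon>"
    using slow_variation_uniform[OF assms, of 1] by auto
  have step: "\<bar>g (s + real n) - g s\<bar> \<le> \<epsilon> * real n" if "s \<ge> S" for s n
  proof (induction n)
    case (Suc n)
    have "\<bar>g (s + real n + 1) - g (s + real n)\<bar> < \<epsilon>"
      using that by (intro S) auto
    then show ?case using Suc by (simp add: algebra_simps abs_if split: if_splits)
  qed simp
  show ?thesis
  proof (intro exI[of _ S] allI impI)
    fix s u :: real assume "S \<le> s" "0 \<le> u"
    define n where "n = nat \<lfloor>u\<rfloor>"
    have n: "real n \<le> u" "u < real n + 1" using \<open>0 \<le> u\<close> by (auto simp: n_def)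
    have "\<bar>g (s + real n + (u - real n)) - g (s + real n)\<bar> < \<epsilon>"
      using n \<open>S \<le> s\<close> by (intro S) auto
    moreover have "\<epsilon> * real n \<le> \<epsilon> * u" using n \<open>\<epsilon> > 0\<close> by simp
    moreover have "\<epsilon> * (1 + u) = \<epsilon> + \<epsilon> * u" by (simp add: algebra_simps)
    moreover have "g (s + real n + (u - real n)) = g (s + u)" by simp
    ultimately show "\<bar>g (s + u) - g s\<bar> \<le> \<epsilon> * (1 + u)"
      using step[OF \<open>S \<le> s\<close>, of n] by linarith
  qed
qed

section \<open>Regularly varying norming functions\<close>

locale regular_norming =
  fixes \<alpha> :: real and l\<^sub>1 :: "real \<Rightarrow> real"
  assumes \<alpha>_pos: "0 < \<alpha>"
    and slow: "slowly_varying_on 1 l\<^sub>1"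
begin

abbreviation A :: "real \<Rightarrow> real" where
  "A \<equiv> norming \<alpha> l\<^sub>1"

lemma l1_pos: "x \<ge> 1 \<Longrightarrow> l\<^sub>1 x > 0"
  using slow by (simp add: slowly_varying_on_def)

lemma A_pos: "x \<ge> 1 \<Longrightarrow> A x > 0"
  using l1_pos[of x] by (simp add: norming_def)

lemma ln_A: "x \<ge> 1 \<Longrightarrow> ln (A x) = ln x / \<alpha> + ln (l\<^sub>1 x)"
  using l1_pos[of x] by (simp add: norming_def ln_mult)

text \<open>In logarithmic coordinates slow variation becomes a statement about additive increments; the value
  zero on the negative half-line makes the function Borel measurable on the whole line.\<close>

definition log_slow :: "real \<Rightarrow> real" where
  "log_slow s = (if 0 \<le> s then ln (l\<^sub>1 (exp s)) else 0)"

lemma log_slow_measurable [measurable]: "log_slow \<in> borel_measurable borel"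
proof -
  have [measurable]: "(\<lambda>x. l\<^sub>1 x * indicator {1..} x) \<in> borel_measurable borel"
    using slow borel_measurable_restrict_space_iff[of "{1::real..}" borel l\<^sub>1]
    by (simp add: slowly_varying_on_def mult.commute)
  have "log_slow = (\<lambda>s. if 0 \<le> s then ln ((\<lambda>x. l\<^sub>1 x * indicator {1..} x) (exp s)) else 0)"
    by (auto simp: log_slow_def fun_eq_iff indicator_def)
  then show ?thesis by simp
qed

lemma log_slow_increments: "((\<lambda>s. log_slow (s + u) - log_slow s) \<longlongrightarrow> 0) at_top"
proof -
  have "((\<lambda>x. l\<^sub>1 (exp u * x) / l\<^sub>1 x) \<longlongrightarrow> 1) at_top"
    using slow by (simp add: slowly_varying_on_def)
  then have "((\<lambda>x. ln (l\<^sub>1 (exp u * x) / l\<^sub>1 x)) \<longlongrightarrow> ln 1) at_top"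
    by (intro tendsto_ln) auto
  then have "((\<lambda>s. ln (l\<^sub>1 (exp u * exp s) / l\<^sub>1 (exp s))) \<longlongrightarrow> 0) at_top"
    using filterlim_compose[OF _ exp_at_top] by fastforce
  moreover have "\<forall>\<^sub>F s in at_top. ln (l\<^sub>1 (exp u * exp s) / l\<^sub>1 (exp s)) = log_slow (s + u) - log_slow s"
    using eventually_ge_at_top[of "\<bar>u\<bar>"]
  proof eventually_elim
    case (elim s)
    then have "l\<^sub>1 (exp (s + u)) > 0" "l\<^sub>1 (exp s) > 0"
      by (auto intro!: l1_pos)
    moreover have "0 \<le> s" "0 \<le> s + u" using elim by linarith+
    ultimately show ?case
      by (simp add: log_slow_def ln_div mult_exp_exp add.commute)
  qed
  ultimately show ?thesis
    by (rule Lim_transform_eventually)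
qed

lemma log_slow_ln: "x \<ge> 1 \<Longrightarrow> log_slow (ln x) = ln (l\<^sub>1 x)"
  by (simp add: log_slow_def)

text \<open>Potter's bound for the norming function, with error terms that can be made small both
  additively and in the exponent.\<close>

lemma log_A_increment:
  assumes "\<epsilon> > 0"
  obtains X\<^sub>0 where "X\<^sub>0 \<ge> 1"
    "\<And>w z. X\<^sub>0 \<le> w \<Longrightarrow> w \<le> z \<Longrightarrow> \<bar>ln (A z) - ln (A w) - ln (z / w) / \<alpha>\<bar> \<le> \<epsilon> * (1 + ln (z / w))"
proof -
  obtain S where S: "\<And>s u. s \<ge> S \<Longrightarrow> u \<ge> 0 \<Longrightarrow> \<bar>log_slow (s + u) - log_slow s\<bar> \<le> \<epsilon> * (1 + u)"
    using slow_variation_potter[OF log_slow_measurable log_slow_increments assms] by auto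
  show thesis
  proof (rule that[of "max 1 (exp S)"])
    fix w z :: real assume wz: "max 1 (exp S) \<le> w" "w \<le> z"
    then have "ln w \<ge> S" by (simp add: ln_ge_iff)
    moreover have "ln (z / w) \<ge> 0" using wz by simp
    ultimately have "\<bar>log_slow (ln w + ln (z / w)) - log_slow (ln w)\<bar> \<le> \<epsilon> * (1 + ln (z / w))"
      by (intro S)
    moreover have "ln w + ln (z / w) = ln z" using wz by (simp add: ln_div)
    ultimately show "\<bar>ln (A z) - ln (A w) - ln (z / w) / \<alpha>\<bar> \<le> \<epsilon> * (1 + ln (z / w))"
      using wz by (simp add: ln_A log_slow_ln ln_div diff_divide_distrib)
  qed simp
qed

text \<open>Uniformity in the multiplier is what allows \<open>y\<close> to vary with the index.\<close>

lemma A_ratio_tendsto: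
  assumes x: "filterlim x at_top sequentially" and y: "y \<longlonglongrightarrow> b" and "b > 0"
  shows "(\<lambda>r. A (y r * x r) / A (x r)) \<longlonglongrightarrow> b powr (1 / \<alpha>)"
proof -
  have lny: "(\<lambda>r. ln (y r)) \<longlonglongrightarrow> ln b"
    using y \<open>b > 0\<close> by (intro tendsto_ln) auto
  have y2: "\<forall>\<^sub>F r in sequentially. b / 2 < y r"
    using order_tendstoD(1)[OF y, of "b/2"] \<open>b > 0\<close> by simp
  have x1: "\<forall>\<^sub>F r in sequentially. x r \<ge> Z" for Z
    using x by (simp add: filterlim_at_top)
  have "(\<lambda>r. log_slow (ln (x r) + ln (y r)) - log_slow (ln (x r))) \<longlonglongrightarrow> 0"
  proof (rule tendstoI)
    fix \<epsilon> :: real assume "\<epsilon> > 0"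
    define B where "B = \<bar>ln b\<bar> + 1"
    obtain S where S: "\<And>s u. s \<ge> S \<Longrightarrow> \<bar>u\<bar> \<le> B \<Longrightarrow> \<bar>log_slow (s + u) - log_slow s\<bar> < \<epsilon>"
      using slow_variation_uniform[OF log_slow_measurable log_slow_increments \<open>\<epsilon> > 0\<close>, of B]
      by (auto simp: B_def)
    have "\<forall>\<^sub>F r in sequentially. dist (ln (y r)) (ln b) < 1"
      using lny by (rule tendstoD) simp
    then show "\<forall>\<^sub>F r in sequentially. dist (log_slow (ln (x r) + ln (y r)) - log_slow (ln (x r))) 0 < \<epsilon>"
      using x1[of "exp S"] x1[of 1]
    proof eventually_elim
      case (elim r)
      have "ln (x r) \<ge> S" using elim by (simp add: ln_ge_iff)
      moreover have "\<bar>ln (y r)\<bar> \<le> B" using elim by (simp add: B_def dist_real_def)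
      ultimately show ?case using S by (simp add: dist_real_def)
    qed
  qed
  then have "(\<lambda>r. exp (ln (y r) / \<alpha> + (log_slow (ln (x r) + ln (y r)) - log_slow (ln (x r))))) \<longlonglongrightarrow> exp (ln b / \<alpha> + 0)"
    using \<alpha>_pos by (intro tendsto_exp tendsto_add tendsto_divide lny tendsto_const) auto
  moreover have "\<forall>\<^sub>F r in sequentially. exp (ln (y r) / \<alpha> + (log_slow (ln (x r) + ln (y r)) - log_slow (ln (x r)))) = A (y r * x r) / A (x r)"
    using y2 x1[of "max 1 (2 / b)"]
  proof eventually_elim
    case (elim r)
    then have yx: "y r > 0" "x r \<ge> 1" using \<open>b > 0\<close> by auto
    have "y r * x r \<ge> (b / 2) * (2 / b)"
      using elim \<open>b > 0\<close> by (intro mult_mono) auto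
    then have xy: "y r * x r \<ge> 1" using \<open>b > 0\<close> by simp
    have "ln (x r) + ln (y r) = ln (y r * x r)"
      using yx by (simp add: ln_mult)
    then have "log_slow (ln (x r) + ln (y r)) = ln (l\<^sub>1 (y r * x r))"
      using log_slow_ln[OF xy] by (simp only:)
    then have "ln (y r) / \<alpha> + (log_slow (ln (x r) + ln (y r)) - log_slow (ln (x r))) = ln (A (y r * x r)) - ln (A (x r))"
      using xy yx by (simp add: log_slow_ln ln_A ln_mult add_divide_distrib)
    then show ?case
      using A_pos[OF xy] A_pos[OF yx(2)] by (simp add: exp_diff)
  qed
  ultimately show ?thesis
    using \<open>b > 0\<close> by (simp add: powr_def Lim_transform_eventually)
qed

text \<open>The norming function need not be monotone; this is the substitute for monotonicity when it
  is inverted.\<close>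

lemma A_almost_increasing:
  assumes "\<epsilon> > 0"
  obtains X\<^sub>0 where "X\<^sub>0 \<ge> 1" "\<And>w z. X\<^sub>0 \<le> w \<Longrightarrow> w \<le> z \<Longrightarrow> A w \<le> (1 + \<epsilon>) * A z"
proof -
  define e where "e = min (1 / \<alpha>) (ln (1 + \<epsilon>))"
  have "e > 0" using assms \<alpha>_pos by (simp add: e_def)
  then obtain X\<^sub>0 where X: "X\<^sub>0 \<ge> 1"
    "\<And>w z. X\<^sub>0 \<le> w \<Longrightarrow> w \<le> z \<Longrightarrow> \<bar>ln (A z) - ln (A w) - ln (z / w) / \<alpha>\<bar> \<le> e * (1 + ln (z / w))"
    using log_A_increment by blast
  show thesis
  proof (rule that[OF X(1)])
    fix w z assume wz: "X\<^sub>0 \<le> w" "w \<le> z"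
    have pos: "w \<ge> 1" "z \<ge> 1" using X(1) wz by auto
    have "e * ln (z / w) \<le> (1 / \<alpha>) * ln (z / w)"
      using wz pos by (intro mult_right_mono) (auto simp: e_def)
    then have "ln (A w) \<le> ln (A z) + e"
      using X(2)[OF wz] by (auto simp: algebra_simps abs_le_iff)
    also have "\<dots> \<le> ln (A z) + ln (1 + \<epsilon>)"
      by (simp add: e_def)
    also have "\<dots> = ln ((1 + \<epsilon>) * A z)"
      using A_pos[OF pos(2)] assms by (simp add: ln_mult)
    finally show "A w \<le> (1 + \<epsilon>) * A z"
      using A_pos[OF pos(1)] A_pos[OF pos(2)] assms by (subst (asm) ln_le_cancel_iff) auto
  qed
qed

lemma A_at_top: "filterlim A at_top at_top"
proof -
  obtain X\<^sub>0 where X: "X\<^sub>0 \<ge> 1"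
    "\<And>w z. X\<^sub>0 \<le> w \<Longrightarrow> w \<le> z \<Longrightarrow> \<bar>ln (A z) - ln (A w) - ln (z / w) / \<alpha>\<bar> \<le> 1 / (2 * \<alpha>) * (1 + ln (z / w))"
    using log_A_increment[of "1 / (2 * \<alpha>)"] \<alpha>_pos by auto
  have "filterlim (\<lambda>z. exp (ln (A X\<^sub>0) + (ln z - ln X\<^sub>0 - 1) * (1 / (2 * \<alpha>)))) at_top at_top"
  proof (rule filterlim_compose[OF exp_at_top])
    have "filterlim (\<lambda>z::real. ln z + (- ln X\<^sub>0 - 1)) at_top at_top"
      using filterlim_tendsto_add_at_top[OF tendsto_const[of "- ln X\<^sub>0 - 1"] ln_at_top]
      by (simp add: add.commute)
    then have "filterlim (\<lambda>z::real. (ln z + (- ln X\<^sub>0 - 1)) * (1 / (2 * \<alpha>))) at_top at_top"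
      using \<alpha>_pos
      by (subst mult.commute) (intro filterlim_tendsto_pos_mult_at_top[OF tendsto_const]; simp)
    then have "filterlim (\<lambda>z::real. ln (A X\<^sub>0) + (ln z + (- ln X\<^sub>0 - 1)) * (1 / (2 * \<alpha>))) at_top at_top"
      by (rule filterlim_tendsto_add_at_top[OF tendsto_const])
    then show "filterlim (\<lambda>z. ln (A X\<^sub>0) + (ln z - ln X\<^sub>0 - 1) * (1 / (2 * \<alpha>))) at_top at_top"
      by (simp add: algebra_simps)
  qed
  then show ?thesis
  proof (rule filterlim_at_top_mono)
    show "\<forall>\<^sub>F z in at_top. exp (ln (A X\<^sub>0) + (ln z - ln X\<^sub>0 - 1) * (1 / (2 * \<alpha>))) \<le> A z"
      using eventually_ge_at_top[of X\<^sub>0]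
    proof eventually_elim
      case (elim z)
      have z: "z \<ge> 1" using elim X(1) by simp
      have "ln (z / X\<^sub>0) = ln z - ln X\<^sub>0" using z X(1) by (simp add: ln_div)
      then have "ln (A z) \<ge> ln (A X\<^sub>0) + (ln z - ln X\<^sub>0) / \<alpha> - 1 / (2 * \<alpha>) * (1 + (ln z - ln X\<^sub>0))"
        using X(2)[OF order_refl elim] by (auto simp: abs_le_iff)
      also have "ln (A X\<^sub>0) + (ln z - ln X\<^sub>0) / \<alpha> - 1 / (2 * \<alpha>) * (1 + (ln z - ln X\<^sub>0)) = ln (A X\<^sub>0) + (ln z - ln X\<^sub>0 - 1) * (1 / (2 * \<alpha>))"
        using \<alpha>_pos by (simp add: field_simps)
      finally show ?case
        using A_pos[OF z] by (subst (asm) ln_ge_iff) auto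
    qed
  qed
qed

text \<open>A single polynomial bound that is valid for all pairs of indices: the first summand dominates
  for \<open>m \<ge> n\<close>, the second for \<open>m \<le> n\<close>.\<close>

lemma A_potter_nat:
  assumes "p < 1 / \<alpha>" "1 / \<alpha> < q" "0 < p"
  obtains C where "C > 0"
    "\<And>m n :: nat. 1 \<le> m \<Longrightarrow> 1 \<le> n \<Longrightarrow>
       A (real m) \<le> C * A (real n) * ((real m / real n) powr q + (real m / real n) powr p)"
proof -
  define e where "e = min (q - 1 / \<alpha>) (1 / \<alpha> - p)"
  have "e > 0" using assms by (simp add: e_def)
  then obtain X\<^sub>0 where X: "X\<^sub>0 \<ge> 1"
    "\<And>w z. X\<^sub>0 \<le> w \<Longrightarrow> w \<le> z \<Longrightarrow> \<bar>ln (A z) - ln (A w) - ln (z / w) / \<alpha>\<bar> \<le> e * (1 + ln (z / w))"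
    using log_A_increment by blast
  define N where "N = nat \<lceil>X\<^sub>0\<rceil>"
  have N: "real N \<ge> X\<^sub>0" "N \<ge> 1" using X(1) unfolding N_def by linarith+
  have large: "A m \<le> exp e * A n * ((m / n) powr q + (m / n) powr p)" if "X\<^sub>0 \<le> m" "X\<^sub>0 \<le> n" for m n :: real
  proof -
    have mn: "m \<ge> 1" "n \<ge> 1" using that X(1) by auto
    have "ln (A m) \<le> e + ln (A n) + ln ((m / n) powr q) \<or> ln (A m) \<le> e + ln (A n) + ln ((m / n) powr p)"
    proof (cases "n \<le> m")
      case True
      define v where "v = ln (m / n)"
      have "v \<ge> 0" using True mn by (simp add: v_def)
      then have "e * v \<le> (q - 1 / \<alpha>) * v" by (intro mult_right_mono) (auto simp: e_def)
      then have "ln (A m) \<le> e + ln (A n) + q * v"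
        using X(2)[OF that(2) True] unfolding v_def[symmetric] by (auto simp: algebra_simps abs_le_iff)
      then show ?thesis using mn by (simp add: v_def ln_powr)
    next
      case False
      define v where "v = ln (n / m)"
      have "v \<ge> 0" using False mn by (simp add: v_def)
      then have "e * v \<le> (1 / \<alpha> - p) * v" by (intro mult_right_mono) (auto simp: e_def)
      then have "ln (A m) \<le> e + ln (A n) + p * (- v)"
        using X(2)[OF that(1), of n] False unfolding v_def[symmetric] by (auto simp: algebra_simps abs_le_iff)
      moreover have "- v = ln (m / n)" using mn by (simp add: v_def ln_div)
      ultimately show ?thesis using mn by (simp add: ln_powr)
    qed
    moreover have "e + ln (A n) + ln ((m / n) powr r) = ln (exp e * A n * (m / n) powr r)" for r
      using A_pos[OF mn(2)] mn by (simp add: ln_mult)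
    ultimately have "ln (A m) \<le> ln (exp e * A n * (m / n) powr q) \<or> ln (A m) \<le> ln (exp e * A n * (m / n) powr p)"
      by simp
    then have "A m \<le> exp e * A n * (m / n) powr q \<or> A m \<le> exp e * A n * (m / n) powr p"
      using A_pos[OF mn(1)] A_pos[OF mn(2)] mn by (subst (asm) (1 2) ln_le_cancel_iff) auto
    moreover have "0 \<le> exp e * A n * (m / n) powr r" for r
      using A_pos[OF mn(2)] by simp
    ultimately show ?thesis
      by (auto simp: distrib_left intro: add_increasing add_increasing2)
  qed
  have A1: "A (real n) > 0" if "n \<ge> 1" for n using A_pos that by simp
  define D where "D = 1 + (\<Sum>i\<in>{1..N}. A i / A N + A N / A i)"
  have D: "A i \<le> D * A N \<and> A N \<le> D * A i" if "i \<in> {1..N}" for i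
  proof -
    have nn: "0 \<le> A i / A N" "0 \<le> A N / A i" if "i \<in> {1..N}" for i
      using that A1[of i] A1[of N] N by auto
    have "A i / A N + A N / A i \<le> (\<Sum>i\<in>{1..N}. A i / A N + A N / A i)"
      using that nn by (intro member_le_sum) auto
    then have "A i / A N \<le> D" "A N / A i \<le> D"
      using nn[OF that] by (auto simp: D_def)
    then show ?thesis using that A1[of i] A1[of N] N by (auto simp: field_simps)
  qed
  have "D \<ge> 1"
  proof -
    have "0 \<le> A (real i) / A (real N) + A (real N) / A (real i)" if "i \<in> {1..N}" for i
      using that A1[of i] A1[of N] N(2) by (intro add_nonneg_nonneg divide_nonneg_nonneg) auto
    then have "0 \<le> (\<Sum>i\<in>{1..N}. A (real i) / A (real N) + A (real N) / A (real i))"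
      by (rule sum_nonneg)
    then show ?thesis unfolding D_def by linarith
  qed
  have up: "A (real m) \<le> D * A (real (max m N))" if "m \<ge> 1" for m
    using D[of m] that \<open>D \<ge> 1\<close> A1[OF that] by (cases "m \<le> N") (auto simp: max_def)
  have down: "A (real (max m N)) \<le> D * A (real m)" if "m \<ge> 1" for m
    using D[of m] that \<open>D \<ge> 1\<close> A1[OF that] by (cases "m \<le> N") (auto simp: max_def)
  define C where "C = D * exp e * D * real N powr q"
  show thesis
  proof (rule that[of C])
    show "C > 0" using \<open>D \<ge> 1\<close> N by (simp add: C_def)
    fix m n :: nat assume mn: "1 \<le> m" "1 \<le> n"
    have "max m N \<le> m * N" using mn N by simp
    then have "real (max m N) \<le> real m * real N"
      by (metis of_nat_le_iff of_nat_mult)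
    then have "real (max m N) / real (max n N) \<le> real m * real N / real n"
      using mn by (intro frac_le) auto
    then have ratio: "real (max m N) / real (max n N) \<le> real N * (real m / real n)"
      by (simp add: mult.commute)
    have pw: "(real (max m N) / real (max n N)) powr r \<le> real N powr q * (real m / real n) powr r" if "0 < r" "r \<le> q" for r
    proof -
      have "(real (max m N) / real (max n N)) powr r \<le> (real N * (real m / real n)) powr r"
        using ratio mn that by (intro powr_mono2) auto
      also have "\<dots> = real N powr r * (real m / real n) powr r"
        by (rule powr_mult)
      also have "\<dots> \<le> real N powr q * (real m / real n) powr r"
        using that N by (intro mult_right_mono powr_mono) auto
      finally show ?thesis .
    qed
    have "A (real m) \<le> D * A (real (max m N))" by (rule up) fact
    also have "\<dots> \<le> D * (exp e * A (real (max n N)) * ((real (max m N) / real (max n N)) powr q + (real (max m N) / real (max n N)) powr p))"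
      using \<open>D \<ge> 1\<close> N by (intro mult_left_mono large) auto
    also have "\<dots> \<le> D * (exp e * (D * A n) * (real N powr q * (real m / real n) powr q + real N powr q * (real m / real n) powr p))"
      using \<open>D \<ge> 1\<close> down[OF mn(2)] A1[OF mn(2)] A1[of "max n N"] mn assms
      by (intro mult_left_mono mult_mono add_mono pw) (auto intro!: mult_nonneg_nonneg)
    also have "\<dots> = C * A n * ((real m / real n) powr q + (real m / real n) powr p)"
      by (simp add: C_def algebra_simps)
    finally show "A (real m) \<le> C * A (real n) * ((real m / real n) powr q + (real m / real n) powr p)" .
  qed
qed

end

section \<open>Geometric blocks\<close>

locale geometric_norming = regular_norming +
  fixes c :: real and k :: "nat \<Rightarrow> nat"
  assumes c_gt_1: "c > 1"
    and k0: "k 0 = 0" and k_mono: "strict_mono k"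
    and k_ratio: "(\<lambda>n. real (k (Suc n)) / real (k n)) \<longlonglongrightarrow> c"
begin

lemma k_ge: "n \<le> k n"
  using k_mono by (rule strict_mono_imp_increasing)

lemma k_pos: "1 \<le> n \<Longrightarrow> 1 \<le> k n"
  using k_ge[of n] by simp

lemma k_at_top: "filterlim (\<lambda>n. real (k n)) at_top sequentially"
  using filterlim_subseq[OF k_mono] by (rule filterlim_compose[OF filterlim_real_sequentially])

lemma A_k_at_top: "filterlim (\<lambda>n. A (real (k n))) at_top sequentially"
  by (rule filterlim_compose[OF A_at_top k_at_top])

text \<open>Since \<open>i\<close> may be negative, the value is truncated at zero; for given \<open>i\<close> this concerns only finitely
  many \<open>m\<close>.\<close>

definition shift :: "int \<Rightarrow> nat \<Rightarrow> nat" where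
  "shift i m = nat (int m + i)"

lemma shift_at_top: "filterlim (shift i) sequentially sequentially"
  unfolding filterlim_at_top
proof
  fix Z
  show "\<forall>\<^sub>F m in sequentially. Z \<le> shift i m"
    using eventually_ge_at_top[of "Z + nat \<bar>i\<bar>"] by eventually_elim (auto simp: shift_def)
qed

lemma eventually_shift_Suc: "\<forall>\<^sub>F m in sequentially. shift (i + 1) m = Suc (shift i m)"
  using eventually_ge_at_top[of "nat \<bar>i\<bar>"] by eventually_elim (auto simp: shift_def)

lemma k_shift_ratio: "(\<lambda>m. real (k (shift i m)) / real (k m)) \<longlonglongrightarrow> c powr real_of_int i"
proof (induction i rule: int_induct[where k = 0])
  case base
  have "\<forall>\<^sub>F m in sequentially. real (k (shift 0 m)) / real (k m) = 1"
    using eventually_ge_at_top[of 1]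
    by eventually_elim (use k_pos in \<open>force simp: shift_def\<close>)
  then show ?case using c_gt_1 by (simp add: tendsto_eventually)
next
  case (step1 i)
  have "(\<lambda>m. real (k (Suc (shift i m))) / real (k (shift i m)) * (real (k (shift i m)) / real (k m))) \<longlonglongrightarrow> c * c powr real_of_int i"
    by (intro tendsto_mult step1 filterlim_compose[OF k_ratio shift_at_top])
  moreover have "\<forall>\<^sub>F m in sequentially. real (k (Suc (shift i m))) / real (k (shift i m)) * (real (k (shift i m)) / real (k m))
      = real (k (shift (i + 1) m)) / real (k m)"
    using eventually_shift_Suc[of i] filterlim_at_top[THEN iffD1, OF shift_at_top[of i], rule_format, of 1]
    by eventually_elim (use k_pos in \<open>force simp: field_simps\<close>)
  ultimately have "(\<lambda>m. real (k (shift (i + 1) m)) / real (k m)) \<longlonglongrightarrow> c * c powr real_of_int i"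
    by (rule Lim_transform_eventually)
  then show ?case
    using c_gt_1 by (simp add: powr_add mult.commute)
next
  case (step2 i)
  have "(\<lambda>m. real (k (shift i m)) / real (k m) / (real (k (Suc (shift (i - 1) m))) / real (k (shift (i - 1) m)))) \<longlonglongrightarrow> c powr real_of_int i / c"
    using c_gt_1 by (intro tendsto_divide step2 filterlim_compose[OF k_ratio shift_at_top]) auto
  moreover have "\<forall>\<^sub>F m in sequentially. real (k (shift i m)) / real (k m) / (real (k (Suc (shift (i - 1) m))) / real (k (shift (i - 1) m)))
      = real (k (shift (i - 1) m)) / real (k m)"
    using eventually_shift_Suc[of "i - 1"] filterlim_at_top[THEN iffD1, OF shift_at_top[of "i - 1"], rule_format, of 1]
  proof eventually_elim
    case (elim m)
    have "k (shift i m) = k (Suc (shift (i - 1) m))" "0 < k (Suc (shift (i - 1) m))"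
      using elim(1) k_pos[of "Suc (shift (i - 1) m)"] by auto
    then show ?case by (simp only:) (simp add: field_simps)
  qed
  ultimately have "(\<lambda>m. real (k (shift (i - 1) m)) / real (k m)) \<longlonglongrightarrow> c powr real_of_int i / c"
    by (rule Lim_transform_eventually)
  then show ?case
    using c_gt_1 by (simp add: powr_diff)
qed

lemma A_k_shift_ratio: "(\<lambda>m. A (real (k (shift i m))) / A (real (k m))) \<longlonglongrightarrow> c powr (real_of_int i / \<alpha>)"
proof -
  have "(\<lambda>m. A (real (k (shift i m)) / real (k m) * real (k m)) / A (real (k m))) \<longlonglongrightarrow> (c powr real_of_int i) powr (1 / \<alpha>)"
    using c_gt_1 by (intro A_ratio_tendsto k_at_top k_shift_ratio) auto
  moreover have "\<forall>\<^sub>F m in sequentially. A (real (k (shift i m)) / real (k m) * real (k m)) / A (real (k m)) = A (real (k (shift i m))) / A (real (k m))"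
    using eventually_ge_at_top[of 1] by eventually_elim (use k_pos in force)
  ultimately show ?thesis
    by (simp add: powr_powr Lim_transform_eventually)
qed

text \<open>The description that defines the block of \<open>x\<close> can be ambiguous for small indices, where
  \<open>A (k n)\<close> need not increase.  For large \<open>x\<close> those indices are excluded because \<open>x\<close> exceeds their
  values.\<close>

lemma relative_position_unique:
  obtains X where "\<And>x n. X \<le> x \<Longrightarrow> 1 \<le> n \<Longrightarrow> A (real (k n)) \<le> x \<Longrightarrow> x < A (real (k (Suc n))) \<Longrightarrow>
    relative_position k A x = x / A (real (k n))"
proof -
  define B where "B n = A (real (k n))" for n
  have "(\<lambda>m. A (real (k (shift 1 m))) / A (real (k m))) \<longlonglongrightarrow> c powr (1 / \<alpha>)"
    using A_k_shift_ratio[of 1] by simp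
  then have "\<forall>\<^sub>F n in sequentially. 1 < B (shift 1 n) / B n"
    unfolding B_def by (rule order_tendstoD(1)) (use c_gt_1 \<alpha>_pos in simp)
  then have "\<forall>\<^sub>F n in sequentially. B n < B (Suc n)"
    using eventually_ge_at_top[of 1]
    by eventually_elim (use A_pos k_pos in \<open>force simp: B_def shift_def field_simps nat_add_distrib\<close>)
  then obtain N where N: "\<And>n. n \<ge> N \<Longrightarrow> B n < B (Suc n)"
    by (auto simp: eventually_sequentially)
  have inc: "B m \<le> B n" if "N \<le> m" "m \<le> n" for m n
    using that(2)
  proof (induction n rule: dec_induct)
    case (step n)
    then show ?case using N[of n] that(1) by linarith
  qed simp
  define X where "X = (\<Sum>n\<le>Suc N. \<bar>B n\<bar>)"
  have X: "B n \<le> X" if "n \<le> Suc N" for n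
    using member_le_sum[of n "{..Suc N}" "\<lambda>n. \<bar>B n\<bar>"] that by (auto simp: X_def)
  show thesis
  proof (rule that[of X])
    fix x n assume x: "X \<le> x" and n: "1 \<le> n" "A (real (k n)) \<le> x" "x < A (real (k (Suc n)))"
    have large: "N \<le> j" if "x < B (Suc j)" for j
      using X[of "Suc j"] that x by (cases "N \<le> j") auto
    have "(THE n. 1 \<le> n \<and> A (real (k n)) \<le> x \<and> x < A (real (k (Suc n)))) = n"
    proof (rule the_equality)
      fix j assume j: "1 \<le> j \<and> A (real (k j)) \<le> x \<and> x < A (real (k (Suc j)))"
      have N': "N \<le> j" "N \<le> n" using j n large by (auto simp: B_def)
      have False if "n < j" using inc[of "Suc n" j] N' that j n by (auto simp: B_def)
      moreover have False if "j < n" using inc[of "Suc j" n] N' that j n by (auto simp: B_def)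
      ultimately show "j = n" by (meson linorder_neqE_nat)
    qed (use n in auto)
    then show "relative_position k A x = x / A (real (k n))"
      by (simp add: relative_position_def)
  qed
qed

text \<open>Away from the countably many break points \<open>c powr (i / \<alpha>)\<close>, the block that contains
  \<open>A (k m) * y\<close> is eventually a fixed number of steps away from block \<open>m\<close>.\<close>

lemma relative_position_eventually:
  assumes "c powr (real_of_int i / \<alpha>) < y" "y < c powr (real_of_int (i + 1) / \<alpha>)"
  shows "\<forall>\<^sub>F m in sequentially. 1 \<le> shift i m \<and>
     relative_position k A (A (real (k m)) * y) = A (real (k m)) * y / A (real (k (shift i m)))"
proof -
  obtain X where X: "\<And>x n. X \<le> x \<Longrightarrow> 1 \<le> n \<Longrightarrow> A (real (k n)) \<le> x \<Longrightarrow> x < A (real (k (Suc n))) \<Longrightarrow>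
    relative_position k A x = x / A (real (k n))"
    using relative_position_unique by blast
  have "y > 0" using assms(1) powr_ge_zero[of c "real_of_int i / \<alpha>"] by linarith
  have 1: "\<forall>\<^sub>F m in sequentially. A (real (k (shift i m))) / A (real (k m)) < y"
    using A_k_shift_ratio assms(1) by (rule order_tendstoD(2))
  have 2: "\<forall>\<^sub>F m in sequentially. y < A (real (k (shift (i + 1) m))) / A (real (k m))"
    using A_k_shift_ratio assms(2) by (rule order_tendstoD(1))
  have 3: "\<forall>\<^sub>F m in sequentially. 1 \<le> shift i m"
    using shift_at_top by (simp add: filterlim_at_top)
  have 4: "\<forall>\<^sub>F m in sequentially. X / y \<le> A (real (k m))"
    using A_k_at_top by (simp add: filterlim_at_top)
  show ?thesis
    using 1 2 3 4 eventually_shift_Suc[of i] eventually_ge_at_top[of 1]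
  proof eventually_elim
    case (elim m)
    have "A (real (k m)) > 0" using k_pos[OF elim(6)] by (intro A_pos) simp
    then show ?case using elim \<open>y > 0\<close> by (intro conjI X) (auto simp: field_simps)
  qed
qed

end

section \<open>Tails along the blocks\<close>

lemma tail_profile_periodic:
  assumes M: "tail_profile \<alpha> c M" and "c > 0" and "x > 0"
  shows "M (c powr (real_of_int i / \<alpha>) * x) = M x"
proof -
  have step: "M (c powr (1 / \<alpha>) * y) = M y" if "y > 0" for y
    using M that \<open>c > 0\<close> by (auto simp: tail_profile_def)
  show ?thesis
  proof (induction i rule: int_induct[where k = 0])
    case base
    then show ?case using \<open>c > 0\<close> by simp
  next
    case (step1 i)
    have "c powr (real_of_int (i + 1) / \<alpha>) * x = c powr (1 / \<alpha>) * (c powr (real_of_int i / \<alpha>) * x)"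
      by (simp add: add_divide_distrib powr_add)
    then show ?case using step[of "c powr (real_of_int i / \<alpha>) * x"] step1 \<open>c > 0\<close> \<open>x > 0\<close> by (simp only:) simp
  next
    case (step2 i)
    have "c powr (1 / \<alpha>) * c powr (real_of_int (i - 1) / \<alpha>) = c powr (real_of_int i / \<alpha>)"
      using \<open>c > 0\<close> by (simp add: diff_divide_distrib powr_diff)
    then have "c powr (1 / \<alpha>) * (c powr (real_of_int (i - 1) / \<alpha>) * x) = c powr (real_of_int i / \<alpha>) * x"
      by (simp only: mult.assoc[symmetric])
    moreover have "0 < c powr (real_of_int (i - 1) / \<alpha>) * x" using \<open>c > 0\<close> \<open>x > 0\<close> by simp
    ultimately show ?case using step step2(2) by metis
  qed
qed

lemma tail_profile_countable_discont:
  assumes M: "tail_profile \<alpha> c M"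
  shows "countable {y \<in> {0<..}. \<not> isCont M y}"
proof -
  define H where "H x = - (M x * x powr (- \<alpha>))" for x
  (* The profile itself need not be monotone; multiplied by a power it is. *)
  have "mono_on {0<..} H"
    using M by (auto simp: tail_profile_def H_def monotone_on_def)
  then have "countable {y \<in> {0<..}. \<not> isCont H y}"
    by (intro mono_on_ctble_discont_open) auto
  moreover have "isCont M y" if "y > 0" "isCont H y" for y
  proof -
    have "isCont (\<lambda>x. - H x * x powr \<alpha>) y"
      using that by (intro continuous_intros) auto
    moreover have "\<forall>\<^sub>F x in nhds y. x \<in> {0<..}"
      using that by (intro eventually_nhds_in_open) auto
    then have "\<forall>\<^sub>F x in nhds y. M x = - H x * x powr \<alpha>"
      by eventually_elim (auto simp: H_def powr_minus field_simps)
    ultimately show ?thesis by (simp add: isCont_cong)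
  qed
  ultimately show ?thesis
    by (elim countable_subset[rotated]) auto
qed

context geometric_norming
begin

text \<open>Monotone functions can be inverted from their values on a dense set, so the countably many
  discontinuities and block boundaries may be left out.\<close>

definition good_points :: "(real \<Rightarrow> real) \<Rightarrow> real set" where
  "good_points M = {y. 0 < y \<and> isCont M y \<and> (\<forall>i::int. y \<noteq> c powr (real_of_int i / \<alpha>))}"

lemma good_points_dense:
  assumes "tail_profile \<alpha> c M" "0 \<le> a" "a < b"
  obtains y where "y \<in> good_points M" "a < y" "y < b"
proof -
  have "countable ({y \<in> {0<..}. \<not> isCont M y} \<union> range (\<lambda>i::int. c powr (real_of_int i / \<alpha>)))"
    using tail_profile_countable_discont[OF assms(1)] by simp
  from open_minus_countable[OF this, of "{a<..<b}"] \<open>a < b\<close>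
  obtain y where "y \<in> {a<..<b}" "y \<notin> {y \<in> {0<..}. \<not> isCont M y} \<union> range (\<lambda>i::int. c powr (real_of_int i / \<alpha>))"
    by fastforce
  then show thesis using \<open>0 \<le> a\<close> by (intro that[of y]) (auto simp: good_points_def)
qed

lemma good_points_block:
  assumes "y \<in> good_points M"
  obtains i :: int where "c powr (real_of_int i / \<alpha>) < y" "y < c powr (real_of_int (i + 1) / \<alpha>)"
proof -
  have "y > 0" using assms by (simp add: good_points_def)
  define i where "i = \<lfloor>\<alpha> * log c y\<rfloor>"
  have "real_of_int i \<le> \<alpha> * log c y" "\<alpha> * log c y < real_of_int (i + 1)"
    unfolding i_def by linarith+
  then have "real_of_int i / \<alpha> \<le> log c y" "log c y < real_of_int (i + 1) / \<alpha>"
    using \<alpha>_pos by (simp_all add: field_simps)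
  then have "c powr (real_of_int i / \<alpha>) \<le> c powr log c y" "c powr log c y < c powr (real_of_int (i + 1) / \<alpha>)"
    using c_gt_1 by (auto intro: powr_mono powr_less_mono)
  then have "c powr (real_of_int i / \<alpha>) \<le> y" "y < c powr (real_of_int (i + 1) / \<alpha>)"
    using c_gt_1 \<open>y > 0\<close> by auto
  then show thesis using that[of i] assms by (fastforce simp: good_points_def order_less_le)
qed

text \<open>Periodicity lets the relative position, which jumps between blocks, be replaced by a
  quantity that converges to \<open>y\<close>.\<close>

lemma profile_relative_position_tendsto:
  assumes M: "tail_profile \<alpha> c M" and y: "y \<in> good_points M"
  shows "(\<lambda>m. M (relative_position k A (A (real (k m)) * y))) \<longlonglongrightarrow> M y"
proof -
  obtain i :: int where i: "c powr (real_of_int i / \<alpha>) < y" "y < c powr (real_of_int (i + 1) / \<alpha>)"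
    using good_points_block[OF y] .
  have "y > 0" "isCont M y" using y by (auto simp: good_points_def)
  let ?q = "\<lambda>m. c powr (real_of_int i / \<alpha>) * (y / (A (real (k (shift i m))) / A (real (k m))))"
  have "?q \<longlonglongrightarrow> c powr (real_of_int i / \<alpha>) * (y / c powr (real_of_int i / \<alpha>))"
    using c_gt_1 by (intro tendsto_intros A_k_shift_ratio) auto
  then have "?q \<longlonglongrightarrow> y" using c_gt_1 by simp
  then have "(\<lambda>m. M (?q m)) \<longlonglongrightarrow> M y"
    by (rule isCont_tendsto_compose[OF \<open>isCont M y\<close>])
  moreover have "\<forall>\<^sub>F m in sequentially. M (?q m) = M (relative_position k A (A (real (k m)) * y))"
    using relative_position_eventually[OF i] eventually_ge_at_top[of 1]
  proof eventually_elim
    case (elim m)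
    have "A (real (k m)) > 0" "A (real (k (shift i m))) > 0"
      using elim k_pos[of m] k_pos[of "shift i m"] by (auto intro!: A_pos)
    then have "M (?q m) = M (y / (A (real (k (shift i m))) / A (real (k m))))"
      using \<open>y > 0\<close> c_gt_1 by (intro tail_profile_periodic[OF M]) auto
    then show ?case using elim by (simp add: mult.commute)
  qed
  ultimately show ?thesis by (rule Lim_transform_eventually)
qed

text \<open>The generalized inverse that underlies \<open>tail_slow\<close>: its reciprocal is the infimum of the
  arguments in \<open>[1, \<infinity>)\<close> at which the norming function exceeds \<open>x\<close>.\<close>

definition level :: "real \<Rightarrow> real" where
  "level x = Sup {t. 0 < t \<and> t \<le> 1 \<and> x < A (1 / t)}"

lemma tail_slow_eq_level: "x > 0 \<Longrightarrow> tail_slow \<alpha> l\<^sub>1 x / x powr \<alpha> = level x"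
proof -
  have "A (1 / t) = t powr (- (1 / \<alpha>)) * l\<^sub>1 (1 / t)" if "0 < t" for t
    using that by (simp add: norming_def powr_divide powr_minus_divide)
  then have "{t. 0 < t \<and> t \<le> 1 \<and> t powr (- (1 / \<alpha>)) * l\<^sub>1 (1 / t) > x} = {t. 0 < t \<and> t \<le> 1 \<and> x < A (1 / t)}"
    by auto
  then show "x > 0 \<Longrightarrow> ?thesis" by (simp add: tail_slow_def level_def)
qed

lemma level_ge: "1 \<le> w \<Longrightarrow> x < A w \<Longrightarrow> 1 / w \<le> level x"
  unfolding level_def by (rule cSup_upper) (auto intro: bdd_aboveI[of _ 1])

text \<open>If the norming function were unbounded near some finite point, the generalized inverse
  would not tend to zero, and neither would a tail with a positive profile.\<close>

lemma A_locally_bounded: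
  assumes M: "tail_profile \<alpha> c M" and "a > 0" and a: "\<And>x. x > 0 \<Longrightarrow> a \<le> M x"
    and h: "\<And>x. x > 0 \<Longrightarrow> isCont M x \<Longrightarrow> (\<lambda>n. h (A (real (k n)) * x)) \<longlonglongrightarrow> 0"
    and G: "\<forall>\<^sub>F x in at_top. G x = tail_slow \<alpha> l\<^sub>1 x / x powr \<alpha> * (M (relative_position k A x) + h x)"
    and G0: "(G \<longlongrightarrow> 0) at_top"
  shows "\<exists>B. \<forall>w\<in>{1..Z}. A w \<le> B"
proof (rule ccontr)
  assume "\<not> ?thesis"
  then have unbdd: "\<exists>w. 1 \<le> w \<and> w \<le> Z \<and> x < A w" for x
    by (meson atLeastAtMost_iff not_less)
  then have "Z \<ge> 1" using order_trans by blast
  have level: "1 / Z \<le> level x" for x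
  proof -
    obtain w where "1 \<le> w" "w \<le> Z" "x < A w" using unbdd by blast
    then have "1 / Z \<le> 1 / w" by (intro divide_left_mono) auto
    then show ?thesis using level_ge[OF \<open>1 \<le> w\<close> \<open>x < A w\<close>] by linarith
  qed
  obtain y where y: "y \<in> good_points M" "0 < y" "y < 1"
    using good_points_dense[OF M, of 0 1] by auto
  have x: "filterlim (\<lambda>m. A (real (k m)) * y) at_top sequentially"
    using filterlim_tendsto_pos_mult_at_top[OF tendsto_const \<open>0 < y\<close> A_k_at_top] by (simp add: mult.commute)
  have Mpos: "M y \<ge> a" using a y by simp
  have "(\<lambda>m. M (relative_position k A (A (real (k m)) * y)) + h (A (real (k m)) * y)) \<longlonglongrightarrow> M y + 0"
    using y by (intro tendsto_add profile_relative_position_tendsto M h) (auto simp: good_points_def)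
  then have 1: "\<forall>\<^sub>F m in sequentially. a / 2 < M (relative_position k A (A (real (k m)) * y)) + h (A (real (k m)) * y)"
    using Mpos \<open>a > 0\<close> by (intro order_tendstoD(1)) auto
  have 2: "\<forall>\<^sub>F m in sequentially. A (real (k m)) * y > 0"
    using x by (simp add: filterlim_at_top_dense)
  have 3: "\<forall>\<^sub>F m in sequentially. G (A (real (k m)) * y) < a / 2 * (1 / Z)"
    using filterlim_compose[OF G0 x] \<open>a > 0\<close> \<open>Z \<ge> 1\<close> by (intro order_tendstoD(2)) auto
  have "\<forall>\<^sub>F m in sequentially. False"
    using 1 2 3 filterlim_iff[THEN iffD1, OF x, rule_format, OF G]
  proof eventually_elim
    case (elim m)
    have "1 / Z * (a / 2) \<le> level (A (real (k m)) * y) * (M (relative_position k A (A (real (k m)) * y)) + h (A (real (k m)) * y))"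
      using elim \<open>a > 0\<close> \<open>Z \<ge> 1\<close> level order_trans[OF _ level] by (intro mult_mono) auto
    then show ?case using elim by (simp add: tail_slow_eq_level)
  qed
  then show False by simp
qed

end

text \<open>Slow variation at infinity says nothing about bounded arguments, where the norming function could
  still be unbounded; the tail conditions exclude this by \<open>A_locally_bounded\<close>.\<close>

locale bounded_norming = geometric_norming +
  assumes A_bounded: "\<And>Z. \<exists>B. \<forall>w\<in>{1..Z}. A w \<le> B"
begin

text \<open>The generalized inverse of a regularly varying function is its asymptotic inverse.\<close>

lemma level_asymptotic:
  assumes x: "filterlim x at_top sequentially" and "y > 0"
  shows "(\<lambda>r. x r * level (A (x r) * y)) \<longlonglongrightarrow> y powr (- \<alpha>)"
proof (rule order_tendstoI)
  have x_ge: "\<forall>\<^sub>F r in sequentially. x r \<ge> Z" for Z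
    using x by (simp add: filterlim_at_top)
  have ratio: "(\<lambda>r. A (v * x r) / A (x r)) \<longlonglongrightarrow> v powr (1 / \<alpha>)" if "v > 0" for v
    by (rule A_ratio_tendsto[OF x tendsto_const that])
  fix a assume a: "a < y powr (- \<alpha>)"
  obtain w where w: "max a 0 < w" "w < y powr (- \<alpha>)"
    using dense[of "max a 0" "y powr (- \<alpha>)"] a \<open>y > 0\<close> by auto
  define v where "v = 1 / w"
  have "y powr \<alpha> < v" using w \<open>y > 0\<close> by (simp add: v_def powr_minus field_simps)
  then have v: "v > 0" "(y powr \<alpha>) powr (1 / \<alpha>) < v powr (1 / \<alpha>)"
    using w \<alpha>_pos by (auto simp: v_def intro!: powr_less_mono2)
  then have "y < v powr (1 / \<alpha>)"
    using \<alpha>_pos \<open>y > 0\<close> by (simp add: powr_powr)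
  then have "\<forall>\<^sub>F r in sequentially. y < A (v * x r) / A (x r)"
    by (rule order_tendstoD(1)[OF ratio[OF v(1)]])
  then show "\<forall>\<^sub>F r in sequentially. a < x r * level (A (x r) * y)"
    using x_ge[of 1] x_ge[of "1 / v"]
  proof eventually_elim
    case (elim r)
    have "A (x r) * y < A (v * x r)" using elim A_pos[of "x r"] by (simp add: field_simps)
    moreover have "1 \<le> v * x r" using elim v(1) by (simp add: field_simps)
    ultimately have "1 / (v * x r) \<le> level (A (x r) * y)" by (intro level_ge)
    then have "x r * (1 / (v * x r)) \<le> x r * level (A (x r) * y)" using elim by (intro mult_left_mono) auto
    moreover have "x r * (1 / (v * x r)) = w" using elim v w by (simp add: v_def)
    ultimately show ?case using w by simp
  qed
next
  have x_ge: "\<forall>\<^sub>F r in sequentially. x r \<ge> Z" for Z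
    using x by (simp add: filterlim_at_top)
  have ratio: "(\<lambda>r. A (v * x r) / A (x r)) \<longlonglongrightarrow> v powr (1 / \<alpha>)" if "v > 0" for v
    by (rule A_ratio_tendsto[OF x tendsto_const that])
  fix a assume a: "y powr (- \<alpha>) < a"
  obtain w where w: "y powr (- \<alpha>) < w" "w < a"
    using dense[OF a] by auto
  have "w > 0" using w(1) powr_ge_zero[of y "- \<alpha>"] by linarith
  define v where "v = 1 / w"
  have "v < y powr \<alpha>" using w \<open>w > 0\<close> \<open>y > 0\<close> by (simp add: v_def powr_minus field_simps)
  then have "v powr (1 / \<alpha>) < (y powr \<alpha>) powr (1 / \<alpha>)"
    using \<open>w > 0\<close> \<alpha>_pos by (auto simp: v_def intro!: powr_less_mono2)
  then have vy: "v powr (1 / \<alpha>) < y" and "v > 0"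
    using \<alpha>_pos \<open>y > 0\<close> \<open>w > 0\<close> by (auto simp: powr_powr v_def)
  define \<epsilon> where "\<epsilon> = (y / v powr (1 / \<alpha>) - 1) / 2"
  have "\<epsilon> > 0" using vy \<open>v > 0\<close> by (simp add: \<epsilon>_def field_simps)
  obtain X\<^sub>0 where X: "X\<^sub>0 \<ge> 1" "\<And>w z. X\<^sub>0 \<le> w \<Longrightarrow> w \<le> z \<Longrightarrow> A w \<le> (1 + \<epsilon>) * A z"
    using A_almost_increasing[OF \<open>\<epsilon> > 0\<close>] by blast
  obtain B where B: "\<And>w. 1 \<le> w \<Longrightarrow> w \<le> X\<^sub>0 \<Longrightarrow> A w \<le> B"
    using A_bounded[of X\<^sub>0] by (meson atLeastAtMost_iff)
  have "(1 + \<epsilon>) * v powr (1 / \<alpha>) < y"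
    using vy \<open>v > 0\<close> by (simp add: \<epsilon>_def field_simps)
  then have "\<forall>\<^sub>F r in sequentially. (1 + \<epsilon>) * (A (v * x r) / A (x r)) < y"
    by (rule order_tendstoD(2)[OF tendsto_mult[OF tendsto_const ratio[OF \<open>v > 0\<close>]]])
  moreover have "\<forall>\<^sub>F r in sequentially. (B + 1) / y \<le> A (x r)"
    using filterlim_compose[OF A_at_top x] by (simp add: filterlim_at_top)
  ultimately show "\<forall>\<^sub>F r in sequentially. x r * level (A (x r) * y) < a"
    using x_ge[of 1]
  proof eventually_elim
    case (elim r)
    have Apos: "A (x r) > 0" using elim by (intro A_pos)
    have "\<forall>\<^sub>F w' in at_top. w' \<ge> 1 \<and> A w' > A (x r) * y"
      using A_at_top by (intro eventually_conj eventually_ge_at_top) (simp add: filterlim_at_top_dense)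
    then obtain w' where "w' \<ge> 1" "A w' > A (x r) * y"
      using eventually_happens' trivial_limit_at_top_linorder by blast
    then have ne: "{t. 0 < t \<and> t \<le> 1 \<and> A (x r) * y < A (1 / t)} \<noteq> {}"
      by (auto intro!: exI[of _ "1 / w'"])
    have "level (A (x r) * y) \<le> 1 / (v * x r)"
      unfolding level_def
    proof (rule cSup_least[OF ne])
      fix t assume t: "t \<in> {t. 0 < t \<and> t \<le> 1 \<and> A (x r) * y < A (1 / t)}"
      (* Arguments 1 / t below X0 are covered by local boundedness, those between X0 and v * x r
         by near-monotonicity; neither reaches the level. *)
      have "\<not> 1 / t \<le> X\<^sub>0"
      proof
        assume "1 / t \<le> X\<^sub>0"
        then have "A (1 / t) \<le> B" using t by (intro B) auto
        then show False using t elim \<open>y > 0\<close> by (auto simp: field_simps)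
      qed
      moreover have "\<not> (X\<^sub>0 \<le> 1 / t \<and> 1 / t \<le> v * x r)"
      proof
        assume "X\<^sub>0 \<le> 1 / t \<and> 1 / t \<le> v * x r"
        then have "A (1 / t) \<le> (1 + \<epsilon>) * A (v * x r)" by (intro X) auto
        also have "\<dots> < y * A (x r)" using elim Apos by (simp add: field_simps)
        finally show False using t by (simp add: mult.commute)
      qed
      ultimately have "v * x r < 1 / t" by auto
      then show "t \<le> 1 / (v * x r)"
        using t \<open>v > 0\<close> elim by (simp add: field_simps)
    qed
    then have "x r * level (A (x r) * y) \<le> x r * (1 / (v * x r))" using elim by (intro mult_left_mono) auto
    moreover have "x r * (1 / (v * x r)) = w" using elim \<open>w > 0\<close> by (simp add: v_def)
    ultimately show ?case using w by simp
  qed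
qed

text \<open>The parts converge separately: the generalized inverse by asymptotic inversion, the profile by
  periodicity, and \<open>h\<close> by hypothesis.\<close>

lemma tail_convergence:
  assumes M: "tail_profile \<alpha> c M"
    and h: "\<And>x. x > 0 \<Longrightarrow> isCont M x \<Longrightarrow> (\<lambda>n. h (A (real (k n)) * x)) \<longlonglongrightarrow> 0"
    and G: "\<forall>\<^sub>F x in at_top. G x = tail_slow \<alpha> l\<^sub>1 x / x powr \<alpha> * (M (relative_position k A x) + h x)"
    and y: "y \<in> good_points M"
  shows "(\<lambda>m. real (k m) * G (A (real (k m)) * y)) \<longlonglongrightarrow> levy_tail \<alpha> M 1 y"
proof -
  have "y > 0" "isCont M y" using y by (auto simp: good_points_def)
  have x: "filterlim (\<lambda>m. A (real (k m)) * y) at_top sequentially"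
    using filterlim_tendsto_pos_mult_at_top[OF tendsto_const \<open>0 < y\<close> A_k_at_top] by (simp add: mult.commute)
  have 1: "\<forall>\<^sub>F m in sequentially. A (real (k m)) * y > 0"
    using x by (simp add: filterlim_at_top_dense)
  have "(\<lambda>m. (real (k m) * level (A (real (k m)) * y)) *
      (M (relative_position k A (A (real (k m)) * y)) + h (A (real (k m)) * y))) \<longlonglongrightarrow> y powr (- \<alpha>) * (M y + 0)"
    using \<open>y > 0\<close> \<open>isCont M y\<close>
    by (intro tendsto_mult tendsto_add level_asymptotic k_at_top profile_relative_position_tendsto M y h)
  moreover have "\<forall>\<^sub>F m in sequentially. (real (k m) * level (A (real (k m)) * y)) *
      (M (relative_position k A (A (real (k m)) * y)) + h (A (real (k m)) * y)) = real (k m) * G (A (real (k m)) * y)"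
    using 1 filterlim_iff[THEN iffD1, OF x, rule_format, OF G]
    by eventually_elim (simp add: tail_slow_eq_level)
  ultimately show ?thesis
    by (simp add: levy_tail_def Lim_transform_eventually)
qed

end

section \<open>Inverse tails\<close>

lemma tail_profile_bounded:
  assumes "tail_profile \<alpha> c M"
  obtains b where "b > 0" "\<And>x. x > 0 \<Longrightarrow> M x \<le> b"
proof -
  have "\<exists>b. \<forall>x>0. M x \<le> b"
    using assms by (force simp: tail_profile_def)
  then obtain b where "\<forall>x>0. M x \<le> b" ..
  then show thesis by (intro that[of "max b 1"]) (auto simp: max_def intro: order_trans)
qed

lemma tail_profile_nonneg: "tail_profile \<alpha> c M \<Longrightarrow> x > 0 \<Longrightarrow> 0 \<le> M x"
  by (fastforce simp: tail_profile_def)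

locale levy_profile =
  fixes \<alpha> :: real and M :: "real \<Rightarrow> real" and b :: real
  assumes \<alpha>_pos: "0 < \<alpha>"
    and M_antimono: "antimono_on {0<..} (\<lambda>x. M x * x powr (- \<alpha>))"
    and b_pos: "b > 0" and M_le: "\<And>x. x > 0 \<Longrightarrow> M x \<le> b"
    and M_nonneg: "\<And>x. x > 0 \<Longrightarrow> 0 \<le> M x"
begin

lemma levy_tail_scale:
  assumes "\<theta> > 0" "x > 0"
  shows "levy_tail \<alpha> M \<theta> x = \<theta> * levy_tail \<alpha> M 1 (\<theta> powr (1 / \<alpha>) * x)"
proof -
  have "(\<theta> powr (1 / \<alpha>) * x) powr (- \<alpha>) = \<theta> powr (- 1) * x powr (- \<alpha>)"
    using \<alpha>_pos by (simp add: powr_mult powr_powr)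
  also have "\<dots> = x powr (- \<alpha>) / \<theta>"
    using assms by (simp add: powr_minus_divide)
  finally have eq: "(\<theta> powr (1 / \<alpha>) * x) powr (- \<alpha>) = x powr (- \<alpha>) / \<theta>" .
  show ?thesis
    unfolding levy_tail_def eq using assms by simp
qed

lemma levy_tail_antimono:
  assumes "\<theta> > 0" "0 < x" "x \<le> y"
  shows "levy_tail \<alpha> M \<theta> y \<le> levy_tail \<alpha> M \<theta> x"
proof -
  have "levy_tail \<alpha> M 1 (\<theta> powr (1 / \<alpha>) * y) \<le> levy_tail \<alpha> M 1 (\<theta> powr (1 / \<alpha>) * x)"
    using M_antimono assms by (auto simp: monotone_on_def levy_tail_def mult.commute)
  then show ?thesis
    using assms levy_tail_scale[of \<theta> x] levy_tail_scale[of \<theta> y] by simp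
qed

lemma levy_tail_small:
  assumes "\<theta> > 0" "s > 0" "x > (b / s) powr (1 / \<alpha>)"
  shows "levy_tail \<alpha> M \<theta> x < s"
proof -
  have "x > 0" using assms(3) powr_ge_zero[of "b / s" "1 / \<alpha>"] by linarith
  have "b / s = ((b / s) powr (1 / \<alpha>)) powr \<alpha>"
    using \<alpha>_pos b_pos assms(2) by (simp add: powr_powr)
  also have "\<dots> < x powr \<alpha>"
    using assms \<alpha>_pos by (intro powr_less_mono2) auto
  finally have "b * x powr (- \<alpha>) < s"
    using \<open>x > 0\<close> assms(2) by (simp add: powr_minus field_simps)
  moreover have "levy_tail \<alpha> M \<theta> x \<le> b * x powr (- \<alpha>)"
    using M_le[of "\<theta> powr (1 / \<alpha>) * x"] \<open>x > 0\<close> assms(1) by (simp add: levy_tail_def mult.commute mult_left_mono)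
  ultimately show ?thesis by simp
qed

lemma levy_inverse_set:
  assumes "\<theta> > 0" "s > 0"
  shows "{x. 0 < x \<and> levy_tail \<alpha> M \<theta> x \<le> s} \<noteq> {}" "bdd_below {x. 0 < x \<and> levy_tail \<alpha> M \<theta> x \<le> s}"
proof -
  have "(b / s) powr (1 / \<alpha>) + 1 \<in> {x. 0 < x \<and> levy_tail \<alpha> M \<theta> x \<le> s}"
    using levy_tail_small[OF assms, of "(b / s) powr (1 / \<alpha>) + 1"]
    by (auto intro: add_nonneg_pos)
  then show "{x. 0 < x \<and> levy_tail \<alpha> M \<theta> x \<le> s} \<noteq> {}" by blast
  show "bdd_below {x. 0 < x \<and> levy_tail \<alpha> M \<theta> x \<le> s}"
    by (auto intro: bdd_belowI[of _ 0])
qed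

lemma levy_inverse_nonneg:
  assumes "\<theta> > 0" "s > 0" shows "0 \<le> levy_inverse \<alpha> M \<theta> s"
  unfolding levy_inverse_def using levy_inverse_set[OF assms] by (intro cInf_greatest) auto

lemma levy_inverse_le:
  assumes "\<theta> > 0" "s > 0" "x > 0" "levy_tail \<alpha> M \<theta> x \<le> s" shows "levy_inverse \<alpha> M \<theta> s \<le> x"
  unfolding levy_inverse_def using levy_inverse_set[OF assms(1,2)] assms by (intro cInf_lower) auto

lemma levy_inverse_ge:
  assumes "\<theta> > 0" "s > 0" "x > 0" "s < levy_tail \<alpha> M \<theta> x" shows "x \<le> levy_inverse \<alpha> M \<theta> s"
  unfolding levy_inverse_def
proof (rule cInf_greatest[OF levy_inverse_set(1)[OF assms(1,2)]])
  fix z assume "z \<in> {x. 0 < x \<and> levy_tail \<alpha> M \<theta> x \<le> s}"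
  then show "x \<le> z"
    using levy_tail_antimono[OF assms(1), of z x] assms by (cases "z \<le> x") auto
qed

lemma levy_inverse_antimono:
  assumes "\<theta> > 0" "0 < s" "s \<le> s'" shows "levy_inverse \<alpha> M \<theta> s' \<le> levy_inverse \<alpha> M \<theta> s"
  unfolding levy_inverse_def using assms levy_inverse_set[of \<theta> s] levy_inverse_set[of \<theta> s']
  by (intro cInf_superset_mono) auto

lemma levy_inverse_upper:
  assumes "\<theta> > 0" "s > 0" shows "levy_inverse \<alpha> M \<theta> s \<le> (b / s) powr (1 / \<alpha>)"
proof (rule dense_ge)
  fix x assume x: "(b / s) powr (1 / \<alpha>) < x"
  then have "x > 0" using powr_ge_zero[of "b / s" "1 / \<alpha>"] by linarith
  then show "levy_inverse \<alpha> M \<theta> s \<le> x"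
    using levy_tail_small[OF assms x] assms by (intro levy_inverse_le) auto
qed

lemma levy_inverse_lower:
  assumes "\<theta> > 0" "s > 0" "a > 0" and a: "\<And>x. x > 0 \<Longrightarrow> a \<le> M x"
  shows "(a / s) powr (1 / \<alpha>) \<le> levy_inverse \<alpha> M \<theta> s"
proof (rule dense_le_bounded[of 0])
  show "0 < (a / s) powr (1 / \<alpha>)" using assms by simp
  fix x assume x: "0 < x" "x < (a / s) powr (1 / \<alpha>)"
  have "x powr \<alpha> < ((a / s) powr (1 / \<alpha>)) powr \<alpha>"
    using x \<alpha>_pos by (intro powr_less_mono2) auto
  also have "\<dots> = a / s"
    using \<alpha>_pos assms by (simp add: powr_powr)
  finally have "s < a * x powr (- \<alpha>)"
    using x assms by (simp add: powr_minus field_simps)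
  also have "\<dots> \<le> levy_tail \<alpha> M \<theta> x"
    using a[of "\<theta> powr (1 / \<alpha>) * x"] x assms by (simp add: levy_tail_def mult.commute mult_left_mono)
  finally show "x \<le> levy_inverse \<alpha> M \<theta> s"
    using assms x by (intro levy_inverse_ge) auto
qed

text \<open>Changing the parameter only rescales, so that convergence needs to be studied for parameter one
  alone.\<close>

lemma levy_inverse_scale:
  assumes "\<theta> > 0" "s > 0"
  shows "levy_inverse \<alpha> M \<theta> s = levy_inverse \<alpha> M 1 (s / \<theta>) / \<theta> powr (1 / \<alpha>)"
proof -
  define a where "a = \<theta> powr (1 / \<alpha>)"
  have "a > 0" using assms by (simp add: a_def)
  let ?S = "{x. 0 < x \<and> levy_tail \<alpha> M 1 x \<le> s / \<theta>}"
  have "{x. 0 < x \<and> levy_tail \<alpha> M \<theta> x \<le> s} = (\<lambda>x. x / a) ` ?S"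
  proof (intro equalityI subsetI)
    fix x assume "x \<in> {x. 0 < x \<and> levy_tail \<alpha> M \<theta> x \<le> s}"
    then have "a * x \<in> ?S"
      using \<open>a > 0\<close> assms levy_tail_scale[of \<theta> x] by (auto simp: a_def[symmetric] field_simps)
    then show "x \<in> (\<lambda>x. x / a) ` ?S"
      using \<open>a > 0\<close> by (auto intro!: image_eqI[of _ _ "a * x"])
  next
    fix x assume "x \<in> (\<lambda>x. x / a) ` ?S"
    then obtain z where z: "x = z / a" "0 < z" "levy_tail \<alpha> M 1 z \<le> s / \<theta>" by auto
    then have "0 < x" "z = a * x" using \<open>a > 0\<close> by auto
    with z show "x \<in> {x. 0 < x \<and> levy_tail \<alpha> M \<theta> x \<le> s}"
      using \<open>a > 0\<close> assms levy_tail_scale[of \<theta> x] by (auto simp: a_def[symmetric] field_simps)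
  qed
  moreover have "Inf ?S / a = Inf ((\<lambda>x. x / a) ` ?S)"
    using \<open>a > 0\<close> assms levy_inverse_set[of 1 "s / \<theta>"]
    by (intro continuous_at_Inf_mono[of "\<lambda>x. x / a"])
       (auto simp: mono_def divide_right_mono intro!: continuous_intros)
  ultimately show ?thesis by (simp add: levy_inverse_def a_def)
qed

lemma levy_inverse_countable_discont:
  "countable {s \<in> {0<..}. \<not> isCont (levy_inverse \<alpha> M 1) s}"
proof -
  have "mono_on {0<..} (\<lambda>s. - levy_inverse \<alpha> M 1 s)"
    using levy_inverse_antimono[of 1] by (auto simp: monotone_on_def)
  then have "countable {s \<in> {0<..}. \<not> isCont (\<lambda>s. - levy_inverse \<alpha> M 1 s) s}"
    by (intro mono_on_ctble_discont_open) auto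
  moreover have "isCont (levy_inverse \<alpha> M 1) s" if "isCont (\<lambda>s. - levy_inverse \<alpha> M 1 s) s" for s
    using continuous_minus[OF that] by simp
  ultimately show ?thesis
    by (elim countable_subset[rotated]) auto
qed

lemma AE_isCont_levy_inverse:
  assumes "\<theta> > 0"
  shows "AE s in lborel. s > 0 \<longrightarrow> isCont (levy_inverse \<alpha> M 1) (s / \<theta>)"
proof -
  have "countable ((\<lambda>s. \<theta> * s) ` {s \<in> {0<..}. \<not> isCont (levy_inverse \<alpha> M 1) s})"
    using levy_inverse_countable_discont by simp
  then have "AE s in lborel. s \<notin> (\<lambda>s. \<theta> * s) ` {s \<in> {0<..}. \<not> isCont (levy_inverse \<alpha> M 1) s}"
    by (intro AE_not_in countable_imp_null_set_lborel)
  then show ?thesis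
  proof eventually_elim
    case (elim s)
    show ?case
    proof (intro impI, rule ccontr)
      assume "s > 0" "\<not> isCont (levy_inverse \<alpha> M 1) (s / \<theta>)"
      then have "s \<in> (\<lambda>s. \<theta> * s) ` {s \<in> {0<..}. \<not> isCont (levy_inverse \<alpha> M 1) s}"
        using assms by (intro image_eqI[of _ _ "s / \<theta>"]) auto
      then show False using elim by simp
    qed
  qed
qed

end

section \<open>Convergence and domination of quantiles\<close>

context geometric_norming
begin

lemma block_exists:
  assumes "1 \<le> n"
  obtains m where "1 \<le> m" "k (m - 1) < n" "n \<le> k m" "position_parameter k n = real n / real (k m)"
proof -
  define m where "m = (LEAST m. n \<le> k m)"
  have ex: "n \<le> k n" by (rule k_ge)
  have m: "n \<le> k m" unfolding m_def using ex by (rule LeastI)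
  have "m \<noteq> 0" using m k0 assms by (metis le_zero_eq not_one_le_zero)
  then have m1: "1 \<le> m" by simp
  then have "\<not> n \<le> k (m - 1)"
    using not_less_Least[of "m - 1" "\<lambda>m. n \<le> k m"] by (simp add: m_def)
  then have m2: "k (m - 1) < n" by simp
  have "(THE m. 1 \<le> m \<and> k (m - 1) < n \<and> n \<le> k m) = m"
  proof (rule the_equality)
    fix j assume j: "1 \<le> j \<and> k (j - 1) < n \<and> n \<le> k j"
    have "k (j - 1) < k m" "k (m - 1) < k j" using j m m2 by linarith+
    then have "j - 1 < m" "m - 1 < j" using k_mono by (simp_all add: strict_mono_less)
    then show "j = m" using j m1 by linarith
  qed (use m m1 m2 in auto)
  then show thesis using m m1 m2 by (intro that[of m]) (auto simp: position_parameter_def)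
qed

lemma k_ratio_bounded:
  obtains D where "D \<ge> 1" "\<And>m n. 1 \<le> m \<Longrightarrow> k (m - 1) < n \<Longrightarrow> real (k m) \<le> D * real n"
proof -
  obtain D\<^sub>0 where D: "\<And>n. norm (real (k (Suc n)) / real (k n)) \<le> D\<^sub>0"
    using convergent_imp_Bseq[OF convergentI[OF k_ratio]] by (auto simp: Bseq_def)
  have "D\<^sub>0 \<ge> 0" using D[of 0] k0 by simp
  show thesis
  proof (rule that[of "1 + D\<^sub>0 + real (k 1)"])
    fix m n assume mn: "1 \<le> m" "k (m - 1) < n"
    show "real (k m) \<le> (1 + D\<^sub>0 + real (k 1)) * real n"
    proof (cases "m = 1")
      case True
      have "real (k 1) * 1 \<le> (1 + D\<^sub>0 + real (k 1)) * real n"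
        using mn \<open>D\<^sub>0 \<ge> 0\<close> by (intro mult_mono) auto
      then show ?thesis using True by simp
    next
      case False
      have "0 < k (m - 1)" using k_pos[of "m - 1"] False mn by linarith
      then have "real (k m) \<le> D\<^sub>0 * real (k (m - 1))"
        using D[of "m - 1"] mn by (simp add: field_simps)
      also have "\<dots> \<le> (1 + D\<^sub>0 + real (k 1)) * real n"
        using mn \<open>D\<^sub>0 \<ge> 0\<close> by (intro mult_mono) auto
      finally show ?thesis .
    qed
  qed (use \<open>D\<^sub>0 \<ge> 0\<close> in simp)
qed

lemma position_parameter_bounds:
  obtains d where "d > 0" "\<And>n. 1 \<le> n \<Longrightarrow> d \<le> position_parameter k n \<and> position_parameter k n \<le> 1"
proof -
  obtain D where D: "D \<ge> 1" "\<And>m n. 1 \<le> m \<Longrightarrow> k (m - 1) < n \<Longrightarrow> real (k m) \<le> D * real n"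
    using k_ratio_bounded by blast
  show thesis
  proof (rule that[of "1 / D"])
    fix n :: nat assume n: "1 \<le> n"
    obtain m where m: "1 \<le> m" "k (m - 1) < n" "n \<le> k m" "position_parameter k n = real n / real (k m)"
      using block_exists[OF n] .
    have "real (k m) > 0" using k_pos[OF m(1)] by simp
    then show "1 / D \<le> position_parameter k n \<and> position_parameter k n \<le> 1"
      unfolding m(4) using m(3) D(2)[OF m(1,2)] D(1) by (simp add: field_simps)
  qed (use D in simp)
qed

end

text \<open>One tail \<open>G\<close> of a law with a generalized inverse \<open>q\<close>.  The two inversion hypotheses are weak enough
  to hold for the upper quantile function as well as for the reflected lower one, although these
  have opposite one-sided continuity.\<close>

locale one_sided_tail = geometric_norming \<alpha> l\<^sub>1 c k
  for \<alpha> :: real and l\<^sub>1 :: "real \<Rightarrow> real" and c :: real and k :: "nat \<Rightarrow> nat" +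
  fixes M G q :: "real \<Rightarrow> real"
  assumes profile: "tail_profile \<alpha> c M"
    and G_lim: "\<And>y. y \<in> good_points M \<Longrightarrow> (\<lambda>m. real (k m) * G (A (real (k m)) * y)) \<longlonglongrightarrow> levy_tail \<alpha> M 1 y"
    and G_antimono: "antimono G" and G_nonneg: "\<And>x. 0 \<le> G x"
    and q_ge: "\<And>s x. 0 < s \<Longrightarrow> s < 1 \<Longrightarrow> s < G x \<Longrightarrow> x \<le> q s"
    and q_le: "\<And>s x. 0 < s \<Longrightarrow> s < 1 \<Longrightarrow> G x < s \<Longrightarrow> q s \<le> x"
    and q_antimono: "\<And>s s'. 0 < s \<Longrightarrow> s \<le> s' \<Longrightarrow> s' < 1 \<Longrightarrow> q s' \<le> q s"
begin

text \<open>A fixed bound of the profile, which makes the properties of \<open>levy_profile\<close> available by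
  interpretation.\<close>

definition bound :: real where
  "bound = (SOME b. b > 0 \<and> (\<forall>x>0. M x \<le> b))"

lemma bound: "bound > 0 \<and> (\<forall>x>0. M x \<le> bound)"
proof -
  obtain b where "b > 0 \<and> (\<forall>x>0. M x \<le> b)"
    using tail_profile_bounded[OF profile] by metis
  then show ?thesis unfolding bound_def by (rule someI)
qed

sublocale levy_profile \<alpha> M bound
proof
  show "0 < \<alpha>" by (rule \<alpha>_pos)
  show "antimono_on {0<..} (\<lambda>x. M x * x powr (- \<alpha>))"
    using profile unfolding tail_profile_def by blast
  show "bound > 0" "x > 0 \<Longrightarrow> M x \<le> bound" for x
    using bound by auto
  show "x > 0 \<Longrightarrow> 0 \<le> M x" for x
    using profile by (rule tail_profile_nonneg)
qed

abbreviation R :: "real \<Rightarrow> real" where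
  "R \<equiv> levy_inverse \<alpha> M 1"

text \<open>Convergence of the tails at good points inverts to convergence of the quantiles at continuity
  points of the limit; monotonicity allows the argument to vary with the index.\<close>

lemma quantile_tendsto_along_blocks:
  assumes m: "filterlim m sequentially sequentially" and u: "u \<longlonglongrightarrow> v" and "v > 0" and R: "isCont R v"
  shows "(\<lambda>r. q (u r / real (k (m r))) / A (real (k (m r)))) \<longlonglongrightarrow> R v"
proof (rule order_tendstoI)
  have k: "filterlim (\<lambda>r. real (k (m r))) at_top sequentially"
    by (rule filterlim_compose[OF k_at_top m])
  have Ak: "filterlim (\<lambda>r. A (real (k (m r)))) at_top sequentially"
    by (rule filterlim_compose[OF A_at_top k])
  have "(\<lambda>r. u r / real (k (m r))) \<longlonglongrightarrow> 0"
    using u k by (rule real_tendsto_divide_at_top)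
  then have half: "\<forall>\<^sub>F r in sequentially. u r / real (k (m r)) < 1/2"
    by (rule order_tendstoD(2)) simp
  have u_pos: "\<forall>\<^sub>F r in sequentially. 0 < u r"
    using u \<open>v > 0\<close> by (rule order_tendstoD(1))
  have Apos: "\<forall>\<^sub>F r in sequentially. 0 < A (real (k (m r)))" and kpos: "\<forall>\<^sub>F r in sequentially. 0 < real (k (m r))"
    using filterlim_at_top_dense[THEN iffD1, OF Ak, rule_format, of 0]
      filterlim_at_top_dense[THEN iffD1, OF k, rule_format, of 0] by simp_all
  have nbhd: "\<forall>\<^sub>F x in at v. R x \<in> S" if "open S" "R v \<in> S" for S
    using R that by (auto simp: isCont_def tendsto_def)
  fix a
  {
    assume a: "a < R v"
    show "\<forall>\<^sub>F r in sequentially. a < q (u r / real (k (m r))) / A (real (k (m r)))"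
    proof (cases "a < 0")
      case True
      have "(\<lambda>r. q (1/2) / A (real (k (m r)))) \<longlonglongrightarrow> 0"
        using Ak by (rule real_tendsto_divide_at_top[OF tendsto_const])
      then have "\<forall>\<^sub>F r in sequentially. a < q (1/2) / A (real (k (m r)))"
        using True by (rule order_tendstoD(1))
      then show ?thesis
        using half u_pos Apos kpos
      proof eventually_elim
        case (elim r)
        have "q (1/2) \<le> q (u r / real (k (m r)))"
          using elim by (intro q_antimono) auto
        then have "q (1/2) / A (real (k (m r))) \<le> q (u r / real (k (m r))) / A (real (k (m r)))"
          using elim by (intro divide_right_mono) auto
        then show ?case using elim by linarith
      qed
    next
      case False
      have "\<forall>\<^sub>F x in at_right v. a < R x"
        using nbhd[of "{a<..}"] a by (auto simp: eventually_at_split)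
      then have "\<forall>\<^sub>F x in at_right v. a < R x \<and> x > v"
        by (intro eventually_conj eventually_at_right_less)
      then have "\<exists>x. a < R x \<and> x > v"
        by (rule eventually_happens'[OF trivial_limit_at_right_real])
      then obtain v' where v': "a < R v'" "v < v'"
        by auto
      obtain y where y: "y \<in> good_points M" "a < y" "y < R v'"
        using good_points_dense[OF profile, of a "R v'"] False v' by auto
      have "levy_tail \<alpha> M 1 y \<ge> v'"
        using levy_inverse_le[of 1 v' y] y v' \<open>v > 0\<close> False by (cases "levy_tail \<alpha> M 1 y \<le> v'") auto
      then have "(v + v') / 2 < levy_tail \<alpha> M 1 y" using v' by simp
      then have "\<forall>\<^sub>F r in sequentially. (v + v') / 2 < real (k (m r)) * G (A (real (k (m r))) * y)"
        by (rule order_tendstoD(1)[OF filterlim_compose[OF G_lim[OF y(1)] m]])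
      moreover have "\<forall>\<^sub>F r in sequentially. u r < (v + v') / 2"
        using u v' by (intro order_tendstoD(2)[OF u]) simp
      ultimately show ?thesis
        using half u_pos Apos kpos
      proof eventually_elim
        case (elim r)
        have "A (real (k (m r))) * y \<le> q (u r / real (k (m r)))"
          using elim by (intro q_ge) (auto simp: field_simps)
        then have "y \<le> q (u r / real (k (m r))) / A (real (k (m r)))"
          using elim by (simp add: field_simps)
        then show ?case using y by linarith
      qed
    qed
  }
  {
    assume a: "R v < a"
    have "\<forall>\<^sub>F x in at_left v. R x < a"
      using nbhd[of "{..<a}"] a by (auto simp: eventually_at_split)
    then have "\<forall>\<^sub>F x in at_left v. R x < a \<and> x \<in> {0<..<v}"
      using \<open>v > 0\<close> by (intro eventually_conj eventually_at_left_real)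
    then have "\<exists>x. R x < a \<and> x \<in> {0<..<v}"
      by (rule eventually_happens'[OF trivial_limit_at_left_real])
    then obtain v' where v': "R v' < a" "0 < v'" "v' < v"
      by auto
    obtain y where y: "y \<in> good_points M" "R v' < y" "y < a"
      using good_points_dense[OF profile, of "R v'" a] v' levy_inverse_nonneg[of 1 v'] by auto
    have "y > 0" using y(1) by (simp add: good_points_def)
    then have "levy_tail \<alpha> M 1 y \<le> v'"
      using levy_inverse_ge[of 1 v' y] y v' by (cases "levy_tail \<alpha> M 1 y \<le> v'") auto
    then have "levy_tail \<alpha> M 1 y < (v + v') / 2" using v' by simp
    then have "\<forall>\<^sub>F r in sequentially. real (k (m r)) * G (A (real (k (m r))) * y) < (v + v') / 2"
      by (rule order_tendstoD(2)[OF filterlim_compose[OF G_lim[OF y(1)] m]])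
    moreover have "\<forall>\<^sub>F r in sequentially. (v + v') / 2 < u r"
      using u v' by (intro order_tendstoD(1)[OF u]) simp
    ultimately show "\<forall>\<^sub>F r in sequentially. q (u r / real (k (m r))) / A (real (k (m r))) < a"
      using half u_pos Apos kpos
    proof eventually_elim
      case (elim r)
      have "q (u r / real (k (m r))) \<le> A (real (k (m r))) * y"
        using elim by (intro q_le) (auto simp: field_simps)
      then have "q (u r / real (k (m r))) / A (real (k (m r))) \<le> y"
        using elim by (simp add: field_simps)
      then show ?case using y by linarith
    qed
  }
qed

text \<open>For general \<open>n\<close> in the block of \<open>k m\<close> the quantile at \<open>s / n\<close> is the one at \<open>(s / \<gamma>) / k m\<close>,
  where \<open>\<gamma> = n / k m\<close>, so that the limit is a rescaled version of the one along the blocks.\<close>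

lemma quantile_tendsto:
  assumes n: "filterlim n sequentially sequentially"
    and pos: "(\<lambda>r. position_parameter k (n r)) \<longlonglongrightarrow> \<theta>" and "\<theta> > 0"
    and "s > 0" and R: "isCont R (s / \<theta>)"
  shows "(\<lambda>r. q (s / real (n r)) / A (real (n r))) \<longlonglongrightarrow> levy_inverse \<alpha> M \<theta> s"
proof -
  define block where "block n = (SOME m. 1 \<le> m \<and> k (m - 1) < n \<and> n \<le> k m \<and> position_parameter k n = real n / real (k m))" for n
  have block: "1 \<le> block n \<and> k (block n - 1) < n \<and> n \<le> k (block n) \<and> position_parameter k n = real n / real (k (block n))"
    if "1 \<le> n" for n
  proof -
    obtain m where "1 \<le> m \<and> k (m - 1) < n \<and> n \<le> k m \<and> position_parameter k n = real n / real (k m)"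
      using block_exists[OF \<open>1 \<le> n\<close>] by metis
    then show ?thesis
      unfolding block_def by (rule someI)
  qed
  define m where "m r = block (n r)" for r
  have n1: "\<forall>\<^sub>F r in sequentially. 1 \<le> n r"
    using n by (simp add: filterlim_at_top)
  have m_top: "filterlim m sequentially sequentially"
    unfolding filterlim_at_top
  proof
    fix Z
    have "\<forall>\<^sub>F r in sequentially. k Z \<le> n r" using n by (simp add: filterlim_at_top)
    with n1 show "\<forall>\<^sub>F r in sequentially. Z \<le> m r"
    proof eventually_elim
      case (elim r)
      then have "k Z \<le> k (m r)" using block[of "n r"] unfolding m_def by linarith
      then show ?case using k_mono by (simp add: strict_mono_less_eq)
    qed
  qed
  let ?\<gamma> = "\<lambda>r. position_parameter k (n r)"
  have "(\<lambda>r. s / ?\<gamma> r) \<longlonglongrightarrow> s / \<theta>"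
    using \<open>\<theta> > 0\<close> by (intro tendsto_divide tendsto_const pos) auto
  then have 1: "(\<lambda>r. q (s / ?\<gamma> r / real (k (m r))) / A (real (k (m r)))) \<longlonglongrightarrow> R (s / \<theta>)"
    using \<open>s > 0\<close> \<open>\<theta> > 0\<close> R by (intro quantile_tendsto_along_blocks m_top) auto
  have 2: "(\<lambda>r. A (?\<gamma> r * real (k (m r))) / A (real (k (m r)))) \<longlonglongrightarrow> \<theta> powr (1 / \<alpha>)"
    by (intro A_ratio_tendsto filterlim_compose[OF k_at_top m_top] pos \<open>\<theta> > 0\<close>)
  have "(\<lambda>r. q (s / ?\<gamma> r / real (k (m r))) / A (real (k (m r))) / (A (?\<gamma> r * real (k (m r))) / A (real (k (m r)))))
      \<longlonglongrightarrow> R (s / \<theta>) / \<theta> powr (1 / \<alpha>)"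
    using \<open>\<theta> > 0\<close> by (intro tendsto_divide 1 2) auto
  moreover have "\<forall>\<^sub>F r in sequentially.
      q (s / ?\<gamma> r / real (k (m r))) / A (real (k (m r))) / (A (?\<gamma> r * real (k (m r))) / A (real (k (m r))))
      = q (s / real (n r)) / A (real (n r))"
    using n1
  proof eventually_elim
    case (elim r)
    have k: "k (m r) \<ge> 1" using block[OF elim] k_pos by (simp add: m_def)
    then have "A (real (k (m r))) > 0" by (intro A_pos) simp
    moreover have "?\<gamma> r * real (k (m r)) = real (n r)"
      using block[OF elim] k by (simp add: m_def)
    ultimately show ?case by (simp add: divide_divide_eq_left)
  qed
  ultimately have "(\<lambda>r. q (s / real (n r)) / A (real (n r))) \<longlonglongrightarrow> R (s / \<theta>) / \<theta> powr (1 / \<alpha>)"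
    by (rule Lim_transform_eventually)
  then show ?thesis using levy_inverse_scale[OF \<open>\<theta> > 0\<close> \<open>s > 0\<close>] by simp
qed

lemma tail_bound:
  obtains y K where "y > 0" "K \<ge> 1" "\<And>n. 1 \<le> n \<Longrightarrow> G (A (real n) * y) \<le> K / real n"
proof -
  obtain y\<^sub>0 where y0: "y\<^sub>0 \<in> good_points M" "0 < y\<^sub>0"
    using good_points_dense[OF profile, of 0 1] by auto
  obtain K where K: "\<And>m. norm (real (k m) * G (A (real (k m)) * y\<^sub>0)) \<le> K"
    using convergent_imp_Bseq[OF convergentI[OF G_lim[OF y0(1)]]] by (auto simp: Bseq_def)
  obtain D where D: "D \<ge> 1" "\<And>m n. 1 \<le> m \<Longrightarrow> k (m - 1) < n \<Longrightarrow> real (k m) \<le> D * real n"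
    using k_ratio_bounded by blast
  define p where "p = 1 / (2 * \<alpha>)"
  define p' where "p' = 2 / \<alpha>"
  obtain C where C: "C > 0" "\<And>m n :: nat. 1 \<le> m \<Longrightarrow> 1 \<le> n \<Longrightarrow>
       A (real m) \<le> C * A (real n) * ((real m / real n) powr p' + (real m / real n) powr p)"
    using A_potter_nat[of p p'] \<alpha>_pos by (auto simp: p_def p'_def field_simps)
  define E where "E = C * (D powr p' + D powr p)"
  have "E > 0" using C D by (simp add: E_def add_pos_pos)
  show thesis
  proof (rule that[of "E * y\<^sub>0" "max K 1"])
    fix n :: nat assume n: "1 \<le> n"
    obtain m where m: "1 \<le> m" "k (m - 1) < n" "n \<le> k m"
      using block_exists[OF n] by metis
    have ratio: "real (k m) / real n \<le> D" using D(2)[OF m(1,2)] n by (simp add: field_simps)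
    have "A (real (k m)) \<le> C * A (real n) * ((real (k m) / real n) powr p' + (real (k m) / real n) powr p)"
      using k_pos[OF m(1)] n by (intro C) auto
    also have "\<dots> \<le> C * A (real n) * (D powr p' + D powr p)"
      using ratio C(1) A_pos[of "real n"] n \<alpha>_pos
      by (intro mult_left_mono add_mono powr_mono2) (auto simp: p_def p'_def)
    finally have "A (real (k m)) * y\<^sub>0 \<le> C * A (real n) * (D powr p' + D powr p) * y\<^sub>0"
      using y0 by (intro mult_right_mono) auto
    also have "\<dots> = A (real n) * (E * y\<^sub>0)"
      by (simp add: E_def algebra_simps)
    finally have "A (real (k m)) * y\<^sub>0 \<le> A (real n) * (E * y\<^sub>0)" .
    then have "G (A (real n) * (E * y\<^sub>0)) \<le> G (A (real (k m)) * y\<^sub>0)"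
      using G_antimono by (simp add: antimonoD)
    also have "\<dots> \<le> max K 1 / real (k m)"
      using K[of m] G_nonneg k_pos[OF m(1)] by (auto simp: field_simps abs_mult)
    also have "\<dots> \<le> max K 1 / real n"
      using m n by (intro divide_left_mono) auto
    finally show "G (A (real n) * (E * y\<^sub>0)) \<le> max K 1 / real n" .
  qed (use \<open>E > 0\<close> y0 in auto)
qed

text \<open>The integrable majorant for all scaled quantiles.  Applying the tail bound at the index
  \<open>n' \<approx> K n / u\<close> bounds the quantile at \<open>u / n\<close> by \<open>A n'\<close>, and Potter's bound compares
  \<open>A n'\<close> with \<open>A n\<close>.\<close>

lemma quantile_bound:
  assumes p: "0 < p" "p < 1 / \<alpha>"
  obtains K where "K > 0"
    "\<And>n u. 1 \<le> n \<Longrightarrow> 1 \<le> u \<Longrightarrow> u \<le> real n / 2 \<Longrightarrow> \<bar>q (u / real n) / A (real n)\<bar> \<le> K * u powr (- p)"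
proof -
  obtain y K where K: "y > 0" "K \<ge> 1" "\<And>n. 1 \<le> n \<Longrightarrow> G (A (real n) * y) \<le> K / real n"
    using tail_bound by blast
  define p' where "p' = 2 / \<alpha>"
  have pp': "p \<le> p'" "0 < p'" using p \<alpha>_pos by (auto simp: p'_def field_simps)
  obtain C where C: "C > 0" "\<And>m n :: nat. 1 \<le> m \<Longrightarrow> 1 \<le> n \<Longrightarrow>
       A (real m) \<le> C * A (real n) * ((real m / real n) powr p' + (real m / real n) powr p)"
    using A_potter_nat[of p p'] p \<alpha>_pos by (auto simp: p'_def divide_strict_right_mono)
  have A1: "A 1 > 0" by (rule A_pos) simp
  define K\<^sub>1 where "K\<^sub>1 = y * C * ((K + 1) powr p' + (K + 1) powr p)"
  define K\<^sub>2 where "K\<^sub>2 = \<bar>q (1/2)\<bar> / A 1 * (2 * C)"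
  have "K\<^sub>1 > 0" using K C by (simp add: K\<^sub>1_def add_pos_pos)
  have "K\<^sub>2 \<ge> 0" using C A1 by (simp add: K\<^sub>2_def)
  show thesis
  proof (rule that[of "K\<^sub>1 + K\<^sub>2"])
    fix n :: nat and u :: real assume n: "1 \<le> n" and u: "1 \<le> u" "u \<le> real n / 2"
    have An: "A (real n) > 0" using n by (intro A_pos) simp
    have un: "0 < u / real n" "u / real n \<le> 1/2" "u \<le> real n" using u n by (auto simp: field_simps)
    define n' where "n' = nat \<lfloor>K * real n / u\<rfloor> + 1"
    have Knu: "K * real n / u \<ge> 0" using K u by simp
    then have n': "K * real n / u < real n'" "real n' \<le> K * real n / u + 1" "1 \<le> n'"
      unfolding n'_def by linarith+
    have "1 \<le> real n / u" using u un by (simp add: field_simps)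
    then have "real n' \<le> (K + 1) * real n / u" using n' by (simp add: add_divide_distrib distrib_right)
    then have ratio: "real n' / real n \<le> (K + 1) / u" using n u by (simp add: field_simps)
    have pw: "(real n' / real n) powr r \<le> (K + 1) powr r * u powr (- p)" if "p \<le> r" for r
    proof -
      have "(real n' / real n) powr r \<le> ((K + 1) / u) powr r"
        using ratio p that by (intro powr_mono2) auto
      also have "\<dots> = (K + 1) powr r * u powr (- r)"
        by (simp only: powr_divide powr_minus divide_inverse[of _ "u powr r"])
      also have "\<dots> \<le> (K + 1) powr r * u powr (- p)"
        using u that by (intro mult_left_mono powr_mono) auto
      finally show ?thesis .
    qed
    have "G (A (real n') * y) \<le> K / real n'" using n' by (intro K)
    also have "\<dots> < u / real n" using n' n u by (simp add: field_simps)
    finally have "q (u / real n) \<le> A (real n') * y"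
      using un by (intro q_le) (auto intro: le_less_trans[of _ "1/2"])
    also have "\<dots> \<le> C * A (real n) * ((real n' / real n) powr p' + (real n' / real n) powr p) * y"
      using C(2)[OF n'(3) n] K by (intro mult_right_mono) auto
    also have "\<dots> \<le> C * A (real n) * ((K + 1) powr p' * u powr (- p) + (K + 1) powr p * u powr (- p)) * y"
      using C An K pp' by (intro mult_right_mono mult_left_mono add_mono pw) auto
    also have "\<dots> = K\<^sub>1 * u powr (- p) * A (real n)"
      by (simp add: K\<^sub>1_def algebra_simps)
    finally have upper: "q (u / real n) / A (real n) \<le> K\<^sub>1 * u powr (- p)"
      using An by (simp add: field_simps)
    (* From below the quantile is at least its value at 1/2, and A n exceeds a multiple of n powr p. *)
    have "A 1 \<le> C * A (real n) * ((1 / real n) powr p' + (1 / real n) powr p)"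
      using C(2)[of 1 n] n by simp
    also have "\<dots> \<le> C * A (real n) * (u powr (- p) + u powr (- p))"
    proof -
      have "(1 / real n) powr r \<le> u powr (- p)" if "p \<le> r" for r
      proof -
        have "(1 / real n) powr r \<le> (1 / u) powr r"
          using un u that p n by (intro powr_mono2 divide_left_mono) auto
        also have "\<dots> = u powr (- r)" by (simp only: powr_divide powr_minus divide_inverse[of _ "u powr r"] powr_one_eq_one mult_1_left)
        also have "\<dots> \<le> u powr (- p)" using u that by (intro powr_mono) auto
        finally show ?thesis .
      qed
      then show ?thesis using C An pp' by (intro mult_left_mono add_mono) auto
    qed
    finally have "1 \<le> 2 * C / A 1 * u powr (- p) * A (real n)"
      using A1 by (simp add: field_simps)
    then have "\<bar>q (1/2)\<bar> * 1 \<le> \<bar>q (1/2)\<bar> * (2 * C / A 1 * u powr (- p) * A (real n))"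
      by (intro mult_left_mono) auto
    then have "- q (1/2) \<le> K\<^sub>2 * u powr (- p) * A (real n)"
      by (simp add: K\<^sub>2_def)
    moreover have "q (1/2) \<le> q (u / real n)" using un by (intro q_antimono) auto
    ultimately have lower: "- (K\<^sub>2 * u powr (- p)) \<le> q (u / real n) / A (real n)"
      using An by (simp add: field_simps)
    have "0 \<le> K\<^sub>1 * u powr (- p)" "0 \<le> K\<^sub>2 * u powr (- p)"
      using \<open>K\<^sub>1 > 0\<close> \<open>K\<^sub>2 \<ge> 0\<close> by auto
    then show "\<bar>q (u / real n) / A (real n)\<bar> \<le> (K\<^sub>1 + K\<^sub>2) * u powr (- p)"
      using upper lower by (auto simp: abs_le_iff distrib_right)
  qed (use \<open>K\<^sub>1 > 0\<close> \<open>K\<^sub>2 \<ge> 0\<close> in auto)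
qed

end

section \<open>Convergence of the exponents\<close>

lemma set_integrable_nonneg_lborelI:
  fixes f :: "real \<Rightarrow> real"
  assumes "f integrable_on S" "\<And>x. x \<in> S \<Longrightarrow> 0 \<le> f x" "S \<in> sets borel" "f \<in> borel_measurable borel"
  shows "set_integrable lborel S f"
proof -
  have "f absolutely_integrable_on S"
    using assms(1,2) by (rule nonnegative_absolutely_integrable_1)
  then show ?thesis
    unfolding set_integrable_def using assms(3,4) by (subst (asm) integrable_completion) auto
qed

lemma set_integrable_powr_to_inf: "p < -1 \<Longrightarrow> set_integrable lborel {1..} (\<lambda>x::real. x powr p)"
  using has_integral_powr_to_inf[of p 1] by (intro set_integrable_nonneg_lborelI) auto

lemma set_integrable_powr_from_0: "p > -1 \<Longrightarrow> set_integrable lborel {0<..1} (\<lambda>x::real. x powr p)"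
  by (intro set_integrable_nonneg_lborelI integrable_on_powr_from_0') auto

text \<open>The integrand of the exponents.  With a Boolean switch for the compensator the truncations \<open>u \<ge> 1\<close> and
  \<open>u > 1\<close>, which differ on a null set, are treated alike.\<close>

definition compensated_exp :: "real \<Rightarrow> bool \<Rightarrow> complex" where
  "compensated_exp x b = iexp x - 1 - \<i> * of_real x * of_bool b"

lemma norm_compensated_exp_False: "norm (compensated_exp x False) \<le> 2"
proof -
  have "norm (iexp x - 1) \<le> norm (iexp x) + norm (1::complex)" by (rule norm_triangle_ineq4)
  then show ?thesis by (simp add: compensated_exp_def)
qed

lemma norm_compensated_exp_True: "norm (compensated_exp x True) \<le> x\<^sup>2 / 2"
proof -
  have "compensated_exp x True = iexp x - (\<Sum>k\<le>1. (\<i> * x) ^ k / fact k)"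
    by (simp add: compensated_exp_def)
  then show ?thesis
    using iexp_approx1[of x 1] by (simp add: numeral_2_eq_2)
qed

lemma Re_compensated_exp: "Re (compensated_exp x b) = cos x - 1"
  by (cases b) (simp_all add: compensated_exp_def Re_exp)

lemma compensated_exp_measurable [measurable]:
  assumes [measurable]: "f \<in> borel_measurable borel" "Measurable.pred borel P"
  shows "(\<lambda>u. compensated_exp (f u) (P u)) \<in> borel_measurable borel"
proof -
  have "(\<lambda>u. compensated_exp (f u) (P u)) = (\<lambda>u. iexp (f u) - 1 - \<i> * of_real (f u) * (if P u then 1 else 0))"
    by (auto simp: compensated_exp_def)
  then show ?thesis by simp
qed

lemma compensated_exp_dominated:
  assumes "1 \<le> u \<Longrightarrow> \<bar>x\<bar> \<le> B * u powr (- p)" and "u > 0"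
  shows "norm (compensated_exp x (1 \<le> u)) \<le> 2 * indicator {0..1} u + B\<^sup>2 / 2 * (indicator {1..} u * u powr (- 2 * p))"
proof (cases "1 \<le> u")
  case True
  have "x\<^sup>2 \<le> (B * u powr (- p))\<^sup>2"
    using power_mono[OF assms(1)[OF True], of 2] by simp
  also have "(B * u powr (- p))\<^sup>2 = B\<^sup>2 * u powr (- 2 * p)"
    using \<open>u > 0\<close> by (simp add: power_mult_distrib powr_power)
  finally show ?thesis
    using True norm_compensated_exp_True[of x] by (auto simp: indicator_def)
next
  case False
  then show ?thesis using \<open>u > 0\<close> norm_compensated_exp_False[of x] by (auto simp: indicator_def)
qed

lemma compensated_majorant_integrable:
  assumes "p > 1/2"
  shows "integrable lborel (\<lambda>u::real. 2 * indicator {0..1} u + B * (indicator {1..} u * u powr (- 2 * p)))"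
proof -
  have "integrable lborel (\<lambda>u::real. indicator {1..} u * u powr (- 2 * p))"
    using set_integrable_powr_to_inf[of "- 2 * p"] assms by (simp add: set_integrable_def)
  moreover have "integrable lborel (indicator {0..1} :: real \<Rightarrow> real)"
    by (simp add: integrable_indicator_iff emeasure_lborel_Icc_eq)
  ultimately show ?thesis by (intro Bochner_Integration.integrable_add integrable_mult_right)
qed

text \<open>Dominated convergence for the integrals that define the exponents.  Near zero the integrand is
  bounded; for \<open>u \<ge> 1\<close> the compensator makes it quadratic in an argument of order \<open>u powr -p\<close>
  with \<open>p > 1/2\<close>.\<close>

lemma compensated_integral_tendsto:
  fixes f :: "nat \<Rightarrow> real \<Rightarrow> real"
  assumes [measurable]: "\<And>r. f r \<in> borel_measurable borel" "g \<in> borel_measurable borel" "\<And>r. S r \<in> sets borel"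
    and S: "\<And>r. S r \<subseteq> {0<..}" "\<And>u. u > 0 \<Longrightarrow> \<forall>\<^sub>F r in sequentially. u \<in> S r"
    and lim: "AE u in lborel. u > 0 \<longrightarrow> (\<lambda>r. f r u) \<longlonglongrightarrow> g u"
    and bound: "\<And>r u. u \<in> S r \<Longrightarrow> 1 \<le> u \<Longrightarrow> \<bar>f r u\<bar> \<le> B * u powr (- p)"
    and "p > 1/2"
  shows "(\<lambda>r. LINT u:S r|lborel. compensated_exp (f r u) (1 \<le> u)) \<longlonglongrightarrow> (LINT u:{0<..}|lborel. compensated_exp (g u) (1 < u))"
    (is "?lim") and "set_integrable lborel {0<..} (\<lambda>u. compensated_exp (g u) (1 < u))" (is "?int")
proof -
  have [measurable]: "Measurable.pred borel (\<lambda>u::real. 1 \<le> u)" "Measurable.pred borel (\<lambda>u::real. 1 < u)"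
    by measurable
  have ne1: "AE u in lborel. (u::real) \<noteq> 1"
    by (rule AE_lborel_singleton)
  have lim': "AE u in lborel. (\<lambda>r. indicator (S r) u *\<^sub>R compensated_exp (f r u) (1 \<le> u))
      \<longlonglongrightarrow> indicator {0<..} u *\<^sub>R compensated_exp (g u) (1 < u)"
    using lim ne1
  proof eventually_elim
    case (elim u)
    show ?case
    proof (cases "u > 0")
      case True
      have "(\<lambda>r. compensated_exp (f r u) (1 \<le> u)) \<longlonglongrightarrow> compensated_exp (g u) (1 \<le> u)"
        unfolding compensated_exp_def using elim True by (intro tendsto_intros) auto
      moreover have "(1 \<le> u) = (1 < u)" using elim by auto
      moreover have "\<forall>\<^sub>F r in sequentially. compensated_exp (f r u) (1 \<le> u) = indicator (S r) u *\<^sub>R compensated_exp (f r u) (1 \<le> u)"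
        using S(2)[OF True] by eventually_elim simp
      ultimately show ?thesis using True by (simp add: Lim_transform_eventually)
    next
      case False
      then have "u \<notin> S r" for r using S(1)[of r] by auto
      then show ?thesis using False by simp
    qed
  qed
  have dom: "AE u in lborel. norm (indicator (S r) u *\<^sub>R compensated_exp (f r u) (1 \<le> u))
      \<le> 2 * indicator {0..1} u + B\<^sup>2 / 2 * (indicator {1..} u * u powr (- 2 * p))" for r
  proof (rule AE_I2)
    fix u :: real
    show "norm (indicator (S r) u *\<^sub>R compensated_exp (f r u) (1 \<le> u))
      \<le> 2 * indicator {0..1} u + B\<^sup>2 / 2 * (indicator {1..} u * u powr (- 2 * p))"
    proof (cases "u \<in> S r")
      case True
      then have "u > 0" using S(1) by auto
      then show ?thesis using compensated_exp_dominated[OF bound[OF True]] True by simp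
    qed (simp add: indicator_def)
  qed
  have meas: "(\<lambda>u. indicator {0<..} u *\<^sub>R compensated_exp (g u) (1 < u)) \<in> borel_measurable lborel"
    "(\<lambda>u. indicator (S r) u *\<^sub>R compensated_exp (f r u) (1 \<le> u)) \<in> borel_measurable lborel" for r
    by measurable
  note dct = meas compensated_majorant_integrable[OF \<open>p > 1/2\<close>, of "B\<^sup>2 / 2"] lim' dom
  show ?lim unfolding set_lebesgue_integral_def by (rule integral_dominated_convergence[OF dct])
  show ?int unfolding set_integrable_def by (rule integrable_dominated_convergence[OF dct])
qed

lemma LINT_compensated_le_eq_less:
  "(LINT u:{0<..}|lborel. compensated_exp (g u) (1 \<le> u)) = (LINT u:{0<..}|lborel. compensated_exp (g u) (1 < (u::real)))"
  if [measurable]: "g \<in> borel_measurable borel"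
  unfolding set_lebesgue_integral_def
proof (rule integral_cong_AE)
  have [measurable]: "Measurable.pred borel (\<lambda>u::real. 1 \<le> u)" "Measurable.pred borel (\<lambda>u::real. 1 < u)"
    by measurable
  show "(\<lambda>u. indicator {0<..} u *\<^sub>R compensated_exp (g u) (1 \<le> u)) \<in> borel_measurable lborel"
    "(\<lambda>u. indicator {0<..} u *\<^sub>R compensated_exp (g u) (1 < u)) \<in> borel_measurable lborel"
    by measurable
  show "AE u in lborel. indicator {0<..} u *\<^sub>R compensated_exp (g u) (1 \<le> u) = indicator {0<..} u *\<^sub>R compensated_exp (g u) (1 < u)"
    using AE_lborel_singleton[of "1::real"] by eventually_elim (auto simp: order_less_le)
qed

lemma antimono_indicator_measurable:
  fixes f :: "real \<Rightarrow> real"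
  assumes "antimono_on S f" "S \<in> sets borel"
  shows "(\<lambda>x. indicator S x * f x) \<in> borel_measurable borel"
proof -
  have "mono_on S (\<lambda>x. - f x)"
    using assms(1) by (auto simp: monotone_on_def)
  then have "(\<lambda>x. - f x) \<in> borel_measurable (restrict_space borel S)"
    by (rule borel_measurable_mono_on_fnc)
  then have "(\<lambda>x. indicator S x * (- f x)) \<in> borel_measurable borel"
    using assms(2) by (subst (asm) borel_measurable_restrict_space_iff) auto
  then have "(\<lambda>x. - (indicator S x * (- f x))) \<in> borel_measurable borel"
    by (rule borel_measurable_uminus)
  then show ?thesis by simp
qed

context levy_profile
begin

definition levy_exponent :: "real \<Rightarrow> real \<Rightarrow> complex" where
  "levy_exponent \<theta> t = (LINT s:{0<..}|lborel. compensated_exp (t * levy_inverse \<alpha> M \<theta> s) (1 < s))"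

lemma levy_inverse_measurable:
  assumes "\<theta> > 0"
  shows "(\<lambda>s. indicator {0<..} s * levy_inverse \<alpha> M \<theta> s) \<in> borel_measurable borel"
  using levy_inverse_antimono[OF assms] by (intro antimono_indicator_measurable) (auto simp: monotone_on_def)

lemma levy_exponent_alt:
  "levy_exponent \<theta> t = (LINT s:{0<..}|lborel. compensated_exp (t * (indicator {0<..} s * levy_inverse \<alpha> M \<theta> s)) (1 < s))"
  unfolding levy_exponent_def by (rule set_lebesgue_integral_cong) auto

lemma levy_inverse_tendsto:
  assumes "\<And>r. \<theta> r > 0" "\<theta> \<longlonglongrightarrow> \<theta>'" "\<theta>' > 0" "s > 0" "isCont (levy_inverse \<alpha> M 1) (s / \<theta>')"
  shows "(\<lambda>r. levy_inverse \<alpha> M (\<theta> r) s) \<longlonglongrightarrow> levy_inverse \<alpha> M \<theta>' s"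
proof -
  have "(\<lambda>r. levy_inverse \<alpha> M 1 (s / \<theta> r)) \<longlonglongrightarrow> levy_inverse \<alpha> M 1 (s / \<theta>')"
    using assms by (intro isCont_tendsto_compose[OF assms(5)] tendsto_intros) auto
  then have "(\<lambda>r. levy_inverse \<alpha> M 1 (s / \<theta> r) / \<theta> r powr (1 / \<alpha>)) \<longlonglongrightarrow> levy_inverse \<alpha> M 1 (s / \<theta>') / \<theta>' powr (1 / \<alpha>)"
    using assms by (intro tendsto_intros) auto
  then show ?thesis
    using assms by (simp add: levy_inverse_scale[of "\<theta> _"] levy_inverse_scale[of \<theta>'])
qed

lemma levy_inverse_upper':
  assumes "\<theta> > 0" "s > 0"
  shows "\<bar>t * levy_inverse \<alpha> M \<theta> s\<bar> \<le> \<bar>t\<bar> * b powr (1 / \<alpha>) * s powr (- (1 / \<alpha>))"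
proof -
  have "\<bar>levy_inverse \<alpha> M \<theta> s\<bar> \<le> (b / s) powr (1 / \<alpha>)"
    using levy_inverse_upper[OF assms] levy_inverse_nonneg[OF assms] by simp
  also have "\<dots> = b powr (1 / \<alpha>) * s powr (- (1 / \<alpha>))"
    by (simp only: powr_divide powr_minus divide_inverse[of _ "s powr (1 / \<alpha>)"])
  finally show ?thesis by (simp add: abs_mult mult_left_mono mult.assoc)
qed

lemma levy_exponent_tendsto:
  assumes "\<alpha> < 2" and \<theta>: "\<And>r. \<theta> r > 0" "\<theta> \<longlonglongrightarrow> \<theta>'" "\<theta>' > 0"
  shows "(\<lambda>r. levy_exponent (\<theta> r) t) \<longlonglongrightarrow> levy_exponent \<theta>' t"
    and "set_integrable lborel {0<..} (\<lambda>s. compensated_exp (t * levy_inverse \<alpha> M \<theta>' s) (1 < s))"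
proof -
  let ?R = "\<lambda>\<theta> s. indicator {0<..} s * levy_inverse \<alpha> M \<theta> s"
  have meas: "(\<lambda>u. t * ?R (\<theta> r) u) \<in> borel_measurable borel" for r
    using \<theta>(1) by (intro borel_measurable_times borel_measurable_const levy_inverse_measurable)
  have meas': "(\<lambda>u. t * ?R \<theta>' u) \<in> borel_measurable borel"
    using \<theta>(3) by (intro borel_measurable_times borel_measurable_const levy_inverse_measurable)
  have lim: "AE u in lborel. u > 0 \<longrightarrow> (\<lambda>r. t * ?R (\<theta> r) u) \<longlonglongrightarrow> t * ?R \<theta>' u"
    using AE_isCont_levy_inverse[OF \<theta>(3)]
    by eventually_elim (auto intro!: tendsto_intros levy_inverse_tendsto \<theta>)
  have bound: "\<bar>t * ?R (\<theta> r) u\<bar> \<le> \<bar>t\<bar> * b powr (1 / \<alpha>) * u powr (- (1 / \<alpha>))" if "u \<in> {0<..}" "1 \<le> u" for r u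
    using levy_inverse_upper'[OF \<theta>(1), of u t r] that by simp
  have p: "1 / 2 < 1 / \<alpha>" using \<alpha>_pos \<open>\<alpha> < 2\<close> by (simp add: field_simps)
  note * = compensated_integral_tendsto[where f = "\<lambda>r u. t * ?R (\<theta> r) u" and S = "\<lambda>_. {0<..}", OF meas meas' _ _ _ lim bound p]
  have lim: "(\<lambda>r. LINT u:{0<..}|lborel. compensated_exp (t * ?R (\<theta> r) u) (1 \<le> u)) \<longlonglongrightarrow>
      (LINT u:{0<..}|lborel. compensated_exp (t * ?R \<theta>' u) (1 < u))"
    by (rule *(1)) auto
  have int: "set_integrable lborel {0<..} (\<lambda>u. compensated_exp (t * ?R \<theta>' u) (1 < u))"
    by (rule *(2)) auto
  show "(\<lambda>r. levy_exponent (\<theta> r) t) \<longlonglongrightarrow> levy_exponent \<theta>' t"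
    using lim unfolding levy_exponent_alt LINT_compensated_le_eq_less[OF meas] .
  show "set_integrable lborel {0<..} (\<lambda>s. compensated_exp (t * levy_inverse \<alpha> M \<theta>' s) (1 < s))"
    using int by (rule set_integrable_cong[THEN iffD1, rotated -1]) auto
qed

lemma Re_levy_exponent:
  assumes "\<alpha> < 2" "\<theta> > 0"
  shows "Re (levy_exponent \<theta> t) = (LINT s:{0<..}|lborel. cos (t * levy_inverse \<alpha> M \<theta> s) - 1)"
    and "set_integrable lborel {0<..} (\<lambda>s. cos (t * levy_inverse \<alpha> M \<theta> s) - 1)"
proof -
  have int: "set_integrable lborel {0<..} (\<lambda>s. compensated_exp (t * levy_inverse \<alpha> M \<theta> s) (1 < s))"
    using assms by (intro levy_exponent_tendsto(2)[of "\<lambda>_. \<theta>"]) auto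
  show "Re (levy_exponent \<theta> t) = (LINT s:{0<..}|lborel. cos (t * levy_inverse \<alpha> M \<theta> s) - 1)"
    using integral_Re[OF int[unfolded set_integrable_def]]
    by (simp add: levy_exponent_def set_lebesgue_integral_def Re_compensated_exp)
  show "set_integrable lborel {0<..} (\<lambda>s. cos (t * levy_inverse \<alpha> M \<theta> s) - 1)"
    using integrable_Re[OF int[unfolded set_integrable_def]]
    by (simp add: set_integrable_def Re_compensated_exp)
qed

lemma Re_levy_exponent_nonpos:
  assumes "\<alpha> < 2" "\<theta> > 0" shows "Re (levy_exponent \<theta> t) \<le> 0"
proof -
  have "0 \<le> (LINT s:{0<..}|lborel. 1 - cos (t * levy_inverse \<alpha> M \<theta> s))"
    unfolding set_lebesgue_integral_def by (intro integral_nonneg_AE AE_I2) (auto simp: indicator_def)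
  also have "\<dots> = - Re (levy_exponent \<theta> t)"
    unfolding Re_levy_exponent[OF assms] set_lebesgue_integral_def
    by (subst Bochner_Integration.integral_minus[symmetric]) (auto intro!: Bochner_Integration.integral_cong simp: algebra_simps)
  finally show ?thesis by simp
qed

text \<open>Since \<open>levy_inverse\<close> is of order \<open>s powr (-1/\<alpha>)\<close>, the phase \<open>t * levy_inverse s\<close> is of order one
  for \<open>s\<close> between \<open>b * |t| powr \<alpha>\<close> and twice this number, and this range alone contributes
  a multiple of \<open>|t| powr \<alpha>\<close>.\<close>

lemma Re_levy_exponent_upper:
  assumes "\<alpha> < 2" "a > 0" and a: "\<And>x. x > 0 \<Longrightarrow> a \<le> M x"
  obtains \<kappa> where "\<kappa> > 0" "\<And>\<theta> t. \<theta> > 0 \<Longrightarrow> Re (levy_exponent \<theta> t) \<le> - \<kappa> * \<bar>t\<bar> powr \<alpha>"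
proof -
  have "a \<le> b" using a[of 1] M_le[of 1] by simp
  define z where "z = (a / (2 * b)) powr (1 / \<alpha>)"
  have "z > 0" using \<open>a > 0\<close> b_pos by (simp add: z_def)
  have "z \<le> 1 powr (1 / \<alpha>)" unfolding z_def using \<alpha>_pos \<open>a \<le> b\<close> \<open>a > 0\<close> b_pos by (intro powr_mono2) (auto simp: field_simps)
  then have "z \<le> 1" by simp
  have "cos z < cos 0" using \<open>z > 0\<close> \<open>z \<le> 1\<close> pi_gt3 by (intro cos_monotone_0_pi) auto
  show thesis
  proof (rule that[of "b * (1 - cos z)"])
    show "b * (1 - cos z) > 0" using \<open>cos z < cos 0\<close> b_pos by simp
    fix \<theta> t :: real assume "\<theta> > 0"
    define R where "R = levy_inverse \<alpha> M \<theta>"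
    show "Re (levy_exponent \<theta> t) \<le> - (b * (1 - cos z)) * \<bar>t\<bar> powr \<alpha>"
    proof (cases "t = 0")
      case True
      then show ?thesis using Re_levy_exponent_nonpos[OF \<open>\<alpha> < 2\<close> \<open>\<theta> > 0\<close>, of t] \<alpha>_pos by simp
    next
      case False
      define s where "s = b * \<bar>t\<bar> powr \<alpha>"
      have "s > 0" using False b_pos by (simp add: s_def)
      have phase: "cos (t * R u) - 1 \<le> cos z - 1" if "u \<in> {s<..2 * s}" for u
      proof -
        have "u > 0" using that \<open>s > 0\<close> by simp
        have tpow: "\<bar>t\<bar> = (s / b) powr (1 / \<alpha>)"
          using \<alpha>_pos b_pos False by (simp add: s_def powr_powr)
        have "\<bar>t\<bar> * R u \<le> \<bar>t\<bar> * (b / u) powr (1 / \<alpha>)"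
          unfolding R_def using levy_inverse_upper[OF \<open>\<theta> > 0\<close> \<open>u > 0\<close>] by (intro mult_left_mono) auto
        also have "\<dots> = (s / b * (b / u)) powr (1 / \<alpha>)"
          unfolding tpow by (rule powr_mult[symmetric])
        also have "\<dots> \<le> 1 powr (1 / \<alpha>)"
          using that \<open>s > 0\<close> b_pos \<alpha>_pos by (intro powr_mono2) (auto simp: field_simps)
        finally have up: "\<bar>t\<bar> * R u \<le> 1" by simp
        have "z \<le> (s / b * (a / u)) powr (1 / \<alpha>)"
          unfolding z_def using that \<open>s > 0\<close> b_pos \<alpha>_pos \<open>a > 0\<close> by (intro powr_mono2) (auto simp: field_simps)
        also have "\<dots> = \<bar>t\<bar> * (a / u) powr (1 / \<alpha>)"
          unfolding tpow by (rule powr_mult)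
        also have "\<dots> \<le> \<bar>t\<bar> * R u"
          unfolding R_def using levy_inverse_lower[OF \<open>\<theta> > 0\<close> \<open>u > 0\<close> \<open>a > 0\<close> a] by (intro mult_left_mono) auto
        finally have low: "z \<le> \<bar>t\<bar> * R u" .
        have "cos (t * R u) = cos (\<bar>t\<bar> * R u)" by (cases "t \<ge> 0") auto
        also have "\<dots> \<le> cos z" using low up \<open>z > 0\<close> pi_gt3 by (intro cos_monotone_0_pi_le) auto
        finally show ?thesis by simp
      qed
      have "Re (levy_exponent \<theta> t) = (LINT u:{0<..}|lborel. cos (t * R u) - 1)"
        unfolding R_def by (rule Re_levy_exponent(1)[OF \<open>\<alpha> < 2\<close> \<open>\<theta> > 0\<close>])
      also have "\<dots> \<le> (LINT u|lborel. indicator {s<..2 * s} u *\<^sub>R (cos z - 1))"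
        unfolding set_lebesgue_integral_def
      proof (rule integral_mono)
        show "integrable lborel (\<lambda>u. indicator {0<..} u *\<^sub>R (cos (t * R u) - 1))"
          using Re_levy_exponent(2)[OF \<open>\<alpha> < 2\<close> \<open>\<theta> > 0\<close>] unfolding R_def set_integrable_def .
        show "integrable lborel (\<lambda>u. indicator {s<..2 * s} u *\<^sub>R (cos z - 1))"
          using \<open>s > 0\<close> by (intro integrable_scaleR_left) (simp add: integrable_indicator_iff)
        show "indicator {0<..} u *\<^sub>R (cos (t * R u) - 1) \<le> indicator {s<..2 * s} u *\<^sub>R (cos z - 1)" for u
          using phase[of u] \<open>s > 0\<close> by (auto simp: indicator_def)
      qed
      also have "\<dots> = s * (cos z - 1)"
        using \<open>s > 0\<close> by simp
      finally show ?thesis by (simp add: s_def algebra_simps)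
    qed
  qed
qed

end

context one_sided_tail
begin

text \<open>The contribution of one half of the law to \<open>n\<close> times the compensated
  characteristic function of a summand, in the scale in which it converges.\<close>

definition half_exponent :: "nat \<Rightarrow> real \<Rightarrow> complex" where
  "half_exponent n t = (LINT u:{0<..<real n / 2}|lborel. compensated_exp (t * (q (u / real n) / A (real n))) (1 \<le> u))"

text \<open>A Borel measurable extension of \<open>q\<close>, which is known to be monotone only on the unit
  interval.\<close>

definition q_ext :: "real \<Rightarrow> real" where
  "q_ext s = indicator {0<..<1} s * q s"

lemma q_ext_measurable [measurable]: "q_ext \<in> borel_measurable borel"
  unfolding q_ext_def using q_antimono by (intro antimono_indicator_measurable) (auto simp: monotone_on_def)

lemma q_ext_eq: "0 < s \<Longrightarrow> s < 1 \<Longrightarrow> q_ext s = q s"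
  by (simp add: q_ext_def)

lemma half_exponent_tendsto:
  assumes "\<alpha> < 2"
    and n: "filterlim n sequentially sequentially"
    and pos: "(\<lambda>r. position_parameter k (n r)) \<longlonglongrightarrow> \<theta>" and "\<theta> > 0"
    and t: "t \<longlonglongrightarrow> t'"
  shows "(\<lambda>r. half_exponent (n r) (t r)) \<longlonglongrightarrow> levy_exponent \<theta> t'"
proof -
  (* Above 1/2 for a square integrable majorant at infinity, below 1/\<alpha> for Potter's bound. *)
  define p where "p = (1/2 + 1/\<alpha>) / 2"
  have p: "1/2 < p" "0 < p" "p < 1 / \<alpha>"
    using \<alpha>_pos \<open>\<alpha> < 2\<close> by (auto simp: p_def field_simps)
  obtain K where K: "K > 0"
    "\<And>n u. 1 \<le> n \<Longrightarrow> 1 \<le> u \<Longrightarrow> u \<le> real n / 2 \<Longrightarrow> \<bar>q (u / real n) / A (real n)\<bar> \<le> K * u powr (- p)"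
    using quantile_bound[OF p(2,3)] by blast
  obtain T where T: "\<And>r. norm (t r) \<le> T"
    using convergent_imp_Bseq[OF convergentI[OF t]] by (auto simp: Bseq_def)
  then have "T \<ge> 0" by (meson norm_ge_zero order_trans)
  have inS: "0 < u / real (n r)" "u / real (n r) < 1" "1 \<le> n r" if "u \<in> {0<..<real (n r) / 2}" for u r
    using that by (auto simp: field_simps)
  let ?R = "\<lambda>s. indicator {0<..} s * levy_inverse \<alpha> M \<theta> s"
  let ?f = "\<lambda>r u. t r * (q_ext (u / real (n r)) / A (real (n r)))"
  have "(\<lambda>r. LINT u:{0<..<real (n r) / 2}|lborel. compensated_exp (?f r u) (1 \<le> u)) \<longlonglongrightarrow>
      (LINT u:{0<..}|lborel. compensated_exp (t' * ?R u) (1 < u))"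
  proof (rule compensated_integral_tendsto[where p = p and B = "T * K"])
    show "?f r \<in> borel_measurable borel" for r by measurable
    show "(\<lambda>u. t' * ?R u) \<in> borel_measurable borel"
      using \<open>\<theta> > 0\<close> by (intro borel_measurable_times borel_measurable_const levy_inverse_measurable)
    have large: "\<forall>\<^sub>F r in sequentially. u \<in> {0<..<real (n r) / 2}" if "u > 0" for u :: real
    proof -
      have "\<forall>\<^sub>F r in sequentially. 2 * u < real (n r)"
        using filterlim_compose[OF filterlim_real_sequentially n] by (simp add: filterlim_at_top_dense)
      then show ?thesis by eventually_elim (use that in auto)
    qed
    show "u > 0 \<Longrightarrow> \<forall>\<^sub>F r in sequentially. u \<in> {0<..<real (n r) / 2}" for u
      by (rule large)
    show "AE u in lborel. u > 0 \<longrightarrow> (\<lambda>r. ?f r u) \<longlonglongrightarrow> t' * ?R u"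
      using AE_isCont_levy_inverse[OF \<open>\<theta> > 0\<close>]
    proof eventually_elim
      case (elim u)
      show ?case
      proof
        assume "u > 0"
        then have "(\<lambda>r. t r * (q (u / real (n r)) / A (real (n r)))) \<longlonglongrightarrow> t' * levy_inverse \<alpha> M \<theta> u"
          using elim by (intro tendsto_mult t quantile_tendsto[OF n pos \<open>\<theta> > 0\<close>]) auto
        moreover have "\<forall>\<^sub>F r in sequentially. t r * (q (u / real (n r)) / A (real (n r))) = ?f r u"
          using large[OF \<open>u > 0\<close>] by eventually_elim (use inS q_ext_eq in simp)
        ultimately show "(\<lambda>r. ?f r u) \<longlonglongrightarrow> t' * ?R u"
          using \<open>u > 0\<close> by (simp add: Lim_transform_eventually)
      qed
    qed
    show "\<bar>?f r u\<bar> \<le> T * K * u powr (- p)" if "u \<in> {0<..<real (n r) / 2}" "1 \<le> u" for r u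
    proof -
      have "\<bar>t r\<bar> * \<bar>q (u / real (n r)) / A (real (n r))\<bar> \<le> T * (K * u powr (- p))"
        using T[of r] K(2)[of "n r" u] that inS[OF that(1)] \<open>T \<ge> 0\<close> by (intro mult_mono) auto
      then show ?thesis using q_ext_eq inS[OF that(1)] by (simp add: abs_mult mult.assoc)
    qed
  qed (use p in auto)
  moreover have "(LINT u:{0<..<real (n r) / 2}|lborel. compensated_exp (?f r u) (1 \<le> u)) = half_exponent (n r) (t r)" for r
    unfolding half_exponent_def
    by (rule set_lebesgue_integral_cong) (use inS q_ext_eq in auto)
  ultimately show ?thesis
    by (simp add: levy_exponent_alt)
qed

text \<open>The centering of one half, divided by \<open>n\<close>, is \<open>O (n powr - p)\<close> for every \<open>p < min 1 (1 / \<alpha>)\<close>.  As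
  \<open>p\<close> may exceed \<open>1/2\<close>, the square of the drift per summand is \<open>o (1 / n)\<close>.\<close>

lemma half_centering_bound:
  assumes p: "0 < p" "p < 1 / \<alpha>" "p < 1"
  obtains K where "\<And>n. 1 \<le> n \<Longrightarrow> \<bar>LINT s:{1 / real n..1/2}|lborel. q s\<bar> / A (real n) \<le> K * real n powr (- p)"
    "\<And>n. 1 \<le> n \<Longrightarrow> set_integrable lborel {1 / real n..1/2} q"
proof -
  obtain K where K: "K > 0"
    "\<And>n u. 1 \<le> n \<Longrightarrow> 1 \<le> u \<Longrightarrow> u \<le> real n / 2 \<Longrightarrow> \<bar>q (u / real n) / A (real n)\<bar> \<le> K * u powr (- p)"
    using quantile_bound[OF p(1,2)] by blast
  let ?I = "LINT s:{0<..1}|lborel. s powr (- p)"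
  have powr: "set_integrable lborel {0<..1} (\<lambda>s::real. s powr (- p))"
    using p by (intro set_integrable_powr_from_0) auto
  have pointwise: "\<bar>indicator {1 / real n..1/2} s *\<^sub>R q s\<bar> \<le> A (real n) * K * real n powr (- p) * (indicator {0<..1} s *\<^sub>R s powr (- p))"
    if n: "1 \<le> n" for n s
  proof (cases "s \<in> {1 / real n..1/2}")
    case True
    have An: "A (real n) > 0" using n by (intro A_pos) simp
    have "0 < 1 / real n" using n by simp
    moreover have "1 / real n \<le> s" using True by simp
    ultimately have "0 < s" by (rule less_le_trans)
    have "\<bar>q (s * real n / real n) / A (real n)\<bar> \<le> K * (s * real n) powr (- p)"
      using True n by (intro K(2)) (auto simp: field_simps)
    then have "\<bar>q s\<bar> \<le> A (real n) * (K * (s * real n) powr (- p))"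
      using An n by (simp add: field_simps)
    also have "(s * real n) powr (- p) = s powr (- p) * real n powr (- p)"
      by (rule powr_mult)
    finally show ?thesis using True \<open>0 < s\<close> by (simp add: mult_ac)
  next
    case False
    have "0 \<le> A (real n)" using A_pos[of "real n"] n by simp
    moreover have "0 \<le> (indicator {0<..1} s *\<^sub>R s powr (- p) :: real)" by simp
    ultimately have "0 \<le> A (real n) * K * real n powr (- p) * (indicator {0<..1} s *\<^sub>R s powr (- p))"
      using K by (intro mult_nonneg_nonneg) auto
    then show ?thesis using False by simp
  qed
  have meas: "(\<lambda>s. indicator {1 / real n..1/2} s *\<^sub>R q s) \<in> borel_measurable lborel" if n: "1 \<le> n" for n :: nat
  proof -
    have "0 < 1 / real n" using n by simp
    then have "0 < s" "s < 1" if "s \<in> {1 / real n..1/2}" for s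
      using that less_le_trans[of 0 "1 / real n" s] by auto
    then have "(\<lambda>s. indicator {1 / real n..1/2} s *\<^sub>R q s) = (\<lambda>s. indicator {1 / real n..1/2} s *\<^sub>R q_ext s)"
      by (intro ext) (simp add: indicator_def q_ext_eq del: atLeastAtMost_iff)
    then show ?thesis by simp
  qed
  have maj: "integrable lborel (\<lambda>s. A (real n) * K * real n powr (- p) * (indicator {0<..1} s *\<^sub>R s powr (- p)))" for n
    using powr unfolding set_integrable_def by (rule integrable_mult_right)
  have int: "integrable lborel (\<lambda>s. indicator {1 / real n..1/2} s *\<^sub>R q s)" if n: "1 \<le> n" for n :: nat
    by (rule Bochner_Integration.integrable_bound[OF maj meas[OF n]])
       (use pointwise[OF n] order_trans[OF _ abs_ge_self] in \<open>auto intro!: AE_I2\<close>)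
  show thesis
  proof (rule that[of "K * ?I"])
    fix n :: nat assume n: "1 \<le> n"
    have An: "A (real n) > 0" using n by (intro A_pos) simp
    have "\<bar>LINT s:{1 / real n..1/2}|lborel. q s\<bar> \<le> (LINT s|lborel. A (real n) * K * real n powr (- p) * (indicator {0<..1} s *\<^sub>R s powr (- p)))"
      unfolding set_lebesgue_integral_def by (rule integral_abs_bound_integral[OF int[OF n] maj pointwise[OF n]])
    also have "\<dots> = A (real n) * (K * ?I * real n powr (- p))"
      by (simp add: set_lebesgue_integral_def)
    finally show "\<bar>LINT s:{1 / real n..1/2}|lborel. q s\<bar> / A (real n) \<le> K * ?I * real n powr (- p)"
      using An by (simp add: field_simps)
    show "set_integrable lborel {1 / real n..1/2} q"
      using int[OF n] unfolding set_integrable_def .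
  qed
qed

end

section \<open>The semistable limit theorem for characteristic functions\<close>

context cdf_distribution
begin

lemma quantile_eq: "quantile M s = I s"
  by (simp add: quantile_def)

lemma quantile_le_iff: "0 < s \<Longrightarrow> s < 1 \<Longrightarrow> quantile M s \<le> x \<longleftrightarrow> s \<le> cdf M x"
  using pseudoinverse[of s x] by (simp add: quantile_eq)

lemma quantile_mono: "0 < s \<Longrightarrow> s \<le> s' \<Longrightarrow> s' < 1 \<Longrightarrow> quantile M s \<le> quantile M s'"
  using quantile_le_iff[of s "quantile M s'"] quantile_le_iff[of s' "quantile M s'"] by simp

lemma char_eq_quantile_integral: "char M t = (LINT s:{0<..<1}|lborel. iexp (t * quantile M s))"
proof -
  have meas: "quantile M \<in> borel_measurable (restrict_space lborel {0<..<1})"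
    using measurable_CI by (simp add: quantile_eq[abs_def] measurable_cong_sets[OF sets_restrict_space_cong[OF sets_lborel] refl])
  have "char M t = char (distr (restrict_space lborel {0<..<1}) borel (quantile M)) t"
    using distr_I_eq_M by (simp add: quantile_eq[abs_def])
  also have "\<dots> = (LINT s|restrict_space lborel {0<..<1}. iexp (t * quantile M s))"
    unfolding char_def using meas by (subst integral_distr) auto
  also have "\<dots> = (LINT s:{0<..<1}|lborel. iexp (t * quantile M s))"
    unfolding set_lebesgue_integral_def by (subst integral_restrict_space) auto
  finally show ?thesis .
qed

end

lemma set_integral_reflect:
  fixes f :: "real \<Rightarrow> 'a::{banach, second_countable_topology}"
  shows "(LINT s:{s. P (1 - s)}|lborel. f (1 - s)) = (LINT s:{s. P s}|lborel. f s)"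
  unfolding set_lebesgue_integral_def
  by (subst (2) lborel_integral_real_affine[where c = "-1" and t = 1]) (simp_all add: indicator_def)

locale semistable_domain = bounded_norming +
  fixes \<mu> :: "real measure" and M\<^sub>R M\<^sub>L h\<^sub>R h\<^sub>L :: "real \<Rightarrow> real"
  assumes \<alpha>_less_2: "\<alpha> < 2"
    and \<mu>: "real_distribution \<mu>"
    and profile_R: "tail_profile \<alpha> c M\<^sub>R" and profile_L: "tail_profile \<alpha> c M\<^sub>L"
    and h_R: "\<And>x. x > 0 \<Longrightarrow> isCont M\<^sub>R x \<Longrightarrow> (\<lambda>n. h\<^sub>R (A (real (k n)) * x)) \<longlonglongrightarrow> 0"
    and h_L: "\<And>x. x > 0 \<Longrightarrow> isCont M\<^sub>L x \<Longrightarrow> (\<lambda>n. h\<^sub>L (A (real (k n)) * x)) \<longlonglongrightarrow> 0"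
    and tail_R: "\<forall>\<^sub>F x in at_top. measure \<mu> {x<..} = tail_slow \<alpha> l\<^sub>1 x / x powr \<alpha> * (M\<^sub>R (relative_position k A x) + h\<^sub>R x)"
    and tail_L: "\<forall>\<^sub>F x in at_top. measure \<mu> {..<- x} = tail_slow \<alpha> l\<^sub>1 x / x powr \<alpha> * (M\<^sub>L (relative_position k A x) + h\<^sub>L x)"
begin

interpretation cdf_distribution \<mu>
  using \<mu> by (simp add: cdf_distribution_def)

lemma upper_tail: "measure \<mu> {x<..} = 1 - cdf \<mu> x"
  using prob_compl[of "{..x}"] by (simp add: cdf_def Compl_eq_Diff_UNIV[symmetric])

sublocale right: one_sided_tail \<alpha> l\<^sub>1 c k M\<^sub>R "\<lambda>x. measure \<mu> {x<..}" "\<lambda>s. quantile \<mu> (1 - s)"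
proof
  show "tail_profile \<alpha> c M\<^sub>R" by (rule profile_R)
  show "(\<lambda>m. real (k m) * measure \<mu> {A (real (k m)) * y<..}) \<longlonglongrightarrow> levy_tail \<alpha> M\<^sub>R 1 y"
    if "y \<in> good_points M\<^sub>R" for y
    by (rule tail_convergence[OF profile_R h_R tail_R that])
  show "antimono (\<lambda>x. measure \<mu> {x<..})"
    by (intro antimonoI finite_measure_mono) auto
  show "x \<le> quantile \<mu> (1 - s)" if "0 < s" "s < 1" "s < measure \<mu> {x<..}" for s x
    using quantile_le_iff[of "1 - s" x] that by (auto simp: upper_tail)
  show "quantile \<mu> (1 - s) \<le> x" if "0 < s" "s < 1" "measure \<mu> {x<..} < s" for s x
    using quantile_le_iff[of "1 - s" x] that by (auto simp: upper_tail)
  show "quantile \<mu> (1 - s') \<le> quantile \<mu> (1 - s)" if "0 < s" "s \<le> s'" "s' < 1" for s s'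
    using that by (intro quantile_mono) auto
qed simp

sublocale left: one_sided_tail \<alpha> l\<^sub>1 c k M\<^sub>L "\<lambda>x. measure \<mu> {..<- x}" "\<lambda>s. - quantile \<mu> s"
proof
  show "tail_profile \<alpha> c M\<^sub>L" by (rule profile_L)
  show "(\<lambda>m. real (k m) * measure \<mu> {..<- (A (real (k m)) * y)}) \<longlonglongrightarrow> levy_tail \<alpha> M\<^sub>L 1 y"
    if "y \<in> good_points M\<^sub>L" for y
    by (rule tail_convergence[OF profile_L h_L tail_L that])
  show "antimono (\<lambda>x. measure \<mu> {..<- x})"
    by (intro antimonoI finite_measure_mono) auto
  show "x \<le> - quantile \<mu> s" if s: "0 < s" "s < 1" "s < measure \<mu> {..<- x}" for s x
  proof -
    have "measure \<mu> {..<- x} \<le> cdf \<mu> (- x)"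
      unfolding cdf_def by (intro finite_measure_mono) auto
    then have "quantile \<mu> s \<le> - x" using quantile_le_iff[OF s(1,2), of "- x"] s(3) by simp
    then show ?thesis by simp
  qed
  show "- quantile \<mu> s \<le> x" if s: "0 < s" "s < 1" "measure \<mu> {..<- x} < s" for s x
  proof -
    have "- x \<le> quantile \<mu> s"
    proof (rule dense_le)
      fix z assume "z < - x"
      then have "cdf \<mu> z \<le> measure \<mu> {..<- x}"
        unfolding cdf_def by (intro finite_measure_mono) auto
      then show "z \<le> quantile \<mu> s" using quantile_le_iff[OF s(1,2), of z] s(3) by simp
    qed
    then show ?thesis by simp
  qed
  show "- quantile \<mu> s' \<le> - quantile \<mu> s" if "0 < s" "s \<le> s'" "s' < 1" for s s'
    using that by (simp add: quantile_mono)
qed simp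

text \<open>The drift of a single summand in the scale \<open>A n\<close>.\<close>

definition center :: "nat \<Rightarrow> real" where
  "center n = (LINT s:{1 / real n..1 - 1 / real n}|lborel. quantile \<mu> s) / A (real n)"

lemma center_eq: "1 \<le> n \<Longrightarrow> centering \<mu> n / A (real n) = real n * center n"
  by (simp add: center_def centering_def)

lemma AE_ne_half: "AE s in lborel. (s::real) \<noteq> 1/2"
  by (rule AE_lborel_singleton)

lemma right_half_reflect:
  "(LINT s:{1/2..1 - 1 / real n}|lborel. f s) = (LINT s:{1 / real n..1/2}|lborel. f (1 - s))" for f :: "real \<Rightarrow> real"
proof -
  have "{1/2..1 - 1 / real n} = {s. 1/2 \<le> s \<and> s \<le> 1 - 1 / real n}" "{1 / real n..1/2} = {s. 1/2 \<le> 1 - s \<and> 1 - s \<le> 1 - 1 / real n}"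
    by auto
  then show ?thesis
    using set_integral_reflect[of "\<lambda>s. 1/2 \<le> s \<and> s \<le> 1 - 1 / real n" f] by simp
qed

lemma right_half_integrable:
  assumes n: "1 \<le> n"
  shows "set_integrable lborel {1/2..1 - 1 / real n} (quantile \<mu>)"
proof -
  have p: "0 < min 1 (1 / \<alpha>) / 2" "min 1 (1 / \<alpha>) / 2 < 1 / \<alpha>" "min 1 (1 / \<alpha>) / 2 < 1"
    using \<alpha>_pos by (auto simp: min_def field_simps)
  have "set_integrable lborel {1 / real n..1/2} (\<lambda>s. quantile \<mu> (1 - s))"
    using right.half_centering_bound[OF p] n by metis
  then have "integrable lborel (\<lambda>s. indicator {1/2..1 - 1 / real n} (1 + (-1) * s) *\<^sub>R quantile \<mu> (1 + (-1) * s))"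
    unfolding set_integrable_def by (rule back_subst[of "integrable lborel"]) (auto simp: indicator_def fun_eq_iff)
  then show ?thesis
    unfolding set_integrable_def by (subst (asm) lborel_integrable_real_affine_iff) auto
qed

lemma left_half_integrable:
  assumes n: "1 \<le> n"
  shows "set_integrable lborel {1 / real n..1/2} (quantile \<mu>)"
proof -
  have p: "0 < min 1 (1 / \<alpha>) / 2" "min 1 (1 / \<alpha>) / 2 < 1 / \<alpha>" "min 1 (1 / \<alpha>) / 2 < 1"
    using \<alpha>_pos by (auto simp: min_def field_simps)
  have "set_integrable lborel {1 / real n..1/2} (\<lambda>s. - quantile \<mu> s)"
    using left.half_centering_bound[OF p] n by metis
  then show ?thesis by (simp add: set_integrable_def)
qed

lemma middle_split:
  assumes n: "2 \<le> n"
  shows "(LINT s:{1 / real n..1 - 1 / real n}|lborel. quantile \<mu> s) =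
      (LINT s:{1 / real n..1/2}|lborel. quantile \<mu> s) + (LINT s:{1/2..1 - 1 / real n}|lborel. quantile \<mu> s)"
    and "set_integrable lborel {1 / real n..1 - 1 / real n} (quantile \<mu>)"
proof -
  have n2: "1 / real n \<le> 1/2" using n by (simp add: field_simps)
  have un: "{1 / real n..1 - 1 / real n} = {1 / real n..1/2} \<union> {1/2..1 - 1 / real n}"
    using n2 by auto
  have int: "set_integrable lborel {1 / real n..1/2} (quantile \<mu>)" "set_integrable lborel {1/2..1 - 1 / real n} (quantile \<mu>)"
    using n by (auto intro: left_half_integrable right_half_integrable)
  show "(LINT s:{1 / real n..1 - 1 / real n}|lborel. quantile \<mu> s) =
      (LINT s:{1 / real n..1/2}|lborel. quantile \<mu> s) + (LINT s:{1/2..1 - 1 / real n}|lborel. quantile \<mu> s)"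
    unfolding un
  proof (rule set_integral_Un_AE)
    show "AE x in lborel. \<not> (x \<in> {1 / real n..1/2} \<and> x \<in> {1/2..1 - 1 / real n})"
      using AE_ne_half by eventually_elim auto
  qed (use int in auto)
  show "set_integrable lborel {1 / real n..1 - 1 / real n} (quantile \<mu>)"
    unfolding un using int by (intro set_integrable_Un) auto
qed

lemma center_bound:
  assumes p: "0 < p" "p < 1 / \<alpha>" "p < 1"
  obtains K where "\<And>n. 2 \<le> n \<Longrightarrow> \<bar>center n\<bar> \<le> K * real n powr (- p)"
proof -
  obtain K\<^sub>1 where K1: "\<And>n. 1 \<le> n \<Longrightarrow> \<bar>LINT s:{1 / real n..1/2}|lborel. quantile \<mu> (1 - s)\<bar> / A (real n) \<le> K\<^sub>1 * real n powr (- p)"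
    using right.half_centering_bound[OF p] by metis
  obtain K\<^sub>2 where K2: "\<And>n. 1 \<le> n \<Longrightarrow> \<bar>LINT s:{1 / real n..1/2}|lborel. - quantile \<mu> s\<bar> / A (real n) \<le> K\<^sub>2 * real n powr (- p)"
    using left.half_centering_bound[OF p] by metis
  show thesis
  proof (rule that[of "K\<^sub>1 + K\<^sub>2"])
    fix n :: nat assume n: "2 \<le> n"
    have "A (real n) > 0" using n by (intro A_pos) simp
    moreover have "(LINT s:{1 / real n..1/2}|lborel. - quantile \<mu> s) = - (LINT s:{1 / real n..1/2}|lborel. quantile \<mu> s)"
      by (simp add: set_lebesgue_integral_def)
    ultimately have "\<bar>center n\<bar> \<le> \<bar>LINT s:{1 / real n..1/2}|lborel. - quantile \<mu> s\<bar> / A (real n) + \<bar>LINT s:{1 / real n..1/2}|lborel. quantile \<mu> (1 - s)\<bar> / A (real n)"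
      unfolding center_def middle_split(1)[OF n] right_half_reflect
      by (simp add: abs_divide add_divide_distrib[symmetric] divide_right_mono)
    then show "\<bar>center n\<bar> \<le> (K\<^sub>1 + K\<^sub>2) * real n powr (- p)"
      using K1[of n] K2[of n] n by (simp add: distrib_right)
  qed
qed

lemma scale_half:
  fixes f :: "real \<Rightarrow> complex"
  assumes "n > 0"
  shows "(LINT u:{0<..<real n / 2}|lborel. f (u / real n)) = of_nat n * (LINT s:{0<..<1/2}|lborel. f s)"
proof -
  have "(LINT u:{0<..<real n / 2}|lborel. f (u / real n)) =
      \<bar>real n\<bar> *\<^sub>R (LINT s|lborel. indicator {0<..<real n / 2} (0 + real n * s) *\<^sub>R f ((0 + real n * s) / real n))"
    unfolding set_lebesgue_integral_def using assms by (intro lborel_integral_real_affine) simp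
  also have "(\<lambda>s. indicator {0<..<real n / 2} (0 + real n * s) *\<^sub>R f ((0 + real n * s) / real n)) = (\<lambda>s. indicator {0<..<1/2} s *\<^sub>R f s)"
    using assms by (auto simp: indicator_def fun_eq_iff field_simps zero_less_mult_iff)
  finally show ?thesis by (simp add: set_lebesgue_integral_def scaleR_conv_of_real)
qed

text \<open>Splitting the quantile representation of the characteristic function at \<open>1/2\<close> and
  reflecting the upper half separates the two tails; in the variable \<open>u = n s\<close> the truncation
  \<open>1 / n \<le> s\<close> of the centering is the compensator's \<open>1 \<le> u\<close>.\<close>

lemma char_half_exponents:
  assumes n: "2 \<le> n"
  shows "of_nat n * (char \<mu> (t / A (real n)) - 1 - \<i> * of_real (t * center n)) = right.half_exponent n t + left.half_exponent n (- t)"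
proof -
  define a where "a = A (real n)"
  define J where "J = {1 / real n..1 - 1 / real n}"
  define F where "F s = compensated_exp (t * (quantile \<mu> s / a)) (s \<in> J)" for s
  have n2: "1 / real n \<le> 1/2" "0 < 1 / real n" using n by (auto simp: field_simps)
  have J01: "J \<subseteq> {0<..<1}"
  proof
    fix s assume "s \<in> J"
    then have "1 / real n \<le> s" "s \<le> 1 - 1 / real n" by (auto simp: J_def)
    then have "0 < s" "s < 1" using n2(2) by linarith+
    then show "s \<in> {0<..<1}" by simp
  qed
  have Qmeas: "(\<lambda>s. indicator {0<..<1} s *\<^sub>R quantile \<mu> s) \<in> borel_measurable lborel"
    using measurable_CI by (subst (asm) borel_measurable_restrict_space_iff) (auto simp: quantile_eq[abs_def])
  have e_meas: "(\<lambda>s. indicator {0<..<1} s *\<^sub>R (iexp (t * (quantile \<mu> s / a)) - 1)) \<in> borel_measurable lborel"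
  proof -
    define Q where "Q s = indicator {0<..<1} s *\<^sub>R quantile \<mu> s" for s
    have [measurable]: "Q \<in> borel_measurable borel"
      using Qmeas by (simp add: Q_def[abs_def])
    have "(\<lambda>s. indicator {0<..<1} s *\<^sub>R (iexp (t * (quantile \<mu> s / a)) - 1)) =
        (\<lambda>s. indicator {0<..<1} s *\<^sub>R (iexp (t * (Q s / a)) - 1))"
      by (auto simp: indicator_def fun_eq_iff Q_def)
    then show ?thesis by simp
  qed
  have one_int: "set_integrable lborel {0<..<1::real} (\<lambda>_. 1::complex)"
    unfolding set_integrable_def by (intro integrable_scaleR_left) (simp add: integrable_indicator_iff)
  have e_int: "set_integrable lborel {0<..<1} (\<lambda>s. iexp (t * (quantile \<mu> s / a)) - 1)"
    unfolding set_integrable_def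
  proof (rule Bochner_Integration.integrable_bound[OF _ e_meas])
    show "integrable lborel (\<lambda>s. indicator {0<..<1::real} s *\<^sub>R (2::real))"
      by (intro integrable_scaleR_left) (simp add: integrable_indicator_iff)
    show "AE s in lborel. norm (indicator {0<..<1} s *\<^sub>R (iexp (t * (quantile \<mu> s / a)) - 1)) \<le> norm (indicator {0<..<1} s *\<^sub>R (2::real))"
    proof (rule AE_I2)
      fix s :: real
      have "norm (iexp (t * (quantile \<mu> s / a)) - 1) \<le> 2"
        using norm_compensated_exp_False[of "t * (quantile \<mu> s / a)"] by (simp add: compensated_exp_def)
      then show "norm (indicator {0<..<1} s *\<^sub>R (iexp (t * (quantile \<mu> s / a)) - 1)) \<le> norm (indicator {0<..<1} s *\<^sub>R (2::real))"
        by (cases "s \<in> {0<..<1}") simp_all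
    qed
  qed
  have c_int: "set_integrable lborel {0<..<1} (\<lambda>s. \<i> * of_real (t * (quantile \<mu> s / a)) * of_bool (s \<in> J))"
  proof -
    have "integrable lborel (\<lambda>s. (\<i> * of_real (t / a)) * of_real (indicator J s *\<^sub>R quantile \<mu> s))"
      using middle_split(2)[OF n] unfolding J_def[symmetric] set_integrable_def
      by (intro integrable_mult_right integrable_of_real)
    then show ?thesis
      unfolding set_integrable_def
      by (rule back_subst[of "integrable lborel"]) (use J01 in \<open>auto simp: indicator_def fun_eq_iff\<close>)
  qed
  have F_int: "set_integrable lborel {0<..<1} F"
    unfolding F_def[abs_def] compensated_exp_def using set_integral_diff(1)[OF e_int c_int] .
  have "(LINT s:{0<..<1}|lborel. F s) = (LINT s:{0<..<1}|lborel. iexp (t * (quantile \<mu> s / a)) - 1)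
      - (LINT s:{0<..<1}|lborel. \<i> * of_real (t * (quantile \<mu> s / a)) * of_bool (s \<in> J))"
    unfolding F_def compensated_exp_def by (rule set_integral_diff(2)[OF e_int c_int])
  also have "(LINT s:{0<..<1}|lborel. \<i> * of_real (t * (quantile \<mu> s / a)) * of_bool (s \<in> J)) =
      (LINT s|lborel. (\<i> * of_real (t / a)) * of_real (indicator J s *\<^sub>R quantile \<mu> s))"
    unfolding set_lebesgue_integral_def
    by (intro Bochner_Integration.integral_cong) (use J01 in \<open>auto simp: indicator_def fun_eq_iff\<close>)
  also have "\<dots> = \<i> * of_real (t * center n)"
    by (simp add: center_def J_def a_def set_lebesgue_integral_def del: of_real_mult)
       (simp add: mult.assoc)
  also have "(LINT s:{0<..<1}|lborel. iexp (t * (quantile \<mu> s / a)) - 1) = char \<mu> (t / a) - 1"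
  proof -
    have iexp_int: "set_integrable lborel {0<..<1} (\<lambda>s. iexp (t * (quantile \<mu> s / a)))"
      using set_integral_add(1)[OF e_int one_int] by simp
    have "(LINT s:{0<..<1}|lborel. iexp (t * (quantile \<mu> s / a)) - 1) = (LINT s:{0<..<1}|lborel. iexp (t * (quantile \<mu> s / a))) - (LINT s:{0<..<1::real}|lborel. 1)"
      by (rule set_integral_diff(2)[OF iexp_int one_int])
    then show ?thesis
      by (simp add: char_eq_quantile_integral set_lebesgue_integral_def)
  qed
  finally have whole: "(LINT s:{0<..<1}|lborel. F s) = char \<mu> (t / a) - 1 - \<i> * of_real (t * center n)" .
  have "(LINT s:{0<..<1}|lborel. F s) = (LINT s:{0<..<1/2} \<union> {1/2<..<1}|lborel. F s)"
    unfolding set_lebesgue_integral_def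
  proof (rule integral_cong_AE)
    show "(\<lambda>s. indicator {0<..<1} s *\<^sub>R F s) \<in> borel_measurable lborel"
      using F_int unfolding set_integrable_def by (rule borel_measurable_integrable)
    have "(\<lambda>s. indicator ({0<..<1/2} \<union> {1/2<..<1}) s *\<^sub>R (indicator {0<..<1} s *\<^sub>R F s)) \<in> borel_measurable lborel"
      using borel_measurable_integrable[OF F_int[unfolded set_integrable_def]] by measurable
    then show "(\<lambda>s. indicator ({0<..<1/2} \<union> {1/2<..<1}) s *\<^sub>R F s) \<in> borel_measurable lborel"
      by (rule back_subst[of "\<lambda>f. f \<in> borel_measurable lborel"]) (auto simp: indicator_def fun_eq_iff)
    show "AE s in lborel. indicator {0<..<1} s *\<^sub>R F s = indicator ({0<..<1/2} \<union> {1/2<..<1}) s *\<^sub>R F s"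
      using AE_ne_half by eventually_elim (auto simp: indicator_def)
  qed
  also have "\<dots> = (LINT s:{0<..<1/2}|lborel. F s) + (LINT s:{1/2<..<1}|lborel. F s)"
    by (rule set_integral_Un) (auto intro: set_integrable_subset[OF F_int])
  also have "(LINT s:{1/2<..<1}|lborel. F s) = (LINT s:{0<..<1/2}|lborel. F (1 - s))"
  proof -
    have "{1/2<..<1::real} = {s. 1/2 < s \<and> s < 1}" "{0<..<1/2::real} = {s. 1/2 < 1 - s \<and> 1 - s < 1}" by auto
    then show ?thesis using set_integral_reflect[of "\<lambda>s. 1/2 < s \<and> s < 1" F] by simp
  qed
  finally have "of_nat n * (char \<mu> (t / a) - 1 - \<i> * of_real (t * center n)) =
      of_nat n * (LINT s:{0<..<1/2}|lborel. F s) + of_nat n * (LINT s:{0<..<1/2}|lborel. F (1 - s))"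
    unfolding whole by (simp add: distrib_left)
  also have "\<dots> = (LINT u:{0<..<real n / 2}|lborel. F (u / real n)) + (LINT u:{0<..<real n / 2}|lborel. F (1 - u / real n))"
    using n scale_half[of n F] scale_half[of n "\<lambda>s. F (1 - s)"] by simp
  also have "(LINT u:{0<..<real n / 2}|lborel. F (u / real n)) = left.half_exponent n (- t)"
    unfolding left.half_exponent_def
  proof (rule set_lebesgue_integral_cong)
    show "\<forall>u. u \<in> {0<..<real n / 2} \<longrightarrow> F (u / real n) = compensated_exp (- t * (- quantile \<mu> (u / real n) / A (real n))) (1 \<le> u)"
    proof (intro allI impI)
      fix u assume "u \<in> {0<..<real n / 2}"
      then have "(u / real n \<in> J) = (1 \<le> u)" using n by (auto simp: J_def field_simps)
      then show "F (u / real n) = compensated_exp (- t * (- quantile \<mu> (u / real n) / A (real n))) (1 \<le> u)"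
        by (simp add: F_def a_def)
    qed
  qed simp
  also have "(LINT u:{0<..<real n / 2}|lborel. F (1 - u / real n)) = right.half_exponent n t"
    unfolding right.half_exponent_def
  proof (rule set_lebesgue_integral_cong)
    show "\<forall>u. u \<in> {0<..<real n / 2} \<longrightarrow> F (1 - u / real n) = compensated_exp (t * (quantile \<mu> (1 - u / real n) / A (real n))) (1 \<le> u)"
    proof (intro allI impI)
      fix u assume "u \<in> {0<..<real n / 2}"
      then have "(1 - u / real n \<in> J) = (1 \<le> u)" using n by (auto simp: J_def field_simps)
      then show "F (1 - u / real n) = compensated_exp (t * (quantile \<mu> (1 - u / real n) / A (real n))) (1 \<le> u)"
        by (simp add: F_def a_def)
    qed
  qed simp
  finally show ?thesis by (simp add: a_def add.commute)
qed

definition limit_exponent :: "real \<Rightarrow> real \<Rightarrow> complex" where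
  "limit_exponent \<theta> t = right.levy_exponent \<theta> t + left.levy_exponent \<theta> (- t)"

lemma Re_limit_exponent_nonpos: "\<theta> > 0 \<Longrightarrow> Re (limit_exponent \<theta> t) \<le> 0"
  using right.Re_levy_exponent_nonpos[OF \<alpha>_less_2, of \<theta> t] left.Re_levy_exponent_nonpos[OF \<alpha>_less_2, of \<theta> "- t"]
  by (simp add: limit_exponent_def)

lemma semistable_exponent_eq: "semistable_exponent \<alpha> M\<^sub>R M\<^sub>L \<theta> t = limit_exponent \<theta> t"
  by (simp add: semistable_exponent_def limit_exponent_def right.levy_exponent_def left.levy_exponent_def
      compensated_exp_def Let_def)

end

text \<open>Removing the drift \<open>d\<close> by rotation instead of subtraction costs only terms of second order.\<close>

lemma rotate_away_drift:
  fixes w :: complex and d :: real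
  shows "norm ((1 + w + \<i> * d) * iexp (- d) - 1 - w) \<le> d\<^sup>2 / 2 + norm w * \<bar>d\<bar>"
proof -
  have "(1 + w + \<i> * d) * iexp (- d) - 1 - w = - (iexp d - 1 - \<i> * d) * iexp (- d) + w * (iexp (- d) - 1)"
    by (simp add: algebra_simps exp_minus)
  also have "norm \<dots> \<le> norm (- (iexp d - 1 - \<i> * d) * iexp (- d)) + norm (w * (iexp (- d) - 1))"
    by (rule norm_triangle_ineq)
  also have "norm (- (iexp d - 1 - \<i> * d) * iexp (- d)) = norm (compensated_exp d True)"
  proof -
    have "compensated_exp d True = iexp d - 1 - \<i> * d" "norm (iexp (- d)) = 1"
      by (simp_all add: compensated_exp_def)
    then show ?thesis by (simp only: norm_mult norm_minus_cancel mult_1_right)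
  qed
  also have "\<dots> \<le> d\<^sup>2 / 2" by (rule norm_compensated_exp_True)
  also have "norm (w * (iexp (- d) - 1)) \<le> norm w * \<bar>d\<bar>"
    using iexp_approx1[of "- d" 0] by (simp add: norm_mult mult_left_mono)
  finally show ?thesis by simp
qed

text \<open>Compound interest for complex numbers: the power is compared with that of \<open>exp (z / n)\<close>, both
  bases having modulus at most one.\<close>

lemma power_tendsto_exp:
  fixes a :: "nat \<Rightarrow> complex"
  assumes n: "filterlim n sequentially sequentially"
    and a: "\<And>r. norm (a r) \<le> 1" and lim: "(\<lambda>r. of_nat (n r) * (a r - 1)) \<longlonglongrightarrow> z" and z: "Re z \<le> 0"
  shows "(\<lambda>r. a r ^ n r) \<longlonglongrightarrow> exp z"
proof -
  define b where "b r = exp (z / of_nat (n r))" for r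
  have n_pos: "\<forall>\<^sub>F r in sequentially. n r > 0"
    using filterlim_at_top[THEN iffD1, OF n, rule_format, of 1] by eventually_elim simp
  have h: "filterlim (\<lambda>r. 1 / of_nat (n r) :: complex) (at 0) sequentially"
  proof (rule filterlim_atI)
    have "(\<lambda>n. 1 / of_nat n :: complex) \<longlonglongrightarrow> 0"
      using lim_1_over_n .
    then show "(\<lambda>r. 1 / of_nat (n r) :: complex) \<longlonglongrightarrow> 0"
      by (rule filterlim_compose[OF _ n])
    show "\<forall>\<^sub>F r in sequentially. 1 / of_nat (n r) \<noteq> (0 :: complex)"
      using n_pos by eventually_elim simp
  qed
  have "((\<lambda>y. exp (z * y)) has_field_derivative z) (at 0)"
    by (auto intro!: derivative_eq_intros)
  then have "((\<lambda>y. (exp (z * y) - 1) / y) \<longlongrightarrow> z) (at 0)"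
    by (simp add: has_field_derivative_iff)
  then have "(\<lambda>r. (exp (z * (1 / of_nat (n r))) - 1) / (1 / of_nat (n r))) \<longlonglongrightarrow> z"
    by (rule filterlim_compose[OF _ h])
  then have b_lim: "(\<lambda>r. of_nat (n r) * (b r - 1)) \<longlonglongrightarrow> z"
    by (simp add: b_def mult.commute)
  have "(\<lambda>r. norm (of_nat (n r) * (a r - 1) - of_nat (n r) * (b r - 1))) \<longlonglongrightarrow> norm (z - z)"
    by (intro tendsto_norm tendsto_diff lim b_lim)
  then have diff: "(\<lambda>r. real (n r) * norm (a r - b r)) \<longlonglongrightarrow> 0"
    by (simp add: right_diff_distrib[symmetric] norm_mult)
  have "(\<lambda>r. a r ^ n r - b r ^ n r) \<longlonglongrightarrow> 0"
  proof (rule Lim_null_comparison[OF _ diff])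
    have "norm (b r) \<le> 1" for r
      using z by (simp add: b_def divide_nonpos_nonneg Re_divide_of_nat)
    then show "\<forall>\<^sub>F r in sequentially. norm (a r ^ n r - b r ^ n r) \<le> real (n r) * norm (a r - b r)"
      using a by (intro always_eventually allI norm_power_diff)
  qed
  moreover have "\<forall>\<^sub>F r in sequentially. b r ^ n r = exp z"
    using n_pos by eventually_elim (simp add: b_def exp_of_nat_mult[symmetric])
  ultimately have "(\<lambda>r. a r ^ n r - exp z) \<longlonglongrightarrow> 0"
    by (elim Lim_transform_eventually) (auto elim: eventually_mono)
  then show ?thesis by (simp add: LIM_zero_iff)
qed

context semistable_domain
begin

lemma norm_char_le_1: "norm (char \<mu> t) \<le> 1"
  using \<mu> by (rule real_distribution.cmod_char_le_1)

text \<open>The semistable limit theorem, in the form of convergence of characteristic functions.  The argument \<open>t\<close> may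
  vary, which yields uniformity on compact sets.\<close>

theorem char_tendsto:
  assumes n: "filterlim n sequentially sequentially"
    and pos: "(\<lambda>r. position_parameter k (n r)) \<longlonglongrightarrow> \<theta>" and "\<theta> > 0"
    and t: "t \<longlonglongrightarrow> t'"
  shows "(\<lambda>r. char \<mu> (t r / A (real (n r))) ^ n r * iexp (- (t r * (centering \<mu> (n r) / A (real (n r))))))
    \<longlonglongrightarrow> exp (limit_exponent \<theta> t')"
proof -
  (* Above 1/2 so that n times the squared drift vanishes in the limit. *)
  define p where "p = (1/2 + min 1 (1 / \<alpha>)) / 2"
  have p: "1/2 < p" "0 < p" "p < 1 / \<alpha>" "p < 1"
    using \<alpha>_pos \<alpha>_less_2 by (auto simp: p_def min_def field_simps)
  obtain K where K: "\<And>n. 2 \<le> n \<Longrightarrow> \<bar>center n\<bar> \<le> K * real n powr (- p)"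
    using center_bound[OF p(2-4)] by blast
  define d where "d r = t r * center (n r)" for r
  define w where "w r = char \<mu> (t r / A (real (n r))) - 1 - \<i> * of_real (d r)" for r
  define a where "a r = (1 + w r + \<i> * of_real (d r)) * iexp (- d r)" for r
  have n_real: "filterlim (\<lambda>r. real (n r)) at_top sequentially"
    using filterlim_compose[OF filterlim_real_sequentially n] .
  have n2: "\<forall>\<^sub>F r in sequentially. 2 \<le> n r"
    using n by (simp add: filterlim_at_top)
  have "(\<lambda>r. right.half_exponent (n r) (t r) + left.half_exponent (n r) (- t r)) \<longlonglongrightarrow> limit_exponent \<theta> t'"
    unfolding limit_exponent_def
    by (intro tendsto_add right.half_exponent_tendsto left.half_exponent_tendsto tendsto_minus n pos t \<open>\<theta> > 0\<close> \<alpha>_less_2)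
  moreover have "\<forall>\<^sub>F r in sequentially. right.half_exponent (n r) (t r) + left.half_exponent (n r) (- t r) = of_nat (n r) * w r"
    using n2 by eventually_elim (simp only: char_half_exponents w_def d_def)
  ultimately have w_lim: "(\<lambda>r. of_nat (n r) * w r) \<longlonglongrightarrow> limit_exponent \<theta> t'"
    by (rule Lim_transform_eventually)
  have powr_0: "(\<lambda>r. real (n r) powr s) \<longlonglongrightarrow> 0" if "s < 0" for s
    using that by (intro tendsto_neg_powr n_real) auto
  have bound_d: "\<forall>\<^sub>F r in sequentially. \<bar>d r\<bar> \<le> \<bar>t r\<bar> * (K * real (n r) powr (- p))"
    using n2 by eventually_elim (simp add: d_def abs_mult K mult_left_mono)
  have "(\<lambda>r. \<bar>t r\<bar> * (K * real (n r) powr (- p))) \<longlonglongrightarrow> \<bar>t'\<bar> * (K * 0)"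
    using p by (intro tendsto_intros t powr_0) auto
  then have d_lim: "d \<longlonglongrightarrow> 0"
    using bound_d by (intro Lim_null_comparison[of d]) auto
  have "(\<lambda>r. (\<bar>t r\<bar> * K)\<^sup>2 * real (n r) powr (1 - 2 * p)) \<longlonglongrightarrow> (\<bar>t'\<bar> * K)\<^sup>2 * 0"
    using p by (intro tendsto_intros t powr_0) auto
  moreover have "\<forall>\<^sub>F r in sequentially. norm (real (n r) * (d r)\<^sup>2) \<le> (\<bar>t r\<bar> * K)\<^sup>2 * real (n r) powr (1 - 2 * p)"
    using bound_d n2
  proof eventually_elim
    case (elim r)
    have "(d r)\<^sup>2 \<le> (\<bar>t r\<bar> * (K * real (n r) powr (- p)))\<^sup>2"
      using power_mono[OF elim(1), of 2] by simp
    also have "\<dots> = (\<bar>t r\<bar> * K)\<^sup>2 * real (n r) powr (- 2 * p)"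
      using elim by (simp add: power_mult_distrib powr_power)
    finally have "real (n r) * (d r)\<^sup>2 \<le> real (n r) * ((\<bar>t r\<bar> * K)\<^sup>2 * real (n r) powr (- 2 * p))"
      by (rule mult_left_mono) simp
    also have "\<dots> = (\<bar>t r\<bar> * K)\<^sup>2 * (real (n r) powr 1 * real (n r) powr (- 2 * p))"
      using elim by simp
    also have "real (n r) powr 1 * real (n r) powr (- 2 * p) = real (n r) powr (1 - 2 * p)"
      by (simp only: powr_add[symmetric]) simp
    finally show ?case by simp
  qed
  ultimately have nd_lim: "(\<lambda>r. real (n r) * (d r)\<^sup>2) \<longlonglongrightarrow> 0"
    by (intro Lim_null_comparison[of "\<lambda>r. real (n r) * (d r)\<^sup>2"]) auto
  have "(\<lambda>r. of_nat (n r) * (a r - 1) - of_nat (n r) * w r) \<longlonglongrightarrow> 0"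
  proof (rule Lim_null_comparison)
    have "(\<lambda>r. real (n r) * (d r)\<^sup>2 / 2 + norm (of_nat (n r) * w r) * \<bar>d r\<bar>) \<longlonglongrightarrow> 0 / 2 + norm (limit_exponent \<theta> t') * \<bar>0\<bar>"
      by (intro tendsto_intros nd_lim w_lim d_lim) auto
    then show "(\<lambda>r. real (n r) * (d r)\<^sup>2 / 2 + norm (of_nat (n r) * w r) * \<bar>d r\<bar>) \<longlonglongrightarrow> 0"
      by simp
    show "\<forall>\<^sub>F r in sequentially. norm (of_nat (n r) * (a r - 1) - of_nat (n r) * w r) \<le> real (n r) * (d r)\<^sup>2 / 2 + norm (of_nat (n r) * w r) * \<bar>d r\<bar>"
    proof (intro always_eventually allI)
      fix r
      have "norm (of_nat (n r) * (a r - 1) - of_nat (n r) * w r) = real (n r) * norm (a r - 1 - w r)"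
        by (simp add: right_diff_distrib[symmetric] norm_mult)
      also have "\<dots> \<le> real (n r) * ((d r)\<^sup>2 / 2 + norm (w r) * \<bar>d r\<bar>)"
        unfolding a_def by (intro mult_left_mono rotate_away_drift) simp
      also have "\<dots> = real (n r) * (d r)\<^sup>2 / 2 + norm (of_nat (n r) * w r) * \<bar>d r\<bar>"
        by (simp add: norm_mult algebra_simps)
      finally show "norm (of_nat (n r) * (a r - 1) - of_nat (n r) * w r) \<le> real (n r) * (d r)\<^sup>2 / 2 + norm (of_nat (n r) * w r) * \<bar>d r\<bar>" .
    qed
  qed
  from tendsto_add[OF this w_lim] have a_lim: "(\<lambda>r. of_nat (n r) * (a r - 1)) \<longlonglongrightarrow> limit_exponent \<theta> t'"
    by simp
  have a_eq: "a r = char \<mu> (t r / A (real (n r))) * iexp (- d r)" for r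
    by (simp add: a_def w_def)
  have "norm (a r) \<le> 1" for r
    unfolding a_eq using norm_char_le_1 by (simp add: norm_mult)
  then have "(\<lambda>r. a r ^ n r) \<longlonglongrightarrow> exp (limit_exponent \<theta> t')"
    using Re_limit_exponent_nonpos[OF \<open>\<theta> > 0\<close>] by (intro power_tendsto_exp n a_lim)
  moreover have "\<forall>\<^sub>F r in sequentially. a r ^ n r = char \<mu> (t r / A (real (n r))) ^ n r * iexp (- (t r * (centering \<mu> (n r) / A (real (n r)))))"
    using n2
  proof eventually_elim
    case (elim r)
    then have "t r * (centering \<mu> (n r) / A (real (n r))) = real (n r) * d r"
      by (simp add: center_eq d_def)
    then show ?case
      by (simp add: a_eq power_mult_distrib exp_of_nat_mult[symmetric] mult_ac)
  qed
  ultimately show ?thesis by (rule Lim_transform_eventually)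
qed

end

section \<open>Uniform decay of the characteristic functions\<close>

lemma powr_le_exp:
  fixes y :: real
  assumes "y > 0" "q > 0" "a > 0"
  shows "y powr q \<le> exp (- q - q * ln (a / q)) * exp (a * y)"
proof -
  have "ln (a / q * y) \<le> a / q * y - 1"
    using assms by (intro ln_le_minus_one) simp
  moreover have "ln (a / q * y) = ln (a / q) + ln y"
    by (subst ln_mult) (use assms in auto)
  ultimately have "q * (ln (a / q) + ln y) \<le> q * (a / q * y - 1)"
    using assms by (intro mult_left_mono) auto
  then have "q * ln y \<le> (- q - q * ln (a / q)) + a * y"
    using assms by (simp add: algebra_simps)
  then show ?thesis
    using assms by (simp add: powr_def exp_add[symmetric])
qed

text \<open>Exponential decay in \<open>y\<close> beats any polynomial relation between \<open>t\<close> and \<open>y\<close>; the target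
  is the integrable function \<open>1 / (1 + t\<^sup>2)\<close>.\<close>

lemma geometric_le_inverse_square:
  fixes \<rho> C q :: real
  assumes "0 < \<rho>" "\<rho> < 1" "C > 0" "q > 0"
  obtains D where "\<And>t y. 1 \<le> y \<Longrightarrow> \<bar>t\<bar> \<le> C * y powr q \<Longrightarrow> \<rho> powr y \<le> D / (1 + t\<^sup>2)"
proof -
  define a where "a = - ln \<rho>"
  have "a > 0" using assms by (simp add: a_def)
  define E where "E = exp (- (2 * q) - 2 * q * ln (a / (2 * q)))"
  show thesis
  proof (rule that[of "(1 + C\<^sup>2) * E"])
    fix t y :: real assume y: "1 \<le> y" and t: "\<bar>t\<bar> \<le> C * y powr q"
    have "t\<^sup>2 \<le> (C * y powr q)\<^sup>2"
      using power_mono[OF t, of 2] by simp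
    also have "\<dots> = C\<^sup>2 * y powr (2 * q)"
      using y by (simp add: power_mult_distrib powr_power mult.commute)
    finally have "1 + t\<^sup>2 \<le> (1 + C\<^sup>2) * y powr (2 * q)"
      using y assms by (simp add: distrib_right add_mono ge_one_powr_ge_zero)
    also have "\<dots> \<le> (1 + C\<^sup>2) * (E * exp (a * y))"
      unfolding E_def using y \<open>a > 0\<close> assms powr_le_exp[of y "2 * q" a] by (intro mult_left_mono) auto
    finally have "(1 + t\<^sup>2) * exp (- (a * y)) \<le> (1 + C\<^sup>2) * (E * exp (a * y)) * exp (- (a * y))"
      by (rule mult_right_mono) simp
    also have "\<dots> = (1 + C\<^sup>2) * E" by (simp add: exp_minus)
    also have "exp (- (a * y)) = \<rho> powr y"
      using assms by (simp add: powr_def a_def mult.commute)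
    finally show "\<rho> powr y \<le> (1 + C\<^sup>2) * E / (1 + t\<^sup>2)"
      by (simp add: pos_le_divide_eq add_pos_nonneg mult.commute)
  qed
qed

lemma one_le_inverse_square:
  assumes "\<bar>t\<bar> \<le> T" shows "(1::real) \<le> (1 + T\<^sup>2) / (1 + t\<^sup>2)"
  using power_mono[OF assms, of 2] by (simp add: pos_le_divide_eq add_pos_nonneg)

lemma norm_char_abs:
  assumes "real_distribution \<mu>"
  shows "norm (char \<mu> \<bar>t\<bar>) = norm (char \<mu> t)"
proof (cases "t \<ge> 0")
  case False
  have "char \<mu> (- t) = cnj (char \<mu> t)"
  proof -
    have "char \<mu> (- t) = (LINT x|\<mu>. cnj (iexp (t * x)))"
      unfolding char_def by (simp add: exp_cnj del: Bochner_Integration.integral_cnj)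
    also have "\<dots> = cnj (LINT x|\<mu>. iexp (t * x))" by (rule Bochner_Integration.integral_cnj)
    finally show ?thesis by (simp only: char_def)
  qed
  then show ?thesis using False by simp
qed simp

text \<open>A profile that is bounded away from zero makes the limit laws smooth; the aperiodicity condition on the
  characteristic function is the Fourier form of span one.\<close>

locale local_limit_domain = semistable_domain +
  assumes positive_profile: "(\<exists>a>0. \<forall>x>0. a \<le> M\<^sub>R x) \<or> (\<exists>a>0. \<forall>x>0. a \<le> M\<^sub>L x)"
    and aperiodic: "\<And>t. 0 < \<bar>t\<bar> \<Longrightarrow> \<bar>t\<bar> \<le> pi \<Longrightarrow> norm (char \<mu> t) < 1"
begin

lemma Re_limit_exponent_upper:
  obtains \<kappa> where "\<kappa> > 0" "\<And>\<theta> t. \<theta> > 0 \<Longrightarrow> Re (limit_exponent \<theta> t) \<le> - \<kappa> * \<bar>t\<bar> powr \<alpha>"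
  using positive_profile
proof
  assume "\<exists>a>0. \<forall>x>0. a \<le> M\<^sub>R x"
  then obtain a where "a > 0" "\<And>x. x > 0 \<Longrightarrow> a \<le> M\<^sub>R x" by auto
  then obtain \<kappa> where \<kappa>: "\<kappa> > 0" "\<And>\<theta> t. \<theta> > 0 \<Longrightarrow> Re (right.levy_exponent \<theta> t) \<le> - \<kappa> * \<bar>t\<bar> powr \<alpha>"
    using right.Re_levy_exponent_upper[OF \<alpha>_less_2] by metis
  show thesis
  proof (rule that[OF \<kappa>(1)])
    fix \<theta> t :: real assume "\<theta> > 0"
    then show "Re (limit_exponent \<theta> t) \<le> - \<kappa> * \<bar>t\<bar> powr \<alpha>"
      using \<kappa>(2)[of \<theta> t] left.Re_levy_exponent_nonpos[OF \<alpha>_less_2, of \<theta> "- t"] by (simp add: limit_exponent_def)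
  qed
next
  assume "\<exists>a>0. \<forall>x>0. a \<le> M\<^sub>L x"
  then obtain a where "a > 0" "\<And>x. x > 0 \<Longrightarrow> a \<le> M\<^sub>L x" by auto
  then obtain \<kappa> where \<kappa>: "\<kappa> > 0" "\<And>\<theta> t. \<theta> > 0 \<Longrightarrow> Re (left.levy_exponent \<theta> t) \<le> - \<kappa> * \<bar>t\<bar> powr \<alpha>"
    using left.Re_levy_exponent_upper[OF \<alpha>_less_2] by metis
  show thesis
  proof (rule that[OF \<kappa>(1)])
    fix \<theta> t :: real assume "\<theta> > 0"
    then show "Re (limit_exponent \<theta> t) \<le> - \<kappa> * \<bar>t\<bar> powr \<alpha>"
      using \<kappa>(2)[of \<theta> "- t"] right.Re_levy_exponent_nonpos[OF \<alpha>_less_2, of \<theta> t] by (simp add: limit_exponent_def)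
  qed
qed

lemma norm_limit_char_bound:
  obtains D where "\<And>\<theta> t. \<theta> > 0 \<Longrightarrow> norm (exp (limit_exponent \<theta> t)) \<le> D / (1 + t\<^sup>2)"
proof -
  obtain \<kappa> where \<kappa>: "\<kappa> > 0" "\<And>\<theta> t. \<theta> > 0 \<Longrightarrow> Re (limit_exponent \<theta> t) \<le> - \<kappa> * \<bar>t\<bar> powr \<alpha>"
    using Re_limit_exponent_upper by blast
  obtain D where D: "\<And>t y. 1 \<le> y \<Longrightarrow> \<bar>t\<bar> \<le> 1 * y powr (1 / \<alpha>) \<Longrightarrow> exp (- \<kappa>) powr y \<le> D / (1 + t\<^sup>2)"
    using geometric_le_inverse_square[of "exp (- \<kappa>)" 1 "1 / \<alpha>"] \<kappa>(1) \<alpha>_pos by auto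
  show thesis
  proof (rule that[of "max D 2"])
    fix \<theta> t :: real assume "\<theta> > 0"
    have pos: "0 < 1 + t\<^sup>2" by (simp add: add_pos_nonneg)
    have "norm (exp (limit_exponent \<theta> t)) \<le> exp (- \<kappa> * \<bar>t\<bar> powr \<alpha>)"
      using \<kappa>(2)[OF \<open>\<theta> > 0\<close>] by simp
    also have "\<dots> \<le> max D 2 / (1 + t\<^sup>2)"
    proof (cases "\<bar>t\<bar> \<le> 1")
      case True
      have "exp (- \<kappa> * \<bar>t\<bar> powr \<alpha>) \<le> 1" using \<kappa>(1) by simp
      also have "\<dots> \<le> 2 / (1 + t\<^sup>2)" using one_le_inverse_square[OF True] by simp
      also have "\<dots> \<le> max D 2 / (1 + t\<^sup>2)" using pos by (intro divide_right_mono) auto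
      finally show ?thesis .
    next
      case False
      have "exp (- \<kappa> * \<bar>t\<bar> powr \<alpha>) = exp (- \<kappa>) powr (\<bar>t\<bar> powr \<alpha>)"
        by (simp add: powr_def mult.commute)
      also have "\<dots> \<le> D / (1 + t\<^sup>2)"
        using False \<alpha>_pos by (intro D) (auto simp: powr_powr ge_one_powr_ge_zero)
      also have "\<dots> \<le> max D 2 / (1 + t\<^sup>2)" using pos by (intro divide_right_mono) auto
      finally show ?thesis .
    qed
    finally show "norm (exp (limit_exponent \<theta> t)) \<le> max D 2 / (1 + t\<^sup>2)" .
  qed
qed

lemma position_parameter_k: "1 \<le> m \<Longrightarrow> position_parameter k (k m) = 1"
proof -
  assume m: "1 \<le> m"
  obtain j where j: "1 \<le> j" "k (j - 1) < k m" "k m \<le> k j" "position_parameter k (k m) = real (k m) / real (k j)"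
    using block_exists[OF k_pos[OF m]] .
  have "j - 1 < m" "m \<le> j" using j k_mono by (simp_all add: strict_mono_less strict_mono_less_eq)
  then have "j = m" using j(1) by linarith
  then show ?thesis using j k_pos[OF m] by simp
qed

text \<open>Along the blocks the limit theorem bounds the powers away from one, uniformly for arguments in a
  compact set that avoids zero.\<close>

lemma norm_char_along_blocks:
  assumes "\<beta> > 0"
  obtains m\<^sub>0 \<rho> where "0 < \<rho>" "\<rho> < 1" "\<And>m t. m\<^sub>0 \<le> m \<Longrightarrow> \<beta> \<le> t \<Longrightarrow> t \<le> 1 \<Longrightarrow> norm (char \<mu> (t / A (real (k m)))) ^ k m \<le> \<rho>"
proof -
  obtain \<kappa> where \<kappa>: "\<kappa> > 0" "\<And>\<theta> t. \<theta> > 0 \<Longrightarrow> Re (limit_exponent \<theta> t) \<le> - \<kappa> * \<bar>t\<bar> powr \<alpha>"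
    using Re_limit_exponent_upper by blast
  have "exp (- \<kappa> * \<beta> powr \<alpha>) < 1" using \<kappa>(1) \<open>\<beta> > 0\<close> by simp
  then obtain \<rho> where \<rho>: "exp (- \<kappa> * \<beta> powr \<alpha>) < \<rho>" "\<rho> < 1" using dense by blast
  have "\<exists>m\<^sub>0. \<forall>m t. m\<^sub>0 \<le> m \<longrightarrow> \<beta> \<le> t \<longrightarrow> t \<le> 1 \<longrightarrow> norm (char \<mu> (t / A (real (k m)))) ^ k m \<le> \<rho>"
  proof (rule ccontr)
    assume "\<not> ?thesis"
    then have "\<forall>j::nat. \<exists>m t. Suc j \<le> m \<and> \<beta> \<le> t \<and> t \<le> 1 \<and> \<rho> < norm (char \<mu> (t / A (real (k m)))) ^ k m"
      by (meson not_less)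
    then obtain m t where mt: "\<And>j::nat. Suc j \<le> m j" "\<And>j. t j \<in> {\<beta>..1}"
      "\<And>j. \<rho> < norm (char \<mu> (t j / A (real (k (m j))))) ^ k (m j)"
      by (metis atLeastAtMost_iff)
    have "compact {\<beta>..1}" by simp
    then obtain t' \<sigma> where \<sigma>: "t' \<in> {\<beta>..1}" "strict_mono \<sigma>" "(t \<circ> \<sigma>) \<longlonglongrightarrow> t'"
      using mt(2) by (metis compact_def)
    have n: "filterlim (\<lambda>j. k (m (\<sigma> j))) sequentially sequentially"
      unfolding filterlim_at_top
    proof
      fix Z
      show "\<forall>\<^sub>F j in sequentially. Z \<le> k (m (\<sigma> j))"
        using eventually_ge_at_top[of Z]
      proof eventually_elim
        case (elim j)
        then show ?case
          using strict_mono_imp_increasing[OF \<sigma>(2), of j] mt(1)[of "\<sigma> j"] k_ge[of "m (\<sigma> j)"] by linarith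
      qed
    qed
    have "position_parameter k (k (m (\<sigma> j))) = 1" for j
      using mt(1)[of "\<sigma> j"] by (intro position_parameter_k) simp
    then have "(\<lambda>j. char \<mu> ((t \<circ> \<sigma>) j / A (real (k (m (\<sigma> j))))) ^ k (m (\<sigma> j)) *
        iexp (- ((t \<circ> \<sigma>) j * (centering \<mu> (k (m (\<sigma> j))) / A (real (k (m (\<sigma> j)))))))) \<longlonglongrightarrow> exp (limit_exponent 1 t')"
      by (intro char_tendsto n \<sigma>(3)) auto
    from tendsto_norm[OF this] have "(\<lambda>j. norm (char \<mu> ((t \<circ> \<sigma>) j / A (real (k (m (\<sigma> j)))))) ^ k (m (\<sigma> j))) \<longlonglongrightarrow> exp (Re (limit_exponent 1 t'))"
      by (simp add: norm_mult norm_power)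
    then have "\<rho> \<le> exp (Re (limit_exponent 1 t'))"
      by (rule tendsto_lowerbound) (auto intro!: always_eventually less_imp_le[OF mt(3)])
    also have "\<dots> \<le> exp (- \<kappa> * \<beta> powr \<alpha>)"
    proof -
      have "\<beta> powr \<alpha> \<le> \<bar>t'\<bar> powr \<alpha>" using \<sigma>(1) \<open>\<beta> > 0\<close> \<alpha>_pos by (intro powr_mono2) auto
      then have "\<kappa> * \<beta> powr \<alpha> \<le> \<kappa> * \<bar>t'\<bar> powr \<alpha>" using \<kappa>(1) by simp
      then show ?thesis using \<kappa>(2)[of 1 t'] by simp
    qed
    finally show False using \<rho> by simp
  qed
  moreover have "0 < \<rho>" using \<rho>(1) exp_gt_zero by (rule less_trans[rotated])
  ultimately show thesis using \<rho>(2) that by blast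
qed

lemma norm_char_away_from_0:
  assumes "\<eta> > 0"
  obtains \<rho> where "0 < \<rho>" "\<rho> < 1" "\<And>t. \<eta> \<le> \<bar>t\<bar> \<Longrightarrow> \<bar>t\<bar> \<le> pi \<Longrightarrow> norm (char \<mu> t) \<le> \<rho>"
proof (cases "\<eta> \<le> pi")
  case True
  have "continuous_on {\<eta>..pi} (\<lambda>t. norm (char \<mu> t))"
    by (intro continuous_on_norm continuous_at_imp_continuous_on ballI real_distribution.isCont_char \<mu>)
  then obtain s where s: "s \<in> {\<eta>..pi}" "\<And>t. t \<in> {\<eta>..pi} \<Longrightarrow> norm (char \<mu> t) \<le> norm (char \<mu> s)"
    using continuous_attains_sup[of "{\<eta>..pi}" "\<lambda>t. norm (char \<mu> t)"] True by auto
  show thesis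
  proof (rule that[of "max (1/2) (norm (char \<mu> s))"])
    show "max (1/2) (norm (char \<mu> s)) < 1" using s(1) \<open>\<eta> > 0\<close> by (auto intro!: aperiodic)
    fix t assume "\<eta> \<le> \<bar>t\<bar>" "\<bar>t\<bar> \<le> pi"
    then have "norm (char \<mu> \<bar>t\<bar>) \<le> norm (char \<mu> s)" by (intro s) auto
    then show "norm (char \<mu> t) \<le> max (1/2) (norm (char \<mu> s))"
      using norm_char_abs[OF \<mu>, of t] by simp
  qed simp
next
  case False
  then show thesis by (intro that[of "1/2"]) auto
qed

text \<open>The bound along the blocks transfers to every \<open>n\<close> and to large arguments: \<open>t / A n\<close> is rewritten
  as \<open>s / A (k m)\<close> with \<open>s\<close> of order one, so that the \<open>n\<close>-th power is the \<open>n / k m\<close>-th power of a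
  quantity bounded by \<open>\<rho>\<close>, and \<open>n / k m\<close> is at least a power of \<open>t\<close> by Potter's
  bound.  For \<open>t\<close> of order \<open>A n\<close> aperiodicity gives exponential decay in \<open>n\<close>.\<close>

lemma norm_char_power_bound:
  obtains D where "\<And>n t. 1 \<le> n \<Longrightarrow> \<bar>t\<bar> \<le> pi * A (real n) \<Longrightarrow> norm (char \<mu> (t / A (real n))) ^ n \<le> D / (1 + t\<^sup>2)"
proof -
  (* Half the limit of A (k m) / A (k (m + 1)), hence eventually a lower bound for this ratio. *)
  define \<beta> where "\<beta> = 1 / (2 * c powr (1 / \<alpha>))"
  have "\<beta> > 0" using c_gt_1 by (simp add: \<beta>_def)
  obtain m\<^sub>1 \<rho> where \<rho>: "0 < \<rho>" "\<rho> < 1" "\<And>m t. m\<^sub>1 \<le> m \<Longrightarrow> \<beta> \<le> t \<Longrightarrow> t \<le> 1 \<Longrightarrow> norm (char \<mu> (t / A (real (k m)))) ^ k m \<le> \<rho>"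
    using norm_char_along_blocks[OF \<open>\<beta> > 0\<close>] by metis
  have "\<forall>\<^sub>F m in sequentially. A (real (k (shift 1 m))) / A (real (k m)) < 1 / \<beta>"
    using A_k_shift_ratio[of 1] by (rule order_tendstoD(2)) (use c_gt_1 in \<open>simp add: \<beta>_def\<close>)
  then obtain m\<^sub>2 where m2: "\<And>m. m\<^sub>2 \<le> m \<Longrightarrow> A (real (k (shift 1 m))) / A (real (k m)) < 1 / \<beta>"
    by (auto simp: eventually_sequentially)
  define m\<^sub>0 where "m\<^sub>0 = max (max m\<^sub>1 m\<^sub>2) 1"
  have Ak: "A (real (k m)) > 0" if "m\<^sub>0 \<le> m" for m
    using that k_pos[of m] by (intro A_pos) (simp add: m\<^sub>0_def)
  have Suc_ratio: "A (real (k (Suc m))) * \<beta> < A (real (k m))" if "m\<^sub>0 \<le> m" for m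
    using m2[of m] that Ak[OF that] \<open>\<beta> > 0\<close> by (simp add: m\<^sub>0_def shift_def nat_add_distrib field_simps)
  define q where "q = 2 / \<alpha>"
  define p where "p = 1 / (2 * \<alpha>)"
  have pq: "0 < p" "p \<le> q" "0 < q" using \<alpha>_pos by (simp_all add: p_def q_def field_simps)
  obtain C where C: "C > 0" "\<And>m n :: nat. 1 \<le> m \<Longrightarrow> 1 \<le> n \<Longrightarrow>
       A (real m) \<le> C * A (real n) * ((real m / real n) powr q + (real m / real n) powr p)"
    using A_potter_nat[of p q] \<alpha>_pos by (auto simp: p_def q_def field_simps)
  have C2: "A (real m) \<le> 2 * C * A (real n) * (real m / real n) powr q" if "1 \<le> n" "n \<le> m" for m n
  proof -
    have An: "A (real n) > 0" using that by (intro A_pos) simp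
    have "1 \<le> real m / real n" using that by simp
    then have "(real m / real n) powr p \<le> (real m / real n) powr q" using pq by (intro powr_mono) auto
    then have "C * A (real n) * ((real m / real n) powr q + (real m / real n) powr p) \<le> C * A (real n) * (2 * (real m / real n) powr q)"
      using C(1) An by (intro mult_left_mono) auto
    then show ?thesis using C(2)[of m n] that by (simp add: mult_ac)
  qed
  define \<eta> where "\<eta> = 1 / A (real (k m\<^sub>0))"
  have "\<eta> > 0" using Ak[of m\<^sub>0] by (simp add: \<eta>_def)
  obtain \<rho>' where \<rho>': "0 < \<rho>'" "\<rho>' < 1" "\<And>t. \<eta> \<le> \<bar>t\<bar> \<Longrightarrow> \<bar>t\<bar> \<le> pi \<Longrightarrow> norm (char \<mu> t) \<le> \<rho>'"
    using norm_char_away_from_0[OF \<open>\<eta> > 0\<close>] by metis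
  obtain D\<^sub>1 where D1: "\<And>t y. 1 \<le> y \<Longrightarrow> \<bar>t\<bar> \<le> 2 * C * y powr q \<Longrightarrow> \<rho> powr y \<le> D\<^sub>1 / (1 + t\<^sup>2)"
    using geometric_le_inverse_square[OF \<rho>(1,2), of "2 * C" q] C(1) pq by auto
  have A1: "A 1 > 0" by (rule A_pos) simp
  obtain D\<^sub>2 where D2: "\<And>t y. 1 \<le> y \<Longrightarrow> \<bar>t\<bar> \<le> pi * (2 * C * A 1) * y powr q \<Longrightarrow> \<rho>' powr y \<le> D\<^sub>2 / (1 + t\<^sup>2)"
    using geometric_le_inverse_square[OF \<rho>'(1,2), of "pi * (2 * C * A 1)" q] C(1) pq A1 by auto
  define D\<^sub>3 where "D\<^sub>3 = 1 + (max 1 (2 * C))\<^sup>2"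
  show thesis
  proof (rule that[of "max D\<^sub>1 (max D\<^sub>2 D\<^sub>3)"])
    fix n :: nat and t :: real assume n: "1 \<le> n" and t: "\<bar>t\<bar> \<le> pi * A (real n)"
    define v where "v = norm (char \<mu> (t / A (real n)))"
    have v: "0 \<le> v" "v \<le> 1" by (auto simp: v_def norm_char_le_1)
    have An: "A (real n) > 0" using n by (intro A_pos) simp
    have pos: "0 < 1 + t\<^sup>2" by (simp add: add_pos_nonneg)
    (* In the second case a block index at least m0 matches the scale A n / |t|; in the third case
       |t / A n| lies between \<eta> and \<pi>. *)
    consider "\<bar>t\<bar> \<le> max 1 (2 * C)" | "\<bar>t\<bar> > max 1 (2 * C)" "A (real (k m\<^sub>0)) \<le> A (real n) / \<bar>t\<bar>" | "\<bar>t\<bar> > max 1 (2 * C)" "A (real n) / \<bar>t\<bar> < A (real (k m\<^sub>0))"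
      by linarith
    then have "v ^ n \<le> D\<^sub>1 / (1 + t\<^sup>2) \<or> v ^ n \<le> D\<^sub>2 / (1 + t\<^sup>2) \<or> v ^ n \<le> D\<^sub>3 / (1 + t\<^sup>2)"
    proof cases
      case 1
      have "v ^ n \<le> 1" using v by (rule power_le_one)
      also have "\<dots> \<le> D\<^sub>3 / (1 + t\<^sup>2)" unfolding D\<^sub>3_def using 1 by (rule one_le_inverse_square)
      finally show ?thesis by simp
    next
      case 2
      define x where "x = A (real n) / \<bar>t\<bar>"
      have "0 < \<bar>t\<bar>" using 2(1) by linarith
      then have "x > 0" unfolding x_def using An by (intro divide_pos_pos)
      have "\<forall>\<^sub>F m in sequentially. x < A (real (k m))"
        using A_k_at_top by (simp add: filterlim_at_top_dense)
      then have "\<exists>j. x < A (real (k j)) \<and> m\<^sub>0 \<le> j"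
        by (intro eventually_happens'[OF trivial_limit_sequentially] eventually_conj eventually_ge_at_top)
      then obtain j where j: "m\<^sub>0 \<le> j" "x < A (real (k j))"
        by auto
      define m' where "m' = (LEAST j. m\<^sub>0 \<le> j \<and> x < A (real (k j)))"
      have m': "m\<^sub>0 \<le> m'" "x < A (real (k m'))"
        using LeastI[of "\<lambda>j. m\<^sub>0 \<le> j \<and> x < A (real (k j))" j] j by (auto simp: m'_def)
      have "m' \<noteq> m\<^sub>0" using m'(2) 2 by (auto simp: x_def)
      then obtain m where m: "m' = Suc m" "m\<^sub>0 \<le> m" using m'(1) by (cases m') auto
      have "\<not> x < A (real (k m))"
        using not_less_Least[of m "\<lambda>j. m\<^sub>0 \<le> j \<and> x < A (real (k j))"] m by (simp add: m'_def[symmetric])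
      then have xm: "A (real (k m)) \<le> x" "x < A (real (k (Suc m)))" using m'(2) m by auto
      define s where "s = A (real (k m)) / x"
      have "s \<le> 1" using xm \<open>x > 0\<close> by (simp add: s_def)
      have "\<beta> * x \<le> \<beta> * A (real (k (Suc m)))" using xm \<open>\<beta> > 0\<close> by simp
      then have "\<beta> \<le> s" using Suc_ratio[OF m(2)] \<open>x > 0\<close> by (simp add: s_def field_simps)
      have "\<bar>t / A (real n)\<bar> = s / A (real (k m))"
        using Ak[OF m(2)] An 2 by (simp add: s_def x_def)
      then have v_eq: "v = norm (char \<mu> (s / A (real (k m))))"
        unfolding v_def using norm_char_abs[OF \<mu>, of "t / A (real n)"] by simp
      have v_le: "v ^ k m \<le> \<rho>"
        unfolding v_eq using m(2) \<open>\<beta> \<le> s\<close> \<open>s \<le> 1\<close> by (intro \<rho>) (auto simp: m\<^sub>0_def)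
      have km: "1 \<le> k m" using m(2) by (intro k_pos) (simp add: m\<^sub>0_def)
      have t_eq: "\<bar>t\<bar> = A (real n) / x" using An 2 by (simp add: x_def)
      have t_le: "\<bar>t\<bar> \<le> A (real n) / A (real (k m))"
        unfolding t_eq using xm Ak[OF m(2)] An by (intro divide_left_mono) auto
      have "k m \<le> n"
      proof (rule ccontr)
        assume "\<not> k m \<le> n"
        then have "(real n / real (k m)) powr r \<le> 1" if "0 < r" for r
          using that by (intro powr_le1) auto
        then have "C * A (real (k m)) * ((real n / real (k m)) powr q + (real n / real (k m)) powr p) \<le> C * A (real (k m)) * (1 + 1)"
          using C(1) Ak[OF m(2)] pq by (intro mult_left_mono add_mono) auto
        then have "A (real n) / A (real (k m)) \<le> 2 * C"
          using C(2)[OF n km] Ak[OF m(2)] by (simp add: field_simps)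
        then show False using t_le 2 by simp
      qed
      then have t_le': "\<bar>t\<bar> \<le> 2 * C * (real n / real (k m)) powr q"
      proof -
        have "A (real n) / A (real (k m)) \<le> 2 * C * (real n / real (k m)) powr q"
          using C2[OF km \<open>k m \<le> n\<close>] Ak[OF m(2)] by (subst pos_divide_le_eq) (simp_all add: mult_ac)
        then show ?thesis using t_le by simp
      qed
      have "v ^ n \<le> \<rho> powr (real n / real (k m))"
      proof (cases "v = 0")
        case False
        then have "v ^ n = (v ^ k m) powr (real n / real (k m))"
          using v(1) km by (simp add: powr_realpow[symmetric] powr_powr)
        also have "\<dots> \<le> \<rho> powr (real n / real (k m))"
          using v_le v(1) by (intro powr_mono2) auto
        finally show ?thesis .
      qed (use n in \<open>simp add: power_0_left\<close>)
      also have "\<dots> \<le> D\<^sub>1 / (1 + t\<^sup>2)"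
        using t_le' \<open>k m \<le> n\<close> km by (intro D1) auto
      finally show ?thesis by simp
    next
      case 3
      have "v \<le> \<rho>'"
        unfolding v_def using 3 t An Ak[of m\<^sub>0] by (intro \<rho>') (auto simp: \<eta>_def field_simps)
      then have "v ^ n \<le> \<rho>' ^ n" using v(1) by (rule power_mono)
      also have "\<dots> = \<rho>' powr real n" using \<rho>'(1) by (simp add: powr_realpow)
      also have "\<dots> \<le> D\<^sub>2 / (1 + t\<^sup>2)"
      proof (rule D2)
        show "1 \<le> real n" using n by simp
        have "pi * A (real n) \<le> pi * (2 * C * A 1 * real n powr q)"
          using C2[of 1 n] n by (intro mult_left_mono) auto
        also have "\<dots> = pi * (2 * C * A 1) * real n powr q" by simp
        finally show "\<bar>t\<bar> \<le> pi * (2 * C * A 1) * real n powr q" using t by linarith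
      qed
      finally show ?thesis by simp
    qed
    moreover have "D / (1 + t\<^sup>2) \<le> max D\<^sub>1 (max D\<^sub>2 D\<^sub>3) / (1 + t\<^sup>2)" if "D \<in> {D\<^sub>1, D\<^sub>2, D\<^sub>3}" for D
      using that pos by (intro divide_right_mono) auto
    ultimately show "norm (char \<mu> (t / A (real n))) ^ n \<le> max D\<^sub>1 (max D\<^sub>2 D\<^sub>3) / (1 + t\<^sup>2)"
      unfolding v_def by (meson insertI1 insertI2 order_trans)
  qed
qed

end

section \<open>Inversion formulas and aperiodicity\<close>

lemma integrable_inverse_square: "integrable lborel (\<lambda>t::real. D / (1 + t\<^sup>2))"
proof -
  have "integrable lborel (\<lambda>t::real. inverse (1 + t\<^sup>2))"
    using integrable_inverse_1_plus_square by (simp add: set_integrable_def einterval_def)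
  then have "integrable lborel (\<lambda>t::real. D * inverse (1 + t\<^sup>2))"
    by (rule integrable_mult_right)
  then show ?thesis by (simp add: divide_inverse)
qed

text \<open>If \<open>|char \<mu> t| = 1\<close>, then \<open>cos (t x - b) = 1\<close> almost surely for a suitable \<open>b\<close>, so that
  \<open>\<mu>\<close> lives on a lattice of step \<open>2 \<pi> / |t|\<close>; for \<open>|t| \<le> \<pi>\<close> this step is at least 2.\<close>

lemma span_one_norm_char_less_1:
  assumes \<mu>: "real_distribution \<mu>" and span: "has_span \<mu> 1" and t: "0 < \<bar>t\<bar>" "\<bar>t\<bar> \<le> pi"
  shows "norm (char \<mu> t) < 1"
proof (rule ccontr)
  interpret real_distribution \<mu> by (rule \<mu>)
  assume "\<not> norm (char \<mu> t) < 1"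
  then have one: "norm (char \<mu> t) = 1" using cmod_char_le_1[of t] by simp
  define b where "b = Arg (char \<mu> t)"
  have "char \<mu> t \<noteq> 0" using one by auto
  then have char_eq: "char \<mu> t = iexp b"
    using Arg_eq[of "char \<mu> t"] one by (simp add: b_def)
  have int: "integrable \<mu> (\<lambda>x. iexp (t * x))"
    using integrable_iexp[of "\<lambda>x. t * x"] by simp
  have cos_eq: "cos (t * x - b) = Re (iexp (- b) * iexp (t * x))" for x
  proof -
    have "iexp (- b) * iexp (t * x) = iexp (t * x - b)"
      by (simp add: exp_add[symmetric] algebra_simps)
    then show ?thesis by (simp only:) (simp add: Re_exp)
  qed
  have int_Re: "integrable \<mu> (\<lambda>x. Re (iexp (- b) * iexp (t * x)))"
    using int by (intro integrable_Re integrable_mult_right)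
  then have int_cos: "integrable \<mu> (\<lambda>x. 1 - cos (t * x - b))"
    unfolding cos_eq by (intro Bochner_Integration.integrable_diff) simp_all
  have "(LINT x|\<mu>. 1 - cos (t * x - b)) = (LINT x|\<mu>. 1) - (LINT x|\<mu>. Re (iexp (- b) * iexp (t * x)))"
    unfolding cos_eq by (rule Bochner_Integration.integral_diff[OF _ int_Re]) simp
  also have "(LINT x|\<mu>. (1::real)) = 1"
    by (simp add: prob_space del: space_eq_univ)
  also have "(LINT x|\<mu>. Re (iexp (- b) * iexp (t * x))) = Re (iexp (- b) * char \<mu> t)"
    unfolding char_def using int by (subst integral_Re) simp_all
  also have "iexp (- b) * char \<mu> t = 1"
    by (simp add: char_eq exp_minus)
  finally have "(LINT x|\<mu>. 1 - cos (t * x - b)) = 0" by simp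
  then have "AE x in \<mu>. 1 - cos (t * x - b) = 0"
    using integral_nonneg_eq_0_iff_AE[OF int_cos] by simp
  then have "AE x in \<mu>. \<exists>j::int. x = b / t + (2 * pi / \<bar>t\<bar>) * of_int j"
  proof eventually_elim
    case (elim x)
    then obtain j :: int where j: "t * x - b = of_int j * 2 * pi"
      using cos_one_2pi_int[of "t * x - b"] by auto
    have "x = b / t + (2 * pi / \<bar>t\<bar>) * of_int (if t > 0 then j else - j)"
      using j t by (auto simp: field_simps)
    then show ?case by blast
  qed
  moreover have "2 * pi / \<bar>t\<bar> > 0" using t pi_gt_zero by simp
  ultimately have "concentrated_on_lattice \<mu> (b / t) (2 * pi / \<bar>t\<bar>)"
    unfolding concentrated_on_lattice_def by blast
  then have "2 * pi / \<bar>t\<bar> \<le> 1"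
    using span by (auto simp: has_span_def)
  then have "2 * pi \<le> \<bar>t\<bar>" using t by (simp add: field_simps)
  then show False using t pi_gt_zero by linarith
qed

lemma LINT_iexp_int:
  "(LINT u:{-pi..pi}|lborel. iexp (u * of_int m)) = (if m = 0 then 2 * pi else 0)"
proof (cases "m = 0")
  case True
  then show ?thesis using pi_gt_zero by (simp add: set_lebesgue_integral_def scaleR_conv_of_real)
next
  case False
  let ?F = "\<lambda>u::real. iexp (u * of_int m) / (\<i> * of_int m)"
  have "(LINT u|lborel. indicator {-pi..pi} u *\<^sub>R iexp (u * of_int m)) = ?F pi - ?F (- pi)"
  proof (rule integral_FTC_Icc)
    show "- pi \<le> pi" using pi_gt_zero by simp
    show "continuous_on {- pi..pi} (\<lambda>u. iexp (u * of_int m))"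
      by (intro continuous_intros)
    fix u :: real
    show "(?F has_vector_derivative iexp (u * of_int m)) (at u within {- pi..pi})"
      using False by (auto intro!: derivative_eq_intros has_vector_derivative_real_field simp: scaleR_conv_of_real mult_ac)
  qed
  also have "?F pi = ?F (- pi)"
  proof -
    have "iexp (pi * of_int m) = iexp (- pi * of_int m) * exp (2 * of_int m * of_real pi * \<i>)"
      by (subst exp_add[symmetric], rule arg_cong[where f = exp]) (simp add: algebra_simps)
    also have "exp (2 * of_int m * of_real pi * \<i>) = (1::complex)"
      using exp_integer_2pi[of "of_int m"] by (simp add: mult_ac)
    finally have "iexp (pi * of_int m) = iexp (- pi * of_int m)" by (simp only: mult_1_right)
    then show ?thesis by (simp only:)
  qed
  finally show ?thesis using False by (simp add: set_lebesgue_integral_def)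
qed

text \<open>Fubini's theorem and orthogonality of the exponentials with integer frequencies.\<close>

lemma lattice_inversion:
  assumes \<nu>: "real_distribution \<nu>" and int: "AE x in \<nu>. x \<in> \<int>"
  shows "2 * pi * measure \<nu> {of_int j} = (LINT u:{-pi..pi}|lborel. iexp (- (u * of_int j)) * char \<nu> u)"
proof -
  interpret \<nu>: real_distribution \<nu> by (rule \<nu>)
  interpret pair_sigma_finite lborel \<nu> ..
  define f where "f u x = indicator {-pi..pi} u *\<^sub>R iexp (u * (x - of_int j))" for u x :: real
  have meas: "case_prod f \<in> borel_measurable (lborel \<Otimes>\<^sub>M \<nu>)"
    unfolding f_def[abs_def] by (simp add: split_beta') measurable
  have pair_int: "integrable (lborel \<Otimes>\<^sub>M \<nu>) (case_prod f)"
  proof (rule Fubini_integrable[OF meas])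
    have "(LINT x|\<nu>. norm (case_prod f (u, x))) = indicator {-pi..pi} u" for u
      by (simp add: f_def \<nu>.prob_space del: \<nu>.space_eq_univ)
    then show "integrable lborel (\<lambda>u. LINT x|\<nu>. norm (case_prod f (u, x)))"
      by (simp add: integrable_indicator_iff emeasure_lborel_Icc_eq)
    show "AE u in lborel. integrable \<nu> (\<lambda>x. case_prod f (u, x))"
      by (intro AE_I2 \<nu>.integrable_const_bound[where B = 1]) (auto simp: f_def indicator_def)
  qed
  have inner: "(LINT x|\<nu>. f u x) = indicator {-pi..pi} u *\<^sub>R (iexp (- (u * of_int j)) * char \<nu> u)" for u
  proof -
    have "f u x = (indicator {-pi..pi} u *\<^sub>R iexp (- (u * of_int j))) * iexp (u * x)" for x
      by (simp add: f_def exp_add[symmetric] algebra_simps)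
    then show ?thesis by (simp add: char_def)
  qed
  have "(LINT x|\<nu>. LINT u|lborel. f u x) = (LINT x|\<nu>. complex_of_real (2 * pi * indicator {of_int j} x))"
  proof (rule integral_cong_AE)
    show "(\<lambda>x. LINT u|lborel. f u x) \<in> borel_measurable \<nu>"
      by (rule borel_measurable_integrable[OF integrable_snd[OF pair_int]])
    show "AE x in \<nu>. (LINT u|lborel. f u x) = complex_of_real (2 * pi * indicator {of_int j} x)"
      using int
    proof eventually_elim
      case (elim x)
      then obtain i :: int where "x = of_int i" by (auto elim: Ints_cases)
      then show ?case
        using LINT_iexp_int[of "i - j"] by (simp add: f_def set_lebesgue_integral_def scaleR_conv_of_real indicator_def)
    qed
  qed simp
  also have "\<dots> = 2 * pi * measure \<nu> {of_int j}"
    by (simp del: of_real_mult)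
  also have "(LINT x|\<nu>. LINT u|lborel. f u x) = (LINT u|lborel. LINT x|\<nu>. f u x)"
    by (rule Fubini_integral[OF pair_int])
  also have "\<dots> = (LINT u|lborel. indicator {-pi..pi} u *\<^sub>R (iexp (- (u * of_int j)) * char \<nu> u))"
    by (simp only: inner)
  finally show ?thesis by (simp add: set_lebesgue_integral_def)
qed

text \<open>For an integrable characteristic function the principal value in Levy's inversion formula is an
  ordinary integral.\<close>

lemma Levy_inversion_integrable:
  assumes \<nu>: "real_distribution \<nu>" and int: "integrable lborel (char \<nu>)"
    and "a \<le> b" and "measure \<nu> {a} = 0" "measure \<nu> {b} = 0"
  shows "2 * pi * measure \<nu> {a<..b} = (LINT t|lborel. (iexp (- (t * a)) - iexp (- (t * b))) / (\<i> * t) * char \<nu> t)"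
proof -
  interpret real_distribution \<nu> by (rule \<nu>)
  let ?f = "\<lambda>t. (iexp (- (t * a)) - iexp (- (t * b))) / (\<i> * of_real t) * char \<nu> t"
  have le: "norm (?f t) \<le> (b - a) * norm (char \<nu> t)" for t
  proof (cases "t = 0")
    case False
    have "norm ((iexp (- (t * a)) - iexp (- (t * b))) / (\<i> * of_real t)) \<le> b - a"
      using Levy_Inversion_aux2[of "- b" "- a" t] False \<open>a \<le> b\<close> by simp
    then show ?thesis unfolding norm_mult by (rule mult_right_mono) simp
  qed (use \<open>a \<le> b\<close> in simp)
  have "(\<lambda>T::nat. LINT t|lborel. indicator {- real T<..<real T} t *\<^sub>R ?f t) \<longlonglongrightarrow> (LINT t|lborel. ?f t)"
  proof (rule integral_dominated_convergence[where w = "\<lambda>t. (b - a) * norm (char \<nu> t)"])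
    show "AE t in lborel. (\<lambda>T::nat. indicator {- real T<..<real T} t *\<^sub>R ?f t) \<longlonglongrightarrow> ?f t"
    proof (rule AE_I2)
      fix t :: real
      have "\<forall>\<^sub>F T::nat in sequentially. \<bar>t\<bar> < real T"
        using filterlim_real_sequentially by (simp add: filterlim_at_top_dense)
      then have "\<forall>\<^sub>F T::nat in sequentially. indicator {- real T<..<real T} t *\<^sub>R ?f t = ?f t"
        by eventually_elim (auto simp: indicator_def abs_less_iff)
      then show "(\<lambda>T::nat. indicator {- real T<..<real T} t *\<^sub>R ?f t) \<longlonglongrightarrow> ?f t"
        by (rule tendsto_eventually)
    qed
    show "AE t in lborel. norm (indicator {- real T<..<real T} t *\<^sub>R ?f t) \<le> (b - a) * norm (char \<nu> t)" for T :: nat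
      using le \<open>a \<le> b\<close> by (intro AE_I2) (simp add: indicator_def)
    show "integrable lborel (\<lambda>t. (b - a) * norm (char \<nu> t))"
      using int by (intro integrable_mult_right integrable_norm)
  qed measurable
  moreover have "(LINT t|lborel. indicator {- real T<..<real T} t *\<^sub>R ?f t) = (CLBINT t=ereal (- real T)..ereal (real T). ?f t)" for T :: nat
    unfolding interval_lebesgue_integral_def set_lebesgue_integral_def einterval_eq(1) by simp
  ultimately have "(\<lambda>T::nat. 1 / (2 * pi) * (CLBINT t=ereal (- real T)..ereal (real T). ?f t)) \<longlonglongrightarrow> 1 / (2 * pi) * (LINT t|lborel. ?f t)"
    by (intro tendsto_intros) simp
  moreover have "(\<lambda>T::nat. 1 / (2 * pi) * (CLBINT t=ereal (- real T)..ereal (real T). ?f t)) \<longlonglongrightarrow> measure \<nu> {a<..b}"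
    using Levy_Inversion[OF \<open>a \<le> b\<close> assms(4,5)] by simp
  ultimately have "1 / (2 * pi) * (LINT t|lborel. ?f t) = measure \<nu> {a<..b}"
    by (rule LIMSEQ_unique)
  then show ?thesis by (simp add: field_simps)
qed

text \<open>Difference quotients of the distribution function, both sides of Levy's formula divided by
  \<open>h \<rightarrow> 0\<close>, give the density at every point.\<close>

lemma density_inversion:
  assumes \<nu>: "real_distribution \<nu>" and int: "integrable lborel (char \<nu>)" and g: "continuous_density \<nu> g"
  shows "2 * pi * g a = (LINT t|lborel. iexp (- (t * a)) * char \<nu> t)"
proof -
  interpret real_distribution \<nu> by (rule \<nu>)
  have g_cont: "continuous_on UNIV g" and g_nonneg: "\<And>x. 0 \<le> g x"
    and g_dens: "distributed \<nu> lborel (\<lambda>x. x) (\<lambda>x. ennreal (g x))"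
    using g by (auto simp: continuous_density_def)
  have [measurable]: "g \<in> borel_measurable borel"
    using g_cont by (rule borel_measurable_continuous_onI)
  have emeas: "emeasure \<nu> B = (\<integral>\<^sup>+x. ennreal (g x) * indicator B x \<partial>lborel)" if "B \<in> sets borel" for B
    using distributed_emeasure[OF g_dens, of B] that by simp
  have null: "measure \<nu> {x} = 0" for x
  proof -
    have "emeasure \<nu> {x} = (\<integral>\<^sup>+y. ennreal (g y) * indicator {x} y \<partial>lborel)"
      by (rule emeas) simp
    also have "\<dots> = (\<integral>\<^sup>+(y::real). 0 \<partial>lborel)"
    proof (rule nn_integral_cong_AE)
      show "AE y in lborel. ennreal (g y) * indicator {x} y = 0"
        using AE_lborel_singleton[of x] by eventually_elim (simp add: indicator_def)
    qed
    finally have "emeasure \<nu> {x} = 0" by simp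
    then show ?thesis by (simp add: measure_def)
  qed
  define h where "h n = 1 / real (Suc n)" for n
  have h: "h n > 0" for n by (simp add: h_def)
  have h_lim: "h \<longlonglongrightarrow> 0" unfolding h_def using LIMSEQ_inverse_real_of_nat by (simp add: inverse_eq_divide)
  have avg: "(\<lambda>n. measure \<nu> {a<..a + h n} / h n) \<longlonglongrightarrow> g a"
  proof (rule tendstoI)
    fix \<epsilon> :: real assume "\<epsilon> > 0"
    have "isCont g a" using g_cont by (simp add: continuous_on_eq_continuous_at)
    then obtain d where d: "d > 0" "\<And>y. \<bar>y - a\<bar> < d \<Longrightarrow> \<bar>g y - g a\<bar> < \<epsilon> / 2"
      using \<open>\<epsilon> > 0\<close> unfolding continuous_at_eps_delta by (metis half_gt_zero dist_real_def)
    have "\<forall>\<^sub>F n in sequentially. h n < d" using h_lim d(1) by (rule order_tendstoD(2))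
    then show "\<forall>\<^sub>F n in sequentially. dist (measure \<nu> {a<..a + h n} / h n) (g a) < \<epsilon>"
    proof eventually_elim
      case (elim n)
      have near: "\<bar>g y - g a\<bar> < \<epsilon> / 2" if "y \<in> {a<..a + h n}" for y
        using that elim by (intro d(2)) auto
      have const: "(\<integral>\<^sup>+y. ennreal r * indicator {a<..a + h n} y \<partial>lborel) = ennreal (r * h n)" if "r \<ge> 0" for r
        using that h[of n] by (subst nn_integral_cmult_indicator) (auto simp: ennreal_mult)
      have emeas_h: "emeasure \<nu> {a<..a + h n} = (\<integral>\<^sup>+x. ennreal (g x) * indicator {a<..a + h n} x \<partial>lborel)"
        by (rule emeas) simp
      have "emeasure \<nu> {a<..a + h n} \<le> (\<integral>\<^sup>+y. ennreal (g a + \<epsilon> / 2) * indicator {a<..a + h n} y \<partial>lborel)"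
        unfolding emeas_h
      proof (rule nn_integral_mono)
        fix y
        show "ennreal (g y) * indicator {a<..a + h n} y \<le> ennreal (g a + \<epsilon> / 2) * indicator {a<..a + h n} y"
        proof (cases "y \<in> {a<..a + h n}")
          case True
          then have "g y \<le> g a + \<epsilon> / 2" using near[of y] by linarith
          then show ?thesis using True by (simp add: ennreal_leI)
        qed simp
      qed
      also have "\<dots> = ennreal ((g a + \<epsilon> / 2) * h n)"
        using g_nonneg[of a] \<open>\<epsilon> > 0\<close> by (intro const) simp
      finally have up: "measure \<nu> {a<..a + h n} \<le> (g a + \<epsilon> / 2) * h n"
        using g_nonneg[of a] \<open>\<epsilon> > 0\<close> h[of n] by (simp add: emeasure_eq_measure)
      have "ennreal (max 0 (g a - \<epsilon> / 2) * h n) = (\<integral>\<^sup>+y. ennreal (max 0 (g a - \<epsilon> / 2)) * indicator {a<..a + h n} y \<partial>lborel)"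
        by (rule const[symmetric]) simp
      also have "\<dots> \<le> emeasure \<nu> {a<..a + h n}"
        unfolding emeas_h
      proof (rule nn_integral_mono)
        fix y
        show "ennreal (max 0 (g a - \<epsilon> / 2)) * indicator {a<..a + h n} y \<le> ennreal (g y) * indicator {a<..a + h n} y"
        proof (cases "y \<in> {a<..a + h n}")
          case True
          then have "max 0 (g a - \<epsilon> / 2) \<le> g y" using near[of y] g_nonneg[of y] by linarith
          then show ?thesis using True by (simp add: ennreal_leI)
        qed simp
      qed
      finally have low: "max 0 (g a - \<epsilon> / 2) * h n \<le> measure \<nu> {a<..a + h n}"
        by (simp add: emeasure_eq_measure)
      have "(g a - \<epsilon> / 2) * h n \<le> max 0 (g a - \<epsilon> / 2) * h n"
        using h[of n] by (intro mult_right_mono) auto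
      with low have low': "(g a - \<epsilon> / 2) * h n \<le> measure \<nu> {a<..a + h n}" by linarith
      have "measure \<nu> {a<..a + h n} / h n \<le> g a + \<epsilon> / 2" "g a - \<epsilon> / 2 \<le> measure \<nu> {a<..a + h n} / h n"
        using up low' h[of n] by (simp_all add: pos_divide_le_eq pos_le_divide_eq)
      then show ?case using \<open>\<epsilon> > 0\<close> unfolding dist_real_def by linarith
    qed
  qed
  let ?f = "\<lambda>n t. (iexp (- (t * a)) - iexp (- (t * (a + h n)))) / (\<i> * of_real t * of_real (h n)) * char \<nu> t"
  have "(\<lambda>n. LINT t|lborel. ?f n t) \<longlonglongrightarrow> (LINT t|lborel. iexp (- (t * a)) * char \<nu> t)"
  proof (rule integral_dominated_convergence[where w = "\<lambda>t. norm (char \<nu> t)"])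
    show "AE t in lborel. (\<lambda>n. ?f n t) \<longlonglongrightarrow> iexp (- (t * a)) * char \<nu> t"
      using AE_lborel_singleton[of "0::real"]
    proof eventually_elim
      case (elim t)
      have hc: "filterlim (\<lambda>n. of_real (h n) :: complex) (at 0) sequentially"
      proof (rule filterlim_atI)
        show "(\<lambda>n. of_real (h n) :: complex) \<longlonglongrightarrow> 0"
          using tendsto_of_real[OF h_lim, where 'a = complex] by simp
        show "\<forall>\<^sub>F n in sequentially. complex_of_real (h n) \<noteq> 0"
          using h by (intro always_eventually allI) (metis less_irrefl of_real_eq_0_iff)
      qed
      have "((\<lambda>z. exp (- (\<i> * of_real t) * z)) has_field_derivative (- (\<i> * of_real t))) (at 0)"
        by (auto intro!: derivative_eq_intros)
      then have "((\<lambda>z. (exp (- (\<i> * of_real t) * z) - 1) / z) \<longlongrightarrow> - (\<i> * of_real t)) (at 0)"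
        by (simp add: has_field_derivative_iff)
      from filterlim_compose[OF this hc]
      have "(\<lambda>n. (exp (- (\<i> * of_real t) * of_real (h n)) - 1) / of_real (h n)) \<longlonglongrightarrow> - (\<i> * of_real t)" .
      then have "(\<lambda>n. iexp (- (t * a)) * ((exp (- (\<i> * of_real t) * of_real (h n)) - 1) / of_real (h n)) / - (\<i> * of_real t) * char \<nu> t)
          \<longlonglongrightarrow> iexp (- (t * a)) * (- (\<i> * of_real t)) / - (\<i> * of_real t) * char \<nu> t"
        using elim by (intro tendsto_intros) auto
      moreover have "iexp (- (t * a)) * ((exp (- (\<i> * of_real t) * of_real (h n)) - 1) / of_real (h n)) / - (\<i> * of_real t) * char \<nu> t = ?f n t" for n
      proof -
        have "iexp (- (t * (a + h n))) = iexp (- (t * a)) * exp (- (\<i> * of_real t) * of_real (h n))"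
          by (simp add: exp_add[symmetric] algebra_simps)
        then show ?thesis using elim h[of n] by (simp only:) (simp add: field_simps)
      qed
      ultimately show ?case using elim by simp
    qed
    show "AE t in lborel. norm (?f n t) \<le> norm (char \<nu> t)" for n
    proof (rule AE_I2)
      fix t :: real
      show "norm (?f n t) \<le> norm (char \<nu> t)"
      proof (cases "t = 0")
        case False
        have "norm ((iexp (- (t * a)) - iexp (- (t * (a + h n)))) / (\<i> * of_real t)) \<le> h n"
          using Levy_Inversion_aux2[of "- (a + h n)" "- a" t] False h[of n] by (simp add: algebra_simps)
        then have "norm ((iexp (- (t * a)) - iexp (- (t * (a + h n)))) / (\<i> * of_real t * of_real (h n))) \<le> 1"
          using h[of n] False by (simp add: norm_divide norm_mult field_simps)
        then have "norm ((iexp (- (t * a)) - iexp (- (t * (a + h n)))) / (\<i> * of_real t * of_real (h n))) * norm (char \<nu> t) \<le> 1 * norm (char \<nu> t)"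
          by (rule mult_right_mono) simp
        then show ?thesis by (simp only: norm_mult mult_1_left)
      qed simp
    qed
    show "integrable lborel (\<lambda>t. norm (char \<nu> t))" using int by (rule integrable_norm)
  qed measurable
  moreover have "(LINT t|lborel. ?f n t) = of_real (2 * pi * (measure \<nu> {a<..a + h n} / h n))" for n
  proof -
    have "(LINT t|lborel. ?f n t) = (LINT t|lborel. (iexp (- (t * a)) - iexp (- (t * (a + h n)))) / (\<i> * t) * char \<nu> t / of_real (h n))"
      by (intro Bochner_Integration.integral_cong) (simp_all add: field_simps)
    also have "\<dots> = (LINT t|lborel. (iexp (- (t * a)) - iexp (- (t * (a + h n)))) / (\<i> * t) * char \<nu> t) / of_real (h n)"
      by (rule integral_divide_zero)
    also have "\<dots> = of_real (2 * pi * measure \<nu> {a<..a + h n}) / of_real (h n)"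
      using Levy_inversion_integrable[OF \<nu> int, of a "a + h n"] null h[of n] by simp
    finally show ?thesis by simp
  qed
  ultimately have "(\<lambda>n. of_real (2 * pi * (measure \<nu> {a<..a + h n} / h n)) :: complex) \<longlonglongrightarrow> (LINT t|lborel. iexp (- (t * a)) * char \<nu> t)"
    by simp
  moreover have "(\<lambda>n. of_real (2 * pi * (measure \<nu> {a<..a + h n} / h n)) :: complex) \<longlonglongrightarrow> of_real (2 * pi * g a)"
    by (intro tendsto_of_real tendsto_mult tendsto_const avg)
  ultimately show ?thesis by (rule LIMSEQ_unique[symmetric])
qed

section \<open>The local limit theorem\<close>

context local_limit_domain
begin

text \<open>The Fourier integrand of \<open>A n * P (S n = j)\<close> after the substitution \<open>t = A n * u\<close>, without
  the phase that depends on \<open>j\<close>.\<close>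

definition scaled_char :: "nat \<Rightarrow> real \<Rightarrow> complex" where
  "scaled_char n t = indicator {-pi..pi} (t / A (real n)) *\<^sub>R
     (char \<mu> (t / A (real n)) ^ n * iexp (- (t * (centering \<mu> n / A (real n)))))"

lemma limit_exponent_tendsto:
  assumes "\<And>r. \<theta> r > 0" "\<theta> \<longlonglongrightarrow> \<theta>'" "\<theta>' > 0"
  shows "(\<lambda>r. limit_exponent (\<theta> r) t) \<longlonglongrightarrow> limit_exponent \<theta>' t"
  unfolding limit_exponent_def
  by (intro tendsto_add right.levy_exponent_tendsto(1) left.levy_exponent_tendsto(1) \<alpha>_less_2 assms)

text \<open>The position parameter need not converge, but it stays in a compact subset of the positive
  half-line, so that along suitable subsequences both terms have the same limit.\<close>

lemma scaled_char_minus_limit_tendsto_0: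
  "(\<lambda>n. scaled_char n t - exp (limit_exponent (position_parameter k n) t)) \<longlonglongrightarrow> 0"
proof (rule ccontr)
  define X where "X n = scaled_char n t - exp (limit_exponent (position_parameter k n) t)" for n
  assume "\<not> (\<lambda>n. scaled_char n t - exp (limit_exponent (position_parameter k n) t)) \<longlonglongrightarrow> 0"
  then have "\<not> X \<longlonglongrightarrow> 0" by (simp add: X_def[abs_def])
  then obtain \<epsilon> where \<epsilon>: "\<epsilon> > 0" "\<And>N. \<exists>n\<ge>N. \<epsilon> \<le> norm (X n)"
    by (auto simp: LIMSEQ_iff not_less)
  then have "\<forall>j. \<exists>n\<ge>Suc j. \<epsilon> \<le> norm (X n)" by blast
  then obtain n where n: "\<And>j. Suc j \<le> n j" "\<And>j. \<epsilon> \<le> norm (X (n j))"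
    by metis
  obtain d where d: "d > 0" "\<And>n. 1 \<le> n \<Longrightarrow> d \<le> position_parameter k n \<and> position_parameter k n \<le> 1"
    using position_parameter_bounds by blast
  have "position_parameter k (n j) \<in> {d..1}" for j
    using d(2)[of "n j"] n(1)[of j] by simp
  moreover have "compact {d..1}" by simp
  ultimately obtain \<theta> \<sigma> where \<sigma>: "\<theta> \<in> {d..1}" "strict_mono \<sigma>" "((\<lambda>j. position_parameter k (n j)) \<circ> \<sigma>) \<longlonglongrightarrow> \<theta>"
    unfolding compact_def by metis
  have "\<theta> > 0" using \<sigma>(1) d(1) by simp
  have lim: "(\<lambda>j. position_parameter k (n (\<sigma> j))) \<longlonglongrightarrow> \<theta>"
    using \<sigma>(3) by (simp add: o_def)
  have n_top: "filterlim (\<lambda>j. n (\<sigma> j)) sequentially sequentially"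
    unfolding filterlim_at_top
  proof
    fix Z
    show "\<forall>\<^sub>F j in sequentially. Z \<le> n (\<sigma> j)"
      using eventually_ge_at_top[of Z]
    proof eventually_elim
      case (elim j)
      then show ?case using strict_mono_imp_increasing[OF \<sigma>(2), of j] n(1)[of "\<sigma> j"] by linarith
    qed
  qed
  have A_top: "filterlim (\<lambda>j. A (real (n (\<sigma> j)))) at_top sequentially"
    by (rule filterlim_compose[OF A_at_top filterlim_compose[OF filterlim_real_sequentially n_top]])
  have pos: "position_parameter k (n (\<sigma> j)) > 0" for j
    using d(1) d(2)[of "n (\<sigma> j)"] n(1)[of "\<sigma> j"] by simp
  have "(\<lambda>j. char \<mu> (t / A (real (n (\<sigma> j)))) ^ n (\<sigma> j) * iexp (- (t * (centering \<mu> (n (\<sigma> j)) / A (real (n (\<sigma> j)))))))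
    \<longlonglongrightarrow> exp (limit_exponent \<theta> t)"
    by (rule char_tendsto[OF n_top lim \<open>\<theta> > 0\<close> tendsto_const])
  moreover have "\<forall>\<^sub>F j in sequentially. char \<mu> (t / A (real (n (\<sigma> j)))) ^ n (\<sigma> j) * iexp (- (t * (centering \<mu> (n (\<sigma> j)) / A (real (n (\<sigma> j))))))
      = scaled_char (n (\<sigma> j)) t"
    using filterlim_at_top_dense[THEN iffD1, OF A_top, rule_format, of "\<bar>t\<bar>"]
  proof eventually_elim
    case (elim j)
    then have "\<bar>t / A (real (n (\<sigma> j)))\<bar> < 1" by (simp add: abs_divide)
    then have "- pi \<le> t / A (real (n (\<sigma> j)))" "t / A (real (n (\<sigma> j))) \<le> pi"
      using pi_gt3 by linarith+
    then show ?case by (simp add: scaled_char_def)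
  qed
  ultimately have "(\<lambda>j. scaled_char (n (\<sigma> j)) t) \<longlonglongrightarrow> exp (limit_exponent \<theta> t)"
    by (rule Lim_transform_eventually)
  moreover have "(\<lambda>j. exp (limit_exponent (position_parameter k (n (\<sigma> j))) t)) \<longlonglongrightarrow> exp (limit_exponent \<theta> t)"
    by (intro tendsto_exp limit_exponent_tendsto pos lim \<open>\<theta> > 0\<close>)
  ultimately have "(\<lambda>j. X (n (\<sigma> j))) \<longlonglongrightarrow> exp (limit_exponent \<theta> t) - exp (limit_exponent \<theta> t)"
    unfolding X_def by (rule tendsto_diff)
  then have "\<forall>\<^sub>F j in sequentially. norm (X (n (\<sigma> j))) < \<epsilon>"
    using \<epsilon>(1) by (simp add: tendsto_iff)
  then have "\<exists>j. norm (X (n (\<sigma> j))) < \<epsilon>"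
    by (rule eventually_happens'[OF trivial_limit_sequentially])
  then show False using n(2) by (meson not_less)
qed

lemma char_semistable_law:
  assumes "semistable_law \<alpha> M\<^sub>R M\<^sub>L \<theta> \<nu>"
  shows "char \<nu> = (\<lambda>t. exp (limit_exponent \<theta> t))"
  using assms by (auto simp: semistable_law_def semistable_exponent_eq)

text \<open>Both inversion formulas carry the same phase \<open>exp (- i t x)\<close>, so that one bound, the L1 distance of the
  transforms, serves for all \<open>j\<close> at once.\<close>

theorem uniform_lattice_approximation:
  fixes \<nu> :: "nat \<Rightarrow> real measure"
  assumes V: "\<And>\<theta>. \<theta> > 0 \<Longrightarrow> semistable_law \<alpha> M\<^sub>R M\<^sub>L \<theta> (V \<theta>)"
    and g: "\<And>\<theta>. \<theta> > 0 \<Longrightarrow> continuous_density (V \<theta>) (g \<theta>)"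
    and \<nu>: "\<And>n. real_distribution (\<nu> n)" "\<And>n. AE x in \<nu> n. x \<in> \<int>" "\<And>n t. char (\<nu> n) t = char \<mu> t ^ n"
  obtains e where "e \<longlonglongrightarrow> 0"
    "\<And>n j. 1 \<le> n \<Longrightarrow> \<bar>A (real n) * measure (\<nu> n) {of_int j} - g (position_parameter k n) ((of_int j - centering \<mu> n) / A (real n))\<bar> \<le> e n"
proof -
  obtain d where d: "d > 0" "\<And>n. 1 \<le> n \<Longrightarrow> d \<le> position_parameter k n \<and> position_parameter k n \<le> 1"
    using position_parameter_bounds by blast
  have pos: "position_parameter k n > 0" if "1 \<le> n" for n
    using d(1) d(2)[OF that] by linarith
  obtain D\<^sub>1 where D1: "\<And>n t. 1 \<le> n \<Longrightarrow> \<bar>t\<bar> \<le> pi * A (real n) \<Longrightarrow> norm (char \<mu> (t / A (real n))) ^ n \<le> D\<^sub>1 / (1 + t\<^sup>2)"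
    using norm_char_power_bound by blast
  obtain D\<^sub>2 where D2: "\<And>\<theta> t. \<theta> > 0 \<Longrightarrow> norm (exp (limit_exponent \<theta> t)) \<le> D\<^sub>2 / (1 + t\<^sup>2)"
    using norm_limit_char_bound by blast
  define \<Psi> where "\<Psi> n t = exp (limit_exponent (position_parameter k n) t)" for n t
  have char_V: "char (V (position_parameter k n)) = \<Psi> n" if "1 \<le> n" for n
    using char_semistable_law[OF V[OF pos[OF that]]] by (simp add: \<Psi>_def[abs_def])
  have dist_V: "real_distribution (V (position_parameter k n))" if "1 \<le> n" for n
    using V[OF pos[OF that]] by (simp add: semistable_law_def)
  have char_meas [measurable]: "char \<mu> \<in> borel_measurable borel"
    using \<mu> by (rule real_distribution.char_measurable)
  have \<Psi>_meas: "\<Psi> n \<in> borel_measurable borel" if "1 \<le> n" for n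
    using real_distribution.char_measurable[OF dist_V[OF that]] char_V[OF that] by simp
  have scaled_meas: "scaled_char n \<in> borel_measurable borel" for n
    unfolding scaled_char_def[abs_def] by measurable
  have scaled_bound: "norm (scaled_char n t) \<le> \<bar>D\<^sub>1\<bar> / (1 + t\<^sup>2)" if n: "1 \<le> n" for n t
  proof (cases "t / A (real n) \<in> {-pi..pi}")
    case True
    have An: "A (real n) > 0" using n by (intro A_pos) simp
    then have "\<bar>t\<bar> \<le> pi * A (real n)" using True by (auto simp: field_simps abs_le_iff)
    then have "norm (char \<mu> (t / A (real n))) ^ n \<le> D\<^sub>1 / (1 + t\<^sup>2)" using n by (intro D1)
    also have "\<dots> \<le> \<bar>D\<^sub>1\<bar> / (1 + t\<^sup>2)" by (intro divide_right_mono) auto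
    finally show ?thesis using True by (simp add: scaled_char_def norm_mult norm_power)
  qed (simp add: scaled_char_def)
  have \<Psi>_bound: "norm (\<Psi> n t) \<le> D\<^sub>2 / (1 + t\<^sup>2)" if "1 \<le> n" for n t
    unfolding \<Psi>_def by (rule D2[OF pos[OF that]])
  have \<Psi>_int: "integrable lborel (\<Psi> n)" if "1 \<le> n" for n
  proof (rule Bochner_Integration.integrable_bound[OF integrable_inverse_square[of D\<^sub>2]])
    show "\<Psi> n \<in> borel_measurable lborel" using \<Psi>_meas[OF that] by simp
    show "AE t in lborel. norm (\<Psi> n t) \<le> norm (D\<^sub>2 / (1 + t\<^sup>2))"
      unfolding real_norm_def by (intro AE_I2 order_trans[OF \<Psi>_bound[OF that] abs_ge_self])
  qed
  have scaled_int: "integrable lborel (scaled_char n)" if "1 \<le> n" for n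
  proof (rule Bochner_Integration.integrable_bound[OF integrable_inverse_square[of "\<bar>D\<^sub>1\<bar>"]])
    show "scaled_char n \<in> borel_measurable lborel" using scaled_meas by simp
    show "AE t in lborel. norm (scaled_char n t) \<le> norm (\<bar>D\<^sub>1\<bar> / (1 + t\<^sup>2))"
      unfolding real_norm_def by (intro AE_I2 order_trans[OF scaled_bound[OF that] abs_ge_self])
  qed
  define e where "e n = (LINT t|lborel. norm (scaled_char n t - \<Psi> n t)) / (2 * pi)" for n
  have "(\<lambda>n. LINT t|lborel. norm (scaled_char (Suc n) t - \<Psi> (Suc n) t)) \<longlonglongrightarrow> (LINT (t::real)|lborel. (0::real))"
  proof (rule integral_dominated_convergence[where w = "\<lambda>t. \<bar>D\<^sub>1\<bar> / (1 + t\<^sup>2) + D\<^sub>2 / (1 + t\<^sup>2)"])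
    show "(\<lambda>t. norm (scaled_char (Suc n) t - \<Psi> (Suc n) t)) \<in> borel_measurable lborel" for n
      using scaled_meas[of "Suc n"] \<Psi>_meas[of "Suc n"] by simp
    show "integrable lborel (\<lambda>t. \<bar>D\<^sub>1\<bar> / (1 + t\<^sup>2) + D\<^sub>2 / (1 + t\<^sup>2))"
      by (intro Bochner_Integration.integrable_add integrable_inverse_square)
    show "AE t in lborel. (\<lambda>n. norm (scaled_char (Suc n) t - \<Psi> (Suc n) t)) \<longlonglongrightarrow> 0"
    proof (rule AE_I2)
      fix t :: real
      have "(\<lambda>n. scaled_char (Suc n) t - \<Psi> (Suc n) t) \<longlonglongrightarrow> 0"
        using LIMSEQ_Suc[OF scaled_char_minus_limit_tendsto_0[of t]] by (simp add: \<Psi>_def)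
      then show "(\<lambda>n. norm (scaled_char (Suc n) t - \<Psi> (Suc n) t)) \<longlonglongrightarrow> 0"
        by (rule tendsto_norm_zero)
    qed
    show "AE t in lborel. norm (norm (scaled_char (Suc n) t - \<Psi> (Suc n) t)) \<le> \<bar>D\<^sub>1\<bar> / (1 + t\<^sup>2) + D\<^sub>2 / (1 + t\<^sup>2)" for n
    proof (rule AE_I2)
      fix t :: real
      have "norm (scaled_char (Suc n) t - \<Psi> (Suc n) t) \<le> norm (scaled_char (Suc n) t) + norm (\<Psi> (Suc n) t)"
        by (rule norm_triangle_ineq4)
      then show "norm (norm (scaled_char (Suc n) t - \<Psi> (Suc n) t)) \<le> \<bar>D\<^sub>1\<bar> / (1 + t\<^sup>2) + D\<^sub>2 / (1 + t\<^sup>2)"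
        using scaled_bound[of "Suc n" t] \<Psi>_bound[of "Suc n" t] by simp
    qed
  qed simp
  then have "(\<lambda>n. e (Suc n)) \<longlonglongrightarrow> 0"
    unfolding e_def by (intro tendsto_divide_zero) simp
  then have "e \<longlonglongrightarrow> 0" by (rule LIMSEQ_imp_Suc)
  moreover have "\<bar>A (real n) * measure (\<nu> n) {of_int j} - g (position_parameter k n) ((of_int j - centering \<mu> n) / A (real n))\<bar> \<le> e n"
    if n: "1 \<le> n" for n j
  proof -
    define a where "a = A (real n)"
    have a: "a > 0" unfolding a_def using n by (intro A_pos) simp
    define x where "x = (of_int j - centering \<mu> n) / a"
    have "2 * pi * measure (\<nu> n) {of_int j} = (LINT u:{-pi..pi}|lborel. iexp (- (u * of_int j)) * char (\<nu> n) u)"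
      by (rule lattice_inversion[OF \<nu>(1,2)])
    also have "\<dots> = (LINT u|lborel. indicator {-pi..pi} u *\<^sub>R (iexp (- (u * of_int j)) * char \<mu> u ^ n))"
      by (simp add: set_lebesgue_integral_def \<nu>(3))
    also have "\<dots> = \<bar>1 / a\<bar> *\<^sub>R (LINT t|lborel. indicator {-pi..pi} (0 + 1 / a * t) *\<^sub>R (iexp (- ((0 + 1 / a * t) * of_int j)) * char \<mu> (0 + 1 / a * t) ^ n))"
      using a by (intro lborel_integral_real_affine) simp
    also have "(\<lambda>t. indicator {-pi..pi} (0 + 1 / a * t) *\<^sub>R (iexp (- ((0 + 1 / a * t) * of_int j)) * char \<mu> (0 + 1 / a * t) ^ n)) = (\<lambda>t. iexp (- (t * x)) * scaled_char n t)"
    proof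
      fix t
      have "iexp (- (t / a * of_int j)) = iexp (- (t * x)) * iexp (- (t * (centering \<mu> n / a)))"
        using a by (subst exp_add[symmetric], intro arg_cong[where f = exp]) (simp add: x_def field_simps)
      then show "indicator {-pi..pi} (0 + 1 / a * t) *\<^sub>R (iexp (- ((0 + 1 / a * t) * of_int j)) * char \<mu> (0 + 1 / a * t) ^ n) = iexp (- (t * x)) * scaled_char n t"
        unfolding scaled_char_def a_def[symmetric] by (simp add: mult_ac)
    qed
    finally have P: "of_real (2 * pi * (a * measure (\<nu> n) {of_int j})) = (LINT t|lborel. iexp (- (t * x)) * scaled_char n t)"
      using a by (simp add: scaleR_conv_of_real field_simps)
    have G: "of_real (2 * pi * g (position_parameter k n) x) = (LINT t|lborel. iexp (- (t * x)) * \<Psi> n t)"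
      using density_inversion[OF dist_V[OF n] _ g[OF pos[OF n]], of x] \<Psi>_int[OF n] char_V[OF n] by simp
    have unit: "norm (iexp (- (t * x)) * z) = norm z" for t z
      by (simp add: norm_mult)
    have e_meas: "(\<lambda>t. iexp (- (t * x))) \<in> borel_measurable lborel"
      by measurable
    have unit_int: "integrable lborel (\<lambda>t. iexp (- (t * x)) * f t)" if "integrable lborel f" for f
    proof (rule Bochner_Integration.integrable_bound[OF that])
      show "(\<lambda>t. iexp (- (t * x)) * f t) \<in> borel_measurable lborel"
        using e_meas borel_measurable_integrable[OF that] by (rule borel_measurable_times)
      show "AE t in lborel. norm (iexp (- (t * x)) * f t) \<le> norm (f t)"
        unfolding unit by simp
    qed
    note int1 = unit_int[OF scaled_int[OF n]] and int2 = unit_int[OF \<Psi>_int[OF n]]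
    have "2 * pi * \<bar>a * measure (\<nu> n) {of_int j} - g (position_parameter k n) x\<bar> =
        norm (complex_of_real (2 * pi * (a * measure (\<nu> n) {of_int j})) - complex_of_real (2 * pi * g (position_parameter k n) x))"
      unfolding of_real_diff[symmetric] norm_of_real by (simp add: right_diff_distrib[symmetric] abs_mult)
    also have "\<dots> = norm (LINT t|lborel. iexp (- (t * x)) * (scaled_char n t - \<Psi> n t))"
      unfolding P G by (subst Bochner_Integration.integral_diff[OF int1 int2, symmetric]) (simp add: right_diff_distrib)
    also have "\<dots> \<le> (LINT t|lborel. norm (iexp (- (t * x)) * (scaled_char n t - \<Psi> n t)))"
      by (rule integral_norm_bound)
    also have "\<dots> = 2 * pi * e n"
      unfolding unit by (simp add: e_def)
    finally show ?thesis
      using pi_gt_zero by (simp add: a_def x_def)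
  qed
  ultimately show thesis by (rule that)
qed

end

lemma upper_tail_tendsto_0:
  assumes "real_distribution \<mu>"
  shows "((\<lambda>x. measure \<mu> {x<..}) \<longlongrightarrow> 0) at_top"
proof -
  interpret real_distribution \<mu> by (rule assms)
  have "((\<lambda>x. 1 - cdf \<mu> x) \<longlongrightarrow> 1 - 1) at_top"
    by (intro tendsto_intros cdf_lim_at_top_prob)
  moreover have "1 - cdf \<mu> x = measure \<mu> {x<..}" for x
    using prob_compl[of "{..x}"] by (simp add: cdf_def Compl_eq_Diff_UNIV[symmetric])
  ultimately show ?thesis by simp
qed

lemma lower_tail_tendsto_0:
  assumes "real_distribution \<mu>"
  shows "((\<lambda>x. measure \<mu> {..<- x}) \<longlongrightarrow> 0) at_top"
proof -
  interpret real_distribution \<mu> by (rule assms)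
  have "((\<lambda>x. cdf \<mu> (- x)) \<longlongrightarrow> 0) at_top"
    by (rule filterlim_compose[OF cdf_lim_at_bot filterlim_uminus_at_bot_at_top])
  then show ?thesis
  proof (rule Lim_null_comparison[rotated])
    show "\<forall>\<^sub>F x in at_top. norm (measure \<mu> {..<- x}) \<le> cdf \<mu> (- x)"
      unfolding cdf_def by (intro always_eventually allI) (auto intro!: finite_measure_mono)
  qed
qed

lemma tail_profile_positive:
  assumes "tail_profile \<alpha> c M" "\<not> (\<forall>x>0. M x = 0)"
  shows "\<exists>a>0. \<forall>x>0. a \<le> M x"
  using assms by (auto simp: tail_profile_def)

theorem theorem2:
  fixes \<Omega> :: "'a measure" and X :: "nat \<Rightarrow> 'a \<Rightarrow> int"
    and \<mu> :: "real measure"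
    and \<alpha> c :: real and k :: "nat \<Rightarrow> nat"
    and l\<^sub>1 M\<^sub>R M\<^sub>L h\<^sub>R h\<^sub>L :: "real \<Rightarrow> real"
    and A l \<delta> :: "real \<Rightarrow> real"
    and V :: "real \<Rightarrow> real measure" and g :: "real \<Rightarrow> real \<Rightarrow> real"
  assumes alpha: "0 < \<alpha>" "\<alpha> < 2"
    and prob: "prob_space \<Omega>"
    and indep: "prob_space.indep_vars \<Omega> (\<lambda>_. count_space UNIV) X UNIV"
    and ident: "\<And>i. distr \<Omega> (count_space UNIV) (X i) = distr \<Omega> (count_space UNIV) (X 0)"
    and law: "\<mu> = distr \<Omega> borel (\<lambda>\<omega>. real_of_int (X 0 \<omega>))"
    and span: "has_span \<mu> 1"
    and c: "c > 1"
    and k: "k 0 = 0" "strict_mono k" "(\<lambda>n. real (k (Suc n)) / real (k n)) \<longlonglongrightarrow> c"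
    and slow: "slowly_varying_on 1 l\<^sub>1"
    and A: "A = norming \<alpha> l\<^sub>1"
    and ell: "l = tail_slow \<alpha> l\<^sub>1"
    and delta: "\<delta> = relative_position k A"
    and right_profile: "tail_profile \<alpha> c M\<^sub>R"
    and left_profile: "tail_profile \<alpha> c M\<^sub>L"
    and not_both_zero: "\<not> ((\<forall>x>0. M\<^sub>R x = 0) \<and> (\<forall>x>0. M\<^sub>L x = 0))"
    and not_both_constant: "\<not> (M\<^sub>R constant_on {0<..} \<and> M\<^sub>L constant_on {0<..})"
    and hR_right_cont: "\<And>x. x > 0 \<Longrightarrow> continuous (at_right x) h\<^sub>R"
    and hL_right_cont: "\<And>x. x > 0 \<Longrightarrow> continuous (at_right x) h\<^sub>L"
    and hR_lim: "\<And>x. x > 0 \<Longrightarrow> isCont M\<^sub>R x \<Longrightarrow> (\<lambda>n. h\<^sub>R (A (real (k n)) * x)) \<longlonglongrightarrow> 0"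
    and hL_lim: "\<And>x. x > 0 \<Longrightarrow> isCont M\<^sub>L x \<Longrightarrow> (\<lambda>n. h\<^sub>L (A (real (k n)) * x)) \<longlonglongrightarrow> 0"
    and right_tail: "eventually (\<lambda>x. measure \<mu> {x<..} = l x / x powr \<alpha> * (M\<^sub>R (\<delta> x) + h\<^sub>R x)) at_top"
    and left_tail: "eventually (\<lambda>x. measure \<mu> {..<-x} = l x / x powr \<alpha> * (M\<^sub>L (\<delta> x) + h\<^sub>L x)) at_top"
    and V: "\<And>\<theta>. \<theta> > 0 \<Longrightarrow> semistable_law \<alpha> M\<^sub>R M\<^sub>L \<theta> (V \<theta>)"
    and g: "\<And>\<theta>. \<theta> > 0 \<Longrightarrow> continuous_density (V \<theta>) (g \<theta>)"
  shows "(\<lambda>n. SUP j::int. ereal \<bar>A (real n) * measure \<Omega> {\<omega> \<in> space \<Omega>. (\<Sum>i=1..n. X i \<omega>) = j}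
              - g (position_parameter k n) ((of_int j - centering \<mu> n) / A (real n))\<bar>)
           \<longlonglongrightarrow> 0"
proof -
  interpret P: prob_space \<Omega> by (rule prob)
  have X_meas [measurable]: "X i \<in> measurable \<Omega> (count_space UNIV)" for i
    using indep by (simp add: P.indep_vars_def)
  have real_X_meas [measurable]: "(\<lambda>\<omega>. real_of_int (X i \<omega>)) \<in> borel_measurable \<Omega>" for i
    by measurable
  have \<mu>: "real_distribution \<mu>"
    unfolding law by (rule P.real_distribution_distr[OF real_X_meas])
  have aperiodic: "norm (char \<mu> t) < 1" if "0 < \<bar>t\<bar>" "\<bar>t\<bar> \<le> pi" for t
    using span_one_norm_char_less_1[OF \<mu> span] that by blast
  interpret geometric_norming \<alpha> l\<^sub>1 c k
    using alpha slow c k by unfold_locales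
  have tail_R: "\<forall>\<^sub>F x in at_top. measure \<mu> {x<..} = tail_slow \<alpha> l\<^sub>1 x / x powr \<alpha> * (M\<^sub>R (relative_position k (norming \<alpha> l\<^sub>1) x) + h\<^sub>R x)"
    using right_tail by (simp add: ell delta A)
  have tail_L: "\<forall>\<^sub>F x in at_top. measure \<mu> {..<- x} = tail_slow \<alpha> l\<^sub>1 x / x powr \<alpha> * (M\<^sub>L (relative_position k (norming \<alpha> l\<^sub>1) x) + h\<^sub>L x)"
    using left_tail by (simp add: ell delta A)
  have h_R: "(\<lambda>n. h\<^sub>R (norming \<alpha> l\<^sub>1 (real (k n)) * x)) \<longlonglongrightarrow> 0" if "x > 0" "isCont M\<^sub>R x" for x
    using hR_lim[OF that] by (simp add: A)
  have h_L: "(\<lambda>n. h\<^sub>L (norming \<alpha> l\<^sub>1 (real (k n)) * x)) \<longlonglongrightarrow> 0" if "x > 0" "isCont M\<^sub>L x" for x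
    using hL_lim[OF that] by (simp add: A)
  have positive: "(\<exists>a>0. \<forall>x>0. a \<le> M\<^sub>R x) \<or> (\<exists>a>0. \<forall>x>0. a \<le> M\<^sub>L x)"
    using not_both_zero tail_profile_positive[OF right_profile] tail_profile_positive[OF left_profile] by blast
  have bounded: "\<exists>B. \<forall>w\<in>{1..Z}. norming \<alpha> l\<^sub>1 w \<le> B" for Z
    using positive
  proof
    assume "\<exists>a>0. \<forall>x>0. a \<le> M\<^sub>R x"
    then obtain a where "a > 0" "\<And>x. x > 0 \<Longrightarrow> a \<le> M\<^sub>R x" by auto
    then show ?thesis
      by (rule A_locally_bounded[OF right_profile _ _ h_R tail_R upper_tail_tendsto_0[OF \<mu>]])
  next
    assume "\<exists>a>0. \<forall>x>0. a \<le> M\<^sub>L x"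
    then obtain a where "a > 0" "\<And>x. x > 0 \<Longrightarrow> a \<le> M\<^sub>L x" by auto
    then show ?thesis
      by (rule A_locally_bounded[OF left_profile _ _ h_L tail_L lower_tail_tendsto_0[OF \<mu>]])
  qed
  interpret local_limit_domain \<alpha> l\<^sub>1 c k \<mu> M\<^sub>R M\<^sub>L h\<^sub>R h\<^sub>L
    by (intro local_limit_domain.intro local_limit_domain_axioms.intro semistable_domain.intro
        semistable_domain_axioms.intro bounded_norming.intro bounded_norming_axioms.intro geometric_norming_axioms)
      (fact bounded alpha \<mu> right_profile left_profile h_R h_L tail_R tail_L positive aperiodic)+
  define \<nu> where "\<nu> n = distr \<Omega> borel (\<lambda>\<omega>. \<Sum>i\<in>{1..n}. real_of_int (X i \<omega>))" for n
  have law_i: "distr \<Omega> borel (\<lambda>\<omega>. real_of_int (X i \<omega>)) = \<mu>" for i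
  proof -
    have "distr \<Omega> borel (\<lambda>\<omega>. real_of_int (X i \<omega>)) = distr (distr \<Omega> (count_space UNIV) (X i)) borel real_of_int" for i
      by (subst distr_distr) (auto simp: o_def)
    then show ?thesis unfolding law using ident[of i] by simp
  qed
  have char_\<nu>: "char (\<nu> n) t = char \<mu> t ^ n" for n t
  proof -
    have "P.indep_vars (\<lambda>_. borel) (\<lambda>i \<omega>. real_of_int (X i \<omega>)) UNIV"
      using indep by (rule P.indep_vars_compose2) simp
    then have "P.indep_vars (\<lambda>_. borel) (\<lambda>i \<omega>. real_of_int (X i \<omega>)) {1..n}"
      by (rule P.indep_vars_subset) simp
    then have "char (\<nu> n) t = (\<Prod>i\<in>{1..n}. char (distr \<Omega> borel (\<lambda>\<omega>. real_of_int (X i \<omega>))) t)"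
      unfolding \<nu>_def by (rule P.char_distr_sum)
    then show ?thesis by (simp add: law_i)
  qed
  have dist_\<nu>: "real_distribution (\<nu> n)" for n
    unfolding \<nu>_def by (rule P.real_distribution_distr) measurable
  have int_\<nu>: "AE x in \<nu> n. x \<in> \<int>" for n
    unfolding \<nu>_def by (subst AE_distr_iff) (auto intro!: AE_I2 Ints_sum)
  have prob_\<nu>: "measure (\<nu> n) {of_int j} = measure \<Omega> {\<omega> \<in> space \<Omega>. (\<Sum>i=1..n. X i \<omega>) = j}" for n j
  proof -
    have "(\<lambda>\<omega>. \<Sum>i\<in>{1..n}. real_of_int (X i \<omega>)) -` {of_int j} \<inter> space \<Omega> = {\<omega> \<in> space \<Omega>. (\<Sum>i=1..n. X i \<omega>) = j}"
      by (auto simp flip: of_int_sum)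
    then show ?thesis unfolding \<nu>_def by (subst measure_distr) auto
  qed
  obtain e where e: "e \<longlonglongrightarrow> 0"
    "\<And>n j. 1 \<le> n \<Longrightarrow> \<bar>norming \<alpha> l\<^sub>1 (real n) * measure (\<nu> n) {of_int j} - g (position_parameter k n) ((of_int j - centering \<mu> n) / norming \<alpha> l\<^sub>1 (real n))\<bar> \<le> e n"
    using uniform_lattice_approximation[OF V g dist_\<nu> int_\<nu> char_\<nu>] by blast
  let ?S = "\<lambda>n. SUP j::int. ereal \<bar>A (real n) * measure \<Omega> {\<omega> \<in> space \<Omega>. (\<Sum>i=1..n. X i \<omega>) = j}
              - g (position_parameter k n) ((of_int j - centering \<mu> n) / A (real n))\<bar>"
  show ?thesis
  proof (rule tendsto_sandwich)
    show "\<forall>\<^sub>F n in sequentially. 0 \<le> ?S n"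
      by (intro always_eventually allI SUP_upper2[of 0]) auto
    show "\<forall>\<^sub>F n in sequentially. ?S n \<le> ereal (e n)"
      using eventually_ge_at_top[of 1]
    proof eventually_elim
      case (elim n)
      show ?case using e(2)[OF elim] by (intro SUP_least) (simp add: A prob_\<nu>)
    qed
    show "(\<lambda>_. 0 :: ereal) \<longlonglongrightarrow> 0" by simp
    show "(\<lambda>n. ereal (e n)) \<longlonglongrightarrow> 0" using tendsto_ereal[OF e(1)] by (simp add: zero_ereal_def)
  qed
qed

end
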